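(* Let $L$ be a language, let $\mathcal R$ be a Ramsey class of finite irreducible $L$-structures and let $\mathcal U$ be a closure description for $L$. Then every $(\mathcal R,\mathcal U)$-multiamalgamation class $\mathcal K$ is Ramsey.
   Context: Structures. A language $L$ consists of relation symbols and function symbols, each with an arity (a positive integer). An $L$-structure $\mathbf A$ has a countable (possibly empty) vertex set $A$, a relation $R_{\mathbf A}\subseteq A^r$ for each relation symbol $R$ of arity $r$, and a partial function $F_{\mathbf A}:\mathrm{Dom}(F_{\mathbf A})\to A$ with $\mathrm{Dom}(F_{\mathbf A})\subseteq A^r$ for each function symbol $F$ of arity $r$. A homomorphism $f:\mathbf A\to\mathbf B$ is a map $f:A\to B$ such that (coordinatewise) $f(R_{\mathbf A})\subseteq R_{\mathbf B}$, $f(\mathrm{Dom}(F_{\mathbf A}))\subseteq\mathrm{Dom}(F_{\mathbf B})$ and $f(F_{\mathbf A}(\bar x))=F_{\mathbf B}(f(\bar x))$. An embedding is an injective homomorphism with $\bar x\in R_{\mathbf A}\iff f(\bar x)\in R_{\mathbf B}$ and $\bar x\in\mathrm{Dom}(F_{\mathbf A})\iff f(\bar x)\in\mathrm{Dom}(F_{\mathbf B})$. $\mathbf A$ is a substructure of $\mathbf B$ if $A\subseteq B$ and the inclusion is an embedding. Classes of structures are closed under isomorphism. Ramsey. $\binom{\mathbf B}{\mathbf A}$ is the set of substructures (copies) of $\mathbf B$ isomorphic to $\mathbf A$. $\mathbf C\longrightarrow(\mathbf B)^{\mathbf A}_k$ means: for every partition of $\binom{\mathbf C}{\mathbf A}$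 into $k$ classes there is $\widetilde{\mathbf B}\in\binom{\mathbf C}{\mathbf B}$ such that $\binom{\widetilde{\mathbf B}}{\mathbf A}$ is contained in one class. A class $\mathcal C$ is Ramsey if for all $\mathbf A,\mathbf B\in\mathcal C$, $k\ge1$ there is $\mathbf C\in\mathcal C$ with $\mathbf C\longrightarrow(\mathbf B)^{\mathbf A}_k$. Amalgamation. Given embeddings $\alpha_i:\mathbf A\to\mathbf B_i$, a strong amalgamation of $\mathbf B_1,\mathbf B_2$ over $\mathbf A$ (with respect to $\alpha_1,\alpha_2$) is a structure $\mathbf C$ with embeddings $\beta_i:\mathbf B_i\to\mathbf C$ such that $\beta_1\alpha_1=\beta_2\alpha_2$ and $\beta_1(B_1)\cap\beta_2(B_2)=\beta_1\alpha_1(A)$. It is free if moreover $C=\beta_1(B_1)\cup\beta_2(B_2)$ and no tuple in a relation of $\mathbf C$ or in the domain of a function of $\mathbf C$ contains both a vertex of $\beta_1(B_1\setminus\alpha_1(A))$ and a vertex of $\beta_2(B_2\setminus\alpha_2(A))$. A structure is irreducible if it is not a free amalgamation of two of its proper substructures. Closure descriptions. A closure description $\mathcal U$ (for $L$) is a set of pairs $(R^U,\mathbf R)$ where $R^U\in L$ is a relation symbol of some arity $n$ and $\mathbf R$ is a non-empty irreducible $L$-structure (a root) on vertices $\{1,\dots,m\}$ with $m<n$. For a relation symbol $R$ of arity $n$, the $R_{\mathbf A}$-out-degree of a $k$-tuple $(v_1,\dots,v_k)$ is the number of $(n-k)$-tuples $(v_{k+1},\dots,v_n)$ with $(v_1,\dots,v_n)\in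 R_{\mathbf A}$. $\mathbf A$ is $\mathcal U$-closed if for every $(R^U,\mathbf R)\in\mathcal U$ and every $|R|$-tuple $\bar t$ of vertices of $\mathbf A$, the $R^U_{\mathbf A}$-out-degree of $\bar t$ is one if $\bar t$ represents an embedding into $\mathbf A$ (i.e. $i\mapsto t_i$ is an embedding) of some root $\mathbf S$ with $|S|=|R|$ and $(R^U,\mathbf S)\in\mathcal U$, and is zero otherwise. A $\mathcal U$-closed substructure is a substructure which is $\mathcal U$-closed; the empty structure is $\mathcal U$-closed. $\mathcal U$-irreducibility and completions. A $\mathcal U$-closed structure is $\mathcal U$-irreducible if it is not a free amalgamation of two of its proper $\mathcal U$-closed substructures. A $\mathcal U$-homomorphism-embedding $f:\mathbf A\to\mathbf B$ is a homomorphism whose restriction to every ($\mathcal U$-closed) $\mathcal U$-irreducible substructure of $\mathbf A$ is an embedding. An irreducible structure $\mathbf C'$ is a $\mathcal U$-completion of $\mathbf C$ if there is a $\mathcal U$-homomorphism-embedding $\mathbf C\to\mathbf C'$; if $\mathbf C'\in\mathcal K$ it is a $(\mathcal K,\mathcal U)$-completion. If $\mathbf B$ is an irreducible substructure of $\mathbf C$, an irreducible structure $\mathbf C'$ is a completion of $\mathbf C$ with respect to copies of $\mathbf B$ if there is a function $f:C\to C'$ such that for every $\widetilde{\mathbf B}\in\binom{\mathbf C}{\mathbf B}$ the restriction of $f$ to $\widetilde B$ is an embedding $\widetilde{\mathbf B}\to\mathbf C'$. Multiamalgamation. A subclass $\mathcal K$ of $\mathcal R$ is an $(\mathcal R,\mathcal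 U)$-multiamalgamation class if: (1) $\mathcal K$ consists of finite $\mathcal U$-closed $L$-structures; (2) every $\mathcal U$-closed substructure of a member of $\mathcal K$ is in $\mathcal K$; (3) for $\mathbf A,\mathbf B_1,\mathbf B_2\in\mathcal K$ and embeddings $\alpha_i:\mathbf A\to\mathbf B_i$ there is a strong amalgamation in $\mathcal K$; (4) for every $\mathbf B\in\mathcal K$ and $\mathbf C_0\in\mathcal R$ there exists $n=n(\mathbf B,\mathbf C_0)$ such that if a $\mathcal U$-closed $L$-structure $\mathbf C$ satisfies (a) $\mathbf C_0$ is a $\mathcal U$-completion of $\mathbf C$, (b) every $\mathcal U$-irreducible substructure of $\mathbf C$ is in $\mathcal K$, and (c) every (not necessarily $\mathcal U$-closed) substructure of $\mathbf C$ with at most $n$ vertices has a $(\mathcal K,\mathcal U)$-completion, then there exists $\mathbf C'\in\mathcal K$ which is a completion of $\mathbf C$ with respect to copies of $\mathbf B$. *)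

theory Defs
  imports Main "HOL-Library.Countable_Set" "HOL-Library.Disjoint_Sets" "HOL-Library.Extended_Nat"
begin

text \<open>The symbols of a language form subsets of the types \<open>'r\<close> and \<open>'f\<close>, so that a language
  may have no relation symbols or no function symbols.\<close>

record ('r, 'f) lang =
  rels :: "'r set"
  funs :: "'f set"
  rel_arity :: "'r \<Rightarrow> nat"
  fun_arity :: "'f \<Rightarrow> nat"

definition is_language :: "('r, 'f) lang \<Rightarrow> bool" where
  "is_language L \<longleftrightarrow>
     (\<forall>R\<in>rels L. 0 < rel_arity L R) \<and> (\<forall>F\<in>funs L. 0 < fun_arity L F)"

text \<open>Tuples are lists; a partial function is a map whose domain is the set \<open>Dom(F)\<close>.\<close>

record ('r, 'f, 'v) lstruct =
  verts :: "'v set"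
  rel :: "'r \<Rightarrow> 'v list set"
  fn :: "'f \<Rightarrow> 'v list \<Rightarrow> 'v option"

definition tuples :: "'v set \<Rightarrow> nat \<Rightarrow> 'v list set" where
  "tuples V n = {xs. length xs = n \<and> set xs \<subseteq> V}"

text \<open>Elements of \<open>'r\<close> and \<open>'f\<close> that are not symbols of the language are given the empty
  interpretation, so that equality of records is equality of structures.\<close>

definition is_structure :: "('r, 'f) lang \<Rightarrow> ('r, 'f, 'v) lstruct \<Rightarrow> bool" where
  "is_structure L A \<longleftrightarrow>
     countable (verts A) \<and>
     (\<forall>R\<in>rels L. rel A R \<subseteq> tuples (verts A) (rel_arity L R)) \<and>
     (\<forall>F\<in>funs L. dom (fn A F) \<subseteq> tuples (verts A) (fun_arity L F) \<and> ran (fn A F) \<subseteq> verts A) \<and>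
     (\<forall>R. R \<notin> rels L \<longrightarrow> rel A R = {}) \<and>
     (\<forall>F. F \<notin> funs L \<longrightarrow> fn A F = Map.empty)"

definition homomorphism ::
  "('r, 'f) lang \<Rightarrow> ('r, 'f, 'v) lstruct \<Rightarrow> ('r, 'f, 'w) lstruct \<Rightarrow> ('v \<Rightarrow> 'w) \<Rightarrow> bool" where
  "homomorphism L A B f \<longleftrightarrow>
     f ` verts A \<subseteq> verts B \<and>
     (\<forall>R\<in>rels L. \<forall>xs\<in>rel A R. map f xs \<in> rel B R) \<and>
     (\<forall>F\<in>funs L. \<forall>xs\<in>dom (fn A F).
        map f xs \<in> dom (fn B F) \<and> f (the (fn A F xs)) = the (fn B F (map f xs)))"

definition embedding ::
  "('r, 'f) lang \<Rightarrow> ('r, 'f, 'v) lstruct \<Rightarrow> ('r, 'f, 'w) lstruct \<Rightarrow> ('v \<Rightarrow> 'w) \<Rightarrow> bool" where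
  "embedding L A B f \<longleftrightarrow>
     homomorphism L A B f \<and> inj_on f (verts A) \<and>
     (\<forall>R\<in>rels L. \<forall>xs\<in>tuples (verts A) (rel_arity L R). xs \<in> rel A R \<longleftrightarrow> map f xs \<in> rel B R) \<and>
     (\<forall>F\<in>funs L. \<forall>xs\<in>tuples (verts A) (fun_arity L F).
        xs \<in> dom (fn A F) \<longleftrightarrow> map f xs \<in> dom (fn B F))"

definition isomorphic ::
  "('r, 'f) lang \<Rightarrow> ('r, 'f, 'v) lstruct \<Rightarrow> ('r, 'f, 'w) lstruct \<Rightarrow> bool" where
  "isomorphic L A B \<longleftrightarrow> (\<exists>f. embedding L A B f \<and> f ` verts A = verts B)"

definition substructure ::
  "('r, 'f) lang \<Rightarrow> ('r, 'f, 'v) lstruct \<Rightarrow> ('r, 'f, 'v) lstruct \<Rightarrow> bool" where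
  "substructure L A B \<longleftrightarrow>
     is_structure L A \<and> is_structure L B \<and> verts A \<subseteq> verts B \<and> embedding L A B id"

text \<open>Every countable structure is isomorphic to one whose vertices are natural numbers, so an
  isomorphism-closed class of countable structures is determined by its members on \<open>nat\<close>.\<close>

definition structure_class :: "('r, 'f) lang \<Rightarrow> ('r, 'f, nat) lstruct set \<Rightarrow> bool" where
  "structure_class L K \<longleftrightarrow>
     (\<forall>A\<in>K. is_structure L A) \<and>
     (\<forall>A\<in>K. \<forall>B. is_structure L B \<and> isomorphic L A B \<longrightarrow> B \<in> K)"

definition copies ::
  "('r, 'f) lang \<Rightarrow> ('r, 'f, 'v) lstruct \<Rightarrow> ('r, 'f, 'w) lstruct \<Rightarrow> ('r, 'f, 'v) lstruct set" where
  "copies L B A = {A'. substructure L A' B \<and> isomorphic L A A'}"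

text \<open>\<open>ramsey_arrow L C B A k\<close> is the partition arrow \<open>C \<longrightarrow> (B)^A_k\<close>; as usual the classes
  \<open>P 0, \<dots>, P (k - 1)\<close> of the partition are allowed to be empty.\<close>

definition ramsey_arrow ::
  "('r, 'f) lang \<Rightarrow> ('r, 'f, 'u) lstruct \<Rightarrow> ('r, 'f, 'v) lstruct \<Rightarrow> ('r, 'f, 'w) lstruct
    \<Rightarrow> nat \<Rightarrow> bool" where
  "ramsey_arrow L C B A k \<longleftrightarrow>
     (\<forall>P :: nat \<Rightarrow> ('r, 'f, 'u) lstruct set.
        disjoint_family_on P {..<k} \<and> (\<Union>i<k. P i) = copies L C A \<longrightarrow>
        (\<exists>B'\<in>copies L C B. \<exists>i<k. copies L B' A \<subseteq> P i))"

definition ramsey_class :: "('r, 'f) lang \<Rightarrow> ('r, 'f, nat) lstruct set \<Rightarrow> bool" where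
  "ramsey_class L K \<longleftrightarrow>
     structure_class L K \<and>
     (\<forall>A\<in>K. \<forall>B\<in>K. \<forall>k\<ge>1. \<exists>C\<in>K. ramsey_arrow L C B A k)"

definition strong_amalgamation ::
  "('r, 'f) lang \<Rightarrow> ('r, 'f, 'a) lstruct \<Rightarrow> ('r, 'f, 'b) lstruct \<Rightarrow> ('r, 'f, 'c) lstruct
    \<Rightarrow> ('a \<Rightarrow> 'b) \<Rightarrow> ('a \<Rightarrow> 'c) \<Rightarrow> ('r, 'f, 'd) lstruct \<Rightarrow> ('b \<Rightarrow> 'd) \<Rightarrow> ('c \<Rightarrow> 'd) \<Rightarrow> bool" where
  "strong_amalgamation L A B1 B2 \<alpha>1 \<alpha>2 C \<beta>1 \<beta>2 \<longleftrightarrow>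
     is_structure L C \<and> embedding L B1 C \<beta>1 \<and> embedding L B2 C \<beta>2 \<and>
     (\<forall>x\<in>verts A. \<beta>1 (\<alpha>1 x) = \<beta>2 (\<alpha>2 x)) \<and>
     \<beta>1 ` verts B1 \<inter> \<beta>2 ` verts B2 = \<beta>1 ` \<alpha>1 ` verts A"

definition free_amalgamation ::
  "('r, 'f) lang \<Rightarrow> ('r, 'f, 'a) lstruct \<Rightarrow> ('r, 'f, 'b) lstruct \<Rightarrow> ('r, 'f, 'c) lstruct
    \<Rightarrow> ('a \<Rightarrow> 'b) \<Rightarrow> ('a \<Rightarrow> 'c) \<Rightarrow> ('r, 'f, 'd) lstruct \<Rightarrow> ('b \<Rightarrow> 'd) \<Rightarrow> ('c \<Rightarrow> 'd) \<Rightarrow> bool" where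
  "free_amalgamation L A B1 B2 \<alpha>1 \<alpha>2 C \<beta>1 \<beta>2 \<longleftrightarrow>
     strong_amalgamation L A B1 B2 \<alpha>1 \<alpha>2 C \<beta>1 \<beta>2 \<and>
     verts C = \<beta>1 ` verts B1 \<union> \<beta>2 ` verts B2 \<and>
     (\<forall>xs \<in> (\<Union>R\<in>rels L. rel C R) \<union> (\<Union>F\<in>funs L. dom (fn C F)).
        \<not> (set xs \<inter> \<beta>1 ` (verts B1 - \<alpha>1 ` verts A) \<noteq> {} \<and>
           set xs \<inter> \<beta>2 ` (verts B2 - \<alpha>2 ` verts A) \<noteq> {}))"

definition proper_substructure ::
  "('r, 'f) lang \<Rightarrow> ('r, 'f, 'v) lstruct \<Rightarrow> ('r, 'f, 'v) lstruct \<Rightarrow> bool" where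
  "proper_substructure L A B \<longleftrightarrow> substructure L A B \<and> A \<noteq> B"

text \<open>\<open>C\<close> is the free amalgamation of its own substructures \<open>B1\<close> and \<open>B2\<close> if it is one via the
  inclusions. (With arbitrary embeddings of \<open>B1\<close> and \<open>B2\<close> into \<open>C\<close> this would be equivalent for
  finite \<open>C\<close>, but an infinite \<open>C\<close> isomorphic to a proper substructure would never be
  irreducible.)\<close>

definition irreducible_structure ::
  "('r, 'f) lang \<Rightarrow> ('r, 'f, 'v) lstruct \<Rightarrow> bool" where
  "irreducible_structure L C \<longleftrightarrow>
     is_structure L C \<and>
     \<not> (\<exists>(A :: ('r, 'f, 'v) lstruct) B1 B2 \<alpha>1 \<alpha>2.
          is_structure L A \<and> proper_substructure L B1 C \<and> proper_substructure L B2 C \<and>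
          embedding L A B1 \<alpha>1 \<and> embedding L A B2 \<alpha>2 \<and>
          free_amalgamation L A B1 B2 \<alpha>1 \<alpha>2 C id id)"

type_synonym ('r, 'f) closure_descr = "('r \<times> ('r, 'f, nat) lstruct) set"

definition closure_description :: "('r, 'f) lang \<Rightarrow> ('r, 'f) closure_descr \<Rightarrow> bool" where
  "closure_description L U \<longleftrightarrow>
     (\<forall>(R, S)\<in>U. R \<in> rels L \<and> irreducible_structure L S \<and> verts S \<noteq> {} \<and>
        (\<exists>m. verts S = {1..m} \<and> m < rel_arity L R))"

text \<open>The number is taken in \<open>enat\<close> because \<open>card\<close> would give an infinite set of extensions
  the out-degree \<open>0\<close>. In a structure only lists \<open>ys\<close> of the complementary length occur.\<close>

definition out_degree :: "('r, 'f, 'v) lstruct \<Rightarrow> 'r \<Rightarrow> 'v list \<Rightarrow> enat" where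
  "out_degree A R t =
     (let E = {ys. t @ ys \<in> rel A R} in if finite E then enat (card E) else \<infinity>)"

text \<open>Roots live on \<open>{1..m}\<close>, while list positions start at \<open>0\<close>.\<close>

definition represents_embedding ::
  "('r, 'f) lang \<Rightarrow> ('r, 'f, nat) lstruct \<Rightarrow> ('r, 'f, 'v) lstruct \<Rightarrow> 'v list \<Rightarrow> bool" where
  "represents_embedding L S A t \<longleftrightarrow> embedding L S A (\<lambda>i. t ! (i - 1))"

definition U_closed ::
  "('r, 'f) lang \<Rightarrow> ('r, 'f) closure_descr \<Rightarrow> ('r, 'f, 'v) lstruct \<Rightarrow> bool" where
  "U_closed L U A \<longleftrightarrow>
     is_structure L A \<and>
     (\<forall>(R, S0)\<in>U. \<forall>t\<in>tuples (verts A) (card (verts S0)).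
        out_degree A R t =
          (if \<exists>S. (R, S) \<in> U \<and> card (verts S) = card (verts S0) \<and> represents_embedding L S A t
           then 1 else 0))"

definition U_irreducible ::
  "('r, 'f) lang \<Rightarrow> ('r, 'f) closure_descr \<Rightarrow> ('r, 'f, 'v) lstruct \<Rightarrow> bool" where
  "U_irreducible L U C \<longleftrightarrow>
     U_closed L U C \<and>
     \<not> (\<exists>(A :: ('r, 'f, 'v) lstruct) B1 B2 \<alpha>1 \<alpha>2.
          is_structure L A \<and>
          proper_substructure L B1 C \<and> U_closed L U B1 \<and>
          proper_substructure L B2 C \<and> U_closed L U B2 \<and>
          embedding L A B1 \<alpha>1 \<and> embedding L A B2 \<alpha>2 \<and>
          free_amalgamation L A B1 B2 \<alpha>1 \<alpha>2 C id id)"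

definition U_hom_embedding ::
  "('r, 'f) lang \<Rightarrow> ('r, 'f) closure_descr \<Rightarrow> ('r, 'f, 'v) lstruct \<Rightarrow> ('r, 'f, 'w) lstruct
    \<Rightarrow> ('v \<Rightarrow> 'w) \<Rightarrow> bool" where
  "U_hom_embedding L U A B f \<longleftrightarrow>
     homomorphism L A B f \<and>
     (\<forall>S. substructure L S A \<and> U_irreducible L U S \<longrightarrow> embedding L S B f)"

definition U_completion ::
  "('r, 'f) lang \<Rightarrow> ('r, 'f) closure_descr \<Rightarrow> ('r, 'f, 'w) lstruct \<Rightarrow> ('r, 'f, 'v) lstruct
    \<Rightarrow> bool" where
  "U_completion L U C' C \<longleftrightarrow>
     irreducible_structure L C' \<and> (\<exists>f. U_hom_embedding L U C C' f)"

definition completion_wrt_copies ::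
  "('r, 'f) lang \<Rightarrow> ('r, 'f, 'w) lstruct \<Rightarrow> ('r, 'f, 'v) lstruct \<Rightarrow> ('r, 'f, 'b) lstruct
    \<Rightarrow> bool" where
  "completion_wrt_copies L C' C B \<longleftrightarrow>
     irreducible_structure L C' \<and>
     (\<exists>f. f ` verts C \<subseteq> verts C' \<and> (\<forall>B'\<in>copies L C B. embedding L B' C' f))"

definition multiamalgamation_class ::
  "('r, 'f) lang \<Rightarrow> ('r, 'f, nat) lstruct set \<Rightarrow> ('r, 'f) closure_descr
    \<Rightarrow> ('r, 'f, nat) lstruct set \<Rightarrow> bool" where
  "multiamalgamation_class L \<R> U \<K> \<longleftrightarrow>
     structure_class L \<K> \<and> \<K> \<subseteq> \<R> \<and>
     (\<forall>A\<in>\<K>. finite (verts A) \<and> U_closed L U A) \<and>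
     (\<forall>B\<in>\<K>. \<forall>A. substructure L A B \<and> U_closed L U A \<longrightarrow> A \<in> \<K>) \<and>
     (\<forall>A\<in>\<K>. \<forall>B1\<in>\<K>. \<forall>B2\<in>\<K>. \<forall>\<alpha>1 \<alpha>2. embedding L A B1 \<alpha>1 \<and> embedding L A B2 \<alpha>2 \<longrightarrow>
        (\<exists>C\<in>\<K>. \<exists>\<beta>1 \<beta>2. strong_amalgamation L A B1 B2 \<alpha>1 \<alpha>2 C \<beta>1 \<beta>2)) \<and>
     (\<forall>B\<in>\<K>. \<forall>C0\<in>\<R>. \<exists>n::nat. \<forall>C :: ('r, 'f, nat) lstruct.
        U_closed L U C \<and>
        U_completion L U C0 C \<and>
        (\<forall>S. substructure L S C \<and> U_irreducible L U S \<longrightarrow> S \<in> \<K>) \<and>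
        (\<forall>S. substructure L S C \<and> finite (verts S) \<and> card (verts S) \<le> n \<longrightarrow>
           (\<exists>C'\<in>\<K>. U_completion L U C' S)) \<longrightarrow>
        (\<exists>C'\<in>\<K>. completion_wrt_copies L C' C B))"

end

theory Submission
  imports Defs "HOL-Library.FuncSet"
begin

text \<open>
  Let \<open>A\<close> and \<open>B\<close> be members of \<open>\<K>\<close> and let \<open>k\<close> colours be given. The Ramsey property of \<open>\<R>\<close>
  yields a finite \<open>C\<^sub>0\<close> with \<open>C\<^sub>0 \<longrightarrow> (B)\<^sup>A\<close>, but \<open>C\<^sub>0\<close> lies only in \<open>\<R>\<close>. It suffices to find
  a finite \<open>\<U>\<close>-closed \<open>C\<close> which still has the arrow, maps to \<open>C\<^sub>0\<close> by a
  \<open>\<U>\<close>-homomorphism-embedding, has all its \<open>\<U>\<close>-irreducible substructures in \<open>\<K>\<close>, and has its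
  substructures with at most \<open>n\<close> vertices completable in \<open>\<K>\<close>: the multiamalgamation property
  completes \<open>C\<close> to a member of \<open>\<K>\<close> without destroying the copies of \<open>B\<close>, so that this member
  inherits the arrow (lemma \<open>ramsey_arrow_of_completion\<close>).

  Such a \<open>C\<close> comes from iterating the partite construction of Nesetril and Roedl. Over a
  base \<open>G\<close> with the arrow, take the disjoint union \<open>P\<close> of copies of \<open>B\<close>, one for each
  embedding of \<open>B\<close> into \<open>G\<close>, and label every vertex by its image in \<open>G\<close>. Suppose first that
  \<open>G\<close> is \<open>\<U>\<close>-closed. An embedding \<open>w\<close> of \<open>A\<close> into \<open>G\<close> then cuts out of \<open>P\<close> the set \<open>D\<close> of
  vertices labelled in \<open>w(A)\<close>. It is closed, and \<open>w\<^sup>-\<^sup>1 \<circ> lab\<close> is a homomorphism \<open>\<rho>\<close> from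
  \<open>D\<close> to \<open>A\<close> which is an embedding on irreducible sets. The \<open>N\<close>-fold fibre power of \<open>D\<close> over
  \<open>A\<close> is again \<open>\<U>\<close>-closed (lemma \<open>Y_U_closed\<close>), its copies of \<open>A\<close> include the words of
  length \<open>N\<close> in the copies of \<open>A\<close> in \<open>P\<close> lying over \<open>w\<close>, and every combinatorial line of
  such words is an embedding of \<open>D\<close> into it. Gluing one copy of \<open>P\<close> along each line, the
  Hales--Jewett theorem makes all copies of \<open>A\<close> over \<open>w\<close> in one of these copies of \<open>P\<close>
  equally coloured (lemma \<open>partite_step\<close>). After this has been done for every \<open>w\<close>, the
  colour of a copy of \<open>A\<close> in some copy of \<open>P\<close> depends on its projection to \<open>G\<close> only, and the
  arrow of \<open>G\<close> applies (lemma \<open>arrow_lift\<close>). Nothing new appears locally: every irreducible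
  set of the result projects back into \<open>P\<close>, and from there into \<open>B\<close> and into \<open>G\<close>, by an
  embedding respecting labels (\<open>locally_in\<close>).

  Two points need care. First, \<open>C\<^sub>0\<close> need not be \<open>\<U>\<close>-closed, and then \<open>D\<close> need not be
  closed: tuples of \<open>P\<close> that have a closure in \<open>P\<close> may have it outside \<open>D\<close>. For this base
  the words of the Hales--Jewett theorem are used as an auxiliary base. One takes a copy of
  \<open>P\<close> for every combinatorial line and labels its vertices by vertices of words as well. A
  word then meets such a copy in the image of a set on which given homomorphisms from \<open>A\<close> to
  \<open>P\<close> agree. Sets of this kind are closed because closures in a \<open>\<U>\<close>-closed structure are
  unique (lemma \<open>closed_agree\<close>), so that the previous construction applies to the words, and
  a final application of the Hales--Jewett theorem picks a line (lemma \<open>uniform_step\<close>).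

  Second, small substructures have to be completed. The predicate \<open>completable\<close> says that
  any \<open>n\<close> vertices can be sent into some \<open>E \<in> \<K>\<close> in a way that extends to every member of
  \<open>\<K>\<close> which sits in \<open>C\<close> and is generated by some of these vertices. Rebuilding the
  construction over a \<open>\<U>\<close>-closed base raises \<open>n\<close> by one (lemma \<open>completable_step\<close>). If all
  \<open>n + 1\<close> vertices lie in one copy of \<open>P\<close>, the copy is as good as \<open>P\<close>, and \<open>P\<close> is completed
  by folding it onto \<open>B\<close> as long as it is the disjoint union. Otherwise every copy of \<open>P\<close>
  contains at most \<open>n\<close> of them; their images in the base have a completion, and these
  completions are amalgamated one after the other over the parts of \<open>A\<close> they have in common.
  Starting at \<open>n = 0\<close>, finitely many rounds suffice.
\<close>

section \<open>Closed sets and irreducible sets\<close>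

lemma list_in_image:
  assumes "set t \<subseteq> f ` A"
  obtains xs where "t = map f xs" "set xs \<subseteq> A"
proof
  show "t = map f (map (inv_into A f) t)"
    using assms by (auto simp: f_inv_into_f subset_iff intro!: map_idI[symmetric])
  show "set (map (inv_into A f) t) \<subseteq> A" using assms by (auto intro!: inv_into_into)
qed

lemma homomorphism_iff:
  "homomorphism L A B f \<longleftrightarrow> f ` verts A \<subseteq> verts B \<and>
     (\<forall>R\<in>rels L. \<forall>xs\<in>rel A R. map f xs \<in> rel B R) \<and>
     (\<forall>F\<in>funs L. \<forall>xs y. fn A F xs = Some y \<longrightarrow> fn B F (map f xs) = Some (f y))"
proof -
  have 1: "(\<forall>xs\<in>dom g. map f xs \<in> dom h \<and> f (the (g xs)) = the (h (map f xs))) \<longleftrightarrow>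
    (\<forall>xs y. g xs = Some y \<longrightarrow> h (map f xs) = Some (f y))"
    for g :: "'c list \<Rightarrow> 'c option" and h :: "'d list \<Rightarrow> 'd option"  and f
    unfolding dom_def by fastforce
  show ?thesis unfolding homomorphism_def 1 by simp
qed

lemma hom_verts: "homomorphism L A B f \<Longrightarrow> f ` verts A \<subseteq> verts B"
  unfolding homomorphism_iff by simp

lemma hom_rel: "homomorphism L A B f \<Longrightarrow> R \<in> rels L \<Longrightarrow> xs \<in> rel A R \<Longrightarrow> map f xs \<in> rel B R"
  unfolding homomorphism_iff by simp

lemma hom_fn: "homomorphism L A B f \<Longrightarrow> F \<in> funs L \<Longrightarrow> fn A F xs = Some y \<Longrightarrow> fn B F (map f xs) = Some (f y)"
  unfolding homomorphism_iff by simp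

lemma structure_rel: "is_structure L A \<Longrightarrow> xs \<in> rel A R \<Longrightarrow> R \<in> rels L \<and> length xs = rel_arity L R \<and> set xs \<subseteq> verts A"
  unfolding is_structure_def tuples_def by blast

lemma structure_fn: "is_structure L A \<Longrightarrow> fn A F xs = Some y \<Longrightarrow> F \<in> funs L \<and> length xs = fun_arity L F \<and> set xs \<subseteq> verts A \<and> y \<in> verts A"
proof -
  assume A: "is_structure L A" and f: "fn A F xs = Some y"
  have F: "F \<in> funs L" using A f unfolding is_structure_def by (metis option.distinct(1))
  then have "dom (fn A F) \<subseteq> tuples (verts A) (fun_arity L F)" "ran (fn A F) \<subseteq> verts A"
    using A unfolding is_structure_def by auto
  then show ?thesis using F f by (auto simp: tuples_def dom_def ran_def)
qed

text \<open>For structures, an embedding reflects also the graphs of the functions, which makes it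
  an equation between partial functions. This form is the one that composes and restricts
  well.\<close>
lemma embedding_iff:
  assumes A: "is_structure L A" and B: "is_structure L B"
  shows "embedding L A B f \<longleftrightarrow> f ` verts A \<subseteq> verts B \<and> inj_on f (verts A) \<and>
     (\<forall>R\<in>rels L. \<forall>xs. set xs \<subseteq> verts A \<longrightarrow> (map f xs \<in> rel B R \<longleftrightarrow> xs \<in> rel A R)) \<and>
     (\<forall>F\<in>funs L. \<forall>xs. set xs \<subseteq> verts A \<longrightarrow> fn B F (map f xs) = map_option f (fn A F xs))"
    (is "?l \<longleftrightarrow> ?r")
proof
  assume l: ?l
  have R: "map f xs \<in> rel B R \<longleftrightarrow> xs \<in> rel A R" if "R \<in> rels L" "set xs \<subseteq> verts A" for R xs
  proof (cases "length xs = rel_arity L R")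
    case True
    then show ?thesis using l that unfolding embedding_def tuples_def by auto
  next
    case False
    then show ?thesis using structure_rel[OF A, of xs R] structure_rel[OF B, of "map f xs" R] by auto
  qed
  have F: "fn B F (map f xs) = map_option f (fn A F xs)" if "F \<in> funs L" "set xs \<subseteq> verts A" for F xs
  proof (cases "fn A F xs")
    case None
    have "fn B F (map f xs) = None"
    proof (cases "length xs = fun_arity L F")
      case True
      then have "xs \<in> dom (fn A F) \<longleftrightarrow> map f xs \<in> dom (fn B F)"
        using l that unfolding embedding_def tuples_def by auto
      then show ?thesis using None by auto
    next
      case False
      then show ?thesis using structure_fn[OF B, of F "map f xs"] by (cases "fn B F (map f xs)") auto
    qed
    then show ?thesis using None by simp
  next
    case (Some y)
    then show ?thesis using l that unfolding embedding_def homomorphism_iff by auto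
  qed
  show ?r using l R F unfolding embedding_def homomorphism_def by blast
next
  assume r: ?r
  have F: "fn B F (map f xs) = map_option f (fn A F xs)" if "F \<in> funs L" "set xs \<subseteq> verts A" for F xs
    using r that by blast
  have F': "fn B F (map f xs) = Some (f y)" if "F \<in> funs L" "fn A F xs = Some y" for F xs y
    using F[OF that(1), of xs] structure_fn[OF A that(2)] that(2) by simp
  have R': "map f xs \<in> rel B R" if "R \<in> rels L" "xs \<in> rel A R" for R xs
    using r that structure_rel[OF A that(2)] by blast
  have "homomorphism L A B f"
    unfolding homomorphism_iff using r F' R' by simp
  moreover have "xs \<in> dom (fn A F) \<longleftrightarrow> map f xs \<in> dom (fn B F)" if "F \<in> funs L" "set xs \<subseteq> verts A" for F xs
    using F[OF that] by (simp add: dom_def)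
  ultimately show ?l unfolding embedding_def tuples_def using r by simp
qed

lemma embedding_hom: "embedding L A B f \<Longrightarrow> homomorphism L A B f"
  unfolding embedding_def by blast

lemma homomorphism_comp:
  "homomorphism L A B f \<Longrightarrow> homomorphism L B C g \<Longrightarrow> homomorphism L A C (g \<circ> f)"
  unfolding homomorphism_iff by (auto simp flip: map_map)

lemma embedding_comp:
  assumes "embedding L A B f" "embedding L B C g"
    "is_structure L A" "is_structure L B" "is_structure L C"
  shows "embedding L A C (g \<circ> f)"
proof -
  have *: "f ` verts A \<subseteq> verts B" "inj_on f (verts A)"
    "\<And>R xs. R\<in>rels L \<Longrightarrow> set xs \<subseteq> verts A \<Longrightarrow> (map f xs \<in> rel B R \<longleftrightarrow> xs \<in> rel A R)"
    "\<And>F xs. F\<in>funs L \<Longrightarrow> set xs \<subseteq> verts A \<Longrightarrow> fn B F (map f xs) = map_option f (fn A F xs)"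
    using assms(1) unfolding embedding_iff[OF assms(3,4)] by auto
  have **: "g ` verts B \<subseteq> verts C" "inj_on g (verts B)"
    "\<And>R xs. R\<in>rels L \<Longrightarrow> set xs \<subseteq> verts B \<Longrightarrow> (map g xs \<in> rel C R \<longleftrightarrow> xs \<in> rel B R)"
    "\<And>F xs. F\<in>funs L \<Longrightarrow> set xs \<subseteq> verts B \<Longrightarrow> fn C F (map g xs) = map_option g (fn B F xs)"
    using assms(2) unfolding embedding_iff[OF assms(4,5)] by auto
  have im: "set (map f xs) \<subseteq> verts B" if "set xs \<subseteq> verts A" for xs using that *(1) by auto
  show ?thesis unfolding embedding_iff[OF assms(3,5)]
  proof (intro conjI ballI allI impI)
    show "(g \<circ> f) ` verts A \<subseteq> verts C" using *(1) **(1) by auto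
    show "inj_on (g \<circ> f) (verts A)" using *(1,2) **(2) by (meson comp_inj_on inj_on_subset)
  next
    fix R xs assume "R \<in> rels L" "set xs \<subseteq> verts A"
    then show "(map (g \<circ> f) xs \<in> rel C R) = (xs \<in> rel A R)"
      using *(3) **(3) im by (metis map_map)
  next
    fix F xs assume "F \<in> funs L" "set xs \<subseteq> verts A"
    then show "fn C F (map (g \<circ> f) xs) = map_option (g \<circ> f) (fn A F xs)"
      using *(4) **(4) im by (metis map_map option.map_comp)
  qed
qed

lemma embedding_cong:
  assumes f: "embedding L A B f" and eq: "\<And>x. x \<in> verts A \<Longrightarrow> f x = g x"
    and A: "is_structure L A" and B: "is_structure L B"
  shows "embedding L A B g"
proof -
  have m: "map g xs = map f xs" if "set xs \<subseteq> verts A" for xs using eq that by auto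
  have o: "map_option g (fn A F xs) = map_option f (fn A F xs)" for F xs
    using eq structure_fn[OF A, of F xs] by (cases "fn A F xs") auto
  have "g ` verts A = f ` verts A" using eq by (auto cong: image_cong)
  moreover have "inj_on g (verts A) = inj_on f (verts A)" using eq by (metis inj_on_cong)
  ultimately show ?thesis using f unfolding embedding_iff[OF A B] by (simp add: m o)
qed

definition restr :: "('r, 'f, 'v) lstruct \<Rightarrow> 'v set \<Rightarrow> ('r, 'f, 'v) lstruct" where
  "restr A X = \<lparr>verts = X, rel = \<lambda>R. {xs \<in> rel A R. set xs \<subseteq> X},
     fn = \<lambda>F. fn A F |` {xs. set xs \<subseteq> X}\<rparr>"

lemma restr_simps [simp]:
  "verts (restr A X) = X"
  "xs \<in> rel (restr A X) R \<longleftrightarrow> xs \<in> rel A R \<and> set xs \<subseteq> X"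
  "fn (restr A X) F xs = (if set xs \<subseteq> X then fn A F xs else None)"
  by (auto simp: restr_def restrict_map_def)

text \<open>A closure rule leads from a tuple \<open>t\<close> to a vertex \<open>y\<close> that every closed set containing
  \<open>t\<close> has to contain: either \<open>y\<close> is the value of a function at \<open>t\<close>, or it occurs in the
  extension of \<open>t\<close> by a relation of the closure description. With the empty closure
  description only the former kind remains, and the closed sets are the vertex sets of
  substructures.\<close>
definition rule :: "('r, 'f) lang \<Rightarrow> ('r, 'f) closure_descr \<Rightarrow> ('r, 'f, 'v) lstruct \<Rightarrow> 'v list \<Rightarrow> 'v \<Rightarrow> bool" where
  "rule L U A t y \<longleftrightarrow> (\<exists>F\<in>funs L. fn A F t = Some y) \<or>
     (\<exists>R S ys. (R, S) \<in> U \<and> R \<in> rels L \<and> t @ ys \<in> rel A R \<and> length t = card (verts S) \<and> y \<in> set ys)"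

text \<open>The tuples that may not be split by a free amalgamation. The value of a function does
  not belong to the tuple, as in the definition of free amalgamation.\<close>
definition edge :: "('r, 'f) lang \<Rightarrow> ('r, 'f, 'v) lstruct \<Rightarrow> 'v list \<Rightarrow> bool" where
  "edge L A e \<longleftrightarrow> (\<exists>R\<in>rels L. e \<in> rel A R) \<or> (\<exists>F\<in>funs L. e \<in> dom (fn A F))"

definition is_closed :: "('r, 'f) lang \<Rightarrow> ('r, 'f) closure_descr \<Rightarrow> ('r, 'f, 'v) lstruct \<Rightarrow> 'v set \<Rightarrow> bool" where
  "is_closed L U A X \<longleftrightarrow> X \<subseteq> verts A \<and> (\<forall>t y. rule L U A t y \<and> set t \<subseteq> X \<longrightarrow> y \<in> X)"

text \<open>Irreducibility expressed by vertex sets alone: with the empty \<open>U\<close> this is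
  irreducibility, with the given closure description it is \<open>\<U>\<close>-irreducibility. It avoids
  speaking of amalgams and makes sense for homomorphic images.\<close>
definition unsplit :: "('r, 'f) lang \<Rightarrow> ('r, 'f) closure_descr \<Rightarrow> ('r, 'f, 'v) lstruct \<Rightarrow> bool" where
  "unsplit L U A \<longleftrightarrow> is_structure L A \<and>
     (\<forall>X1 X2. is_closed L U A X1 \<and> is_closed L U A X2 \<and> verts A \<subseteq> X1 \<union> X2 \<and>
        (\<forall>e. edge L A e \<longrightarrow> set e \<subseteq> X1 \<or> set e \<subseteq> X2) \<longrightarrow> verts A \<subseteq> X1 \<or> verts A \<subseteq> X2)"

definition closure_in :: "('r, 'f) lang \<Rightarrow> ('r, 'f) closure_descr \<Rightarrow> ('r, 'f, 'v) lstruct \<Rightarrow> 'v set \<Rightarrow> 'v set" where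
  "closure_in L U A X = verts A \<inter> \<Inter>{Y. is_closed L U A Y \<and> X \<subseteq> Y}"

lemma rule_cases [consumes 1, case_names fn rel]:
  assumes "rule L U A t y"
  obtains F where "F \<in> funs L" "fn A F t = Some y"
  | R S ys where "(R, S) \<in> U" "R \<in> rels L" "t @ ys \<in> rel A R" "length t = card (verts S)" "y \<in> set ys"
  using assms unfolding rule_def by blast

lemma rule_fnI: "F \<in> funs L \<Longrightarrow> fn A F t = Some y \<Longrightarrow> rule L U A t y"
  unfolding rule_def by blast

lemma rule_relI: "(R, S) \<in> U \<Longrightarrow> R \<in> rels L \<Longrightarrow> t @ ys \<in> rel A R \<Longrightarrow> length t = card (verts S) \<Longrightarrow> y \<in> set ys
  \<Longrightarrow> rule L U A t y"
  unfolding rule_def by blast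

lemma rule_verts:
  assumes A: "is_structure L A" and "rule L U A t y"
  shows "set t \<subseteq> verts A \<and> y \<in> verts A"
  using assms(2)
proof (cases rule: rule_cases)
  case (fn F) then show ?thesis using structure_fn[OF A] by blast
next
  case (rel R S ys)
  then show ?thesis using structure_rel[OF A rel(3)] by auto
qed

lemma rule_edge:
  assumes "rule L U A t y"
  shows "\<exists>e. edge L A e \<and> set t \<subseteq> set e \<and> (e = t \<or> y \<in> set e)"
  using assms
proof (cases rule: rule_cases)
  case (fn F) then have "edge L A t" unfolding edge_def by blast
  then show ?thesis by blast
next
  case (rel R S ys)
  then have "edge L A (t @ ys)" unfolding edge_def by blast
  then show ?thesis using rel(5) by (intro exI[of _ "t @ ys"]) auto
qed

lemma edge_verts:
  assumes A: "is_structure L A" and "edge L A e"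
  shows "set e \<subseteq> verts A"
  using assms(2) structure_fn[OF A] structure_rel[OF A] unfolding edge_def by blast

lemma hom_rule:
  assumes h: "homomorphism L A B f" and "rule L U A t y"
  shows "rule L U B (map f t) (f y)"
  using assms(2)
proof (cases rule: rule_cases)
  case (fn F) then show ?thesis using hom_fn[OF h] by (blast intro: rule_fnI)
next
  case (rel R S ys)
  then have "map f (t @ ys) \<in> rel B R" using hom_rel[OF h] by blast
  then show ?thesis using rel by (intro rule_relI[of R S _ _ _ "map f ys"]) auto
qed

lemma hom_edge: "homomorphism L A B f \<Longrightarrow> edge L A e \<Longrightarrow> edge L B (map f e)"
  unfolding edge_def homomorphism_iff by blast

lemma rule_mono: "U' \<subseteq> U \<Longrightarrow> rule L U' A t y \<Longrightarrow> rule L U A t y"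
  unfolding rule_def by blast

lemma closedD: "is_closed L U A X \<Longrightarrow> rule L U A t y \<Longrightarrow> set t \<subseteq> X \<Longrightarrow> y \<in> X"
  unfolding is_closed_def by blast

lemma closed_subset: "is_closed L U A X \<Longrightarrow> X \<subseteq> verts A"
  unfolding is_closed_def by blast

lemma unsplitD:
  assumes "unsplit L U A" "is_closed L U A X1" "is_closed L U A X2" "verts A \<subseteq> X1 \<union> X2"
    "\<And>e. edge L A e \<Longrightarrow> set e \<subseteq> X1 \<or> set e \<subseteq> X2"
  shows "verts A \<subseteq> X1 \<or> verts A \<subseteq> X2"
  using assms unfolding unsplit_def by simp

lemma closed_verts: "is_structure L A \<Longrightarrow> is_closed L U A (verts A)"
  unfolding is_closed_def by (auto dest: rule_verts)

lemma closed_Int: "is_closed L U A X \<Longrightarrow> is_closed L U A Y \<Longrightarrow> is_closed L U A (X \<inter> Y)"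
  unfolding is_closed_def by blast

lemma closed_closure_in: "is_structure L A \<Longrightarrow> is_closed L U A (closure_in L U A X)"
proof -
  assume A: "is_structure L A"
  have "y \<in> Y" if "rule L U A t y" "set t \<subseteq> closure_in L U A X" "is_closed L U A Y" "X \<subseteq> Y" for t y Y
  proof -
    have "set t \<subseteq> Y" using that(2-4) unfolding closure_in_def by blast
    then show ?thesis using that(1,3) unfolding is_closed_def by blast
  qed
  then show ?thesis using rule_verts[OF A] unfolding is_closed_def[of L U A "closure_in L U A X"]
    by (auto simp: closure_in_def)
qed

lemma closure_in_superset: "X \<subseteq> verts A \<Longrightarrow> X \<subseteq> closure_in L U A X"
  unfolding closure_in_def by blast

lemma closure_in_least: "is_closed L U A Y \<Longrightarrow> X \<subseteq> Y \<Longrightarrow> closure_in L U A X \<subseteq> Y"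
  unfolding closure_in_def by blast

lemma restr_structure:
  assumes "is_structure L A" "is_closed L U A X"
  shows "is_structure L (restr A X)"
proof -
  have X: "X \<subseteq> verts A" "\<And>F t y. F \<in> funs L \<Longrightarrow> fn A F t = Some y \<Longrightarrow> set t \<subseteq> X \<Longrightarrow> y \<in> X"
    using assms(2) unfolding is_closed_def rule_def by blast+
  have "countable X" using assms(1) X(1) unfolding is_structure_def by (meson countable_subset)
  moreover have "xs \<in> tuples X (fun_arity L F)" if "xs \<in> dom (fn (restr A X) F)" for F xs
    using structure_fn[OF assms(1), of F xs] that by (auto simp: tuples_def dom_def split: if_splits)
  moreover have "ran (fn (restr A X) F) \<subseteq> X" if "F \<in> funs L" for F
    using X(2) that by (auto simp: ran_def split: if_splits)
  moreover have "xs \<in> tuples X (rel_arity L R)" if "xs \<in> rel (restr A X) R" for R xs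
    using structure_rel[OF assms(1), of xs R] that by (auto simp: tuples_def)
  moreover have "rel (restr A X) R = {}" if "R \<notin> rels L" for R
    using assms(1) that unfolding is_structure_def by (auto simp: restr_def)
  moreover have "fn (restr A X) F = Map.empty" if "F \<notin> funs L" for F
    using assms(1) that unfolding is_structure_def by (auto simp: restr_def restrict_map_def fun_eq_iff)
  ultimately show ?thesis unfolding is_structure_def restr_simps(1) by blast
qed

lemma restr_embedding:
  assumes "is_structure L A" "is_closed L U A X"
  shows "embedding L (restr A X) A id"
  using assms(2) unfolding embedding_iff[OF restr_structure[OF assms] assms(1)] is_closed_def
  by (auto simp: option.map_id)

lemma restr_rule: "is_structure L (A :: ('r,'f,'v) lstruct) \<Longrightarrow> is_closed L U' A X \<Longrightarrow> U'' \<subseteq> U' \<Longrightarrow> rule L U'' (restr A X) t y \<longleftrightarrow> rule L U'' A t y \<and> set t \<subseteq> X"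
proof -
  assume a: "is_structure L A" "is_closed L U' A X" "U'' \<subseteq> U'"
  show ?thesis
  proof
    assume "rule L U'' (restr A X) t y"
    then show "rule L U'' A t y \<and> set t \<subseteq> X" unfolding rule_def by (auto split: if_splits)
  next
    assume b: "rule L U'' A t y \<and> set t \<subseteq> X"
    show "rule L U'' (restr A X) t y"
    proof (cases "\<exists>F\<in>funs L. fn A F t = Some y")
      case True then show ?thesis using b unfolding rule_def by auto
    next
      case False
      then obtain R S ys where *: "(R, S) \<in> U''" "R \<in> rels L" "t @ ys \<in> rel A R" "length t = card (verts S)" "y \<in> set ys"
        using b unfolding rule_def by blast
      have "rule L U' A t z" if "z \<in> set ys" for z using * that a(3) unfolding rule_def by blast
      then have "set ys \<subseteq> X" using a(2) b unfolding is_closed_def by blast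
      then show ?thesis using * b by (intro rule_relI[OF *(1,2) _ *(4,5)]) auto
    qed
  qed
qed

lemma restr_edge: "edge L (restr A X) e \<longleftrightarrow> edge L A e \<and> set e \<subseteq> X"
  unfolding edge_def by (auto simp: dom_def split: if_splits)

lemma restr_closed: "is_structure L A \<Longrightarrow> is_closed L U A X \<Longrightarrow> is_closed L U (restr A X) Y \<longleftrightarrow> is_closed L U A Y \<and> Y \<subseteq> X"
proof -
  assume A: "is_structure L A" and X: "is_closed L U A X"
  have r: "rule L U (restr A X) t y \<longleftrightarrow> rule L U A t y \<and> set t \<subseteq> X" for t y
    using restr_rule[OF A X subset_refl] .
  have Xv: "X \<subseteq> verts A" using X unfolding is_closed_def by blast
  show ?thesis
  proof
    assume l: "is_closed L U (restr A X) Y"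
    then have Y: "Y \<subseteq> X" "\<And>t y. rule L U (restr A X) t y \<Longrightarrow> set t \<subseteq> Y \<Longrightarrow> y \<in> Y"
      unfolding is_closed_def by auto
    have "y \<in> Y" if "rule L U A t y" "set t \<subseteq> Y" for t y
      using Y(2)[of t y] r[of t y] that Y(1) by simp
    then show "is_closed L U A Y \<and> Y \<subseteq> X" using Y(1) Xv unfolding is_closed_def by auto
  next
    assume "is_closed L U A Y \<and> Y \<subseteq> X"
    then show "is_closed L U (restr A X) Y" unfolding is_closed_def r restr_simps by blast
  qed
qed

lemma restr_restr: "Y \<subseteq> X \<Longrightarrow> restr (restr A X) Y = restr A Y"
  unfolding restr_def by (auto simp: fun_eq_iff restrict_map_def)

lemma restr_verts: "is_structure L A \<Longrightarrow> restr A (verts A) = (A :: ('r,'f,'v) lstruct)"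
proof -
  assume a: "is_structure L A"
  have "rel (restr A (verts A)) = rel A" using structure_rel[OF a] by (auto simp: fun_eq_iff)
  moreover have "fn (restr A (verts A)) F xs = fn A F xs" for F xs
    using structure_fn[OF a] by (cases "fn A F xs") auto
  ultimately show ?thesis by (simp add: lstruct.equality fun_eq_iff)
qed

lemma substructure_restr: "substructure L S A \<Longrightarrow> S = restr A (verts S) \<and> is_closed L {} A (verts S)"
proof -
  assume "substructure L S A"
  then have a: "is_structure L S" "is_structure L A" "verts S \<subseteq> verts A" "embedding L S A id"
    unfolding substructure_def by auto
  have e: "\<And>R xs. R\<in>rels L \<Longrightarrow> set xs \<subseteq> verts S \<Longrightarrow> (xs \<in> rel A R \<longleftrightarrow> xs \<in> rel S R)"
    "\<And>F xs. F\<in>funs L \<Longrightarrow> set xs \<subseteq> verts S \<Longrightarrow> fn A F xs = fn S F xs"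
    using a(4) unfolding embedding_iff[OF a(1,2)] by (auto simp: option.map_id)
  have "xs \<in> rel S R \<longleftrightarrow> xs \<in> rel (restr A (verts S)) R" for R xs
    using e(1)[of R xs] structure_rel[OF a(1), of xs R] structure_rel[OF a(2), of xs R] by auto
  then have "rel S R = rel (restr A (verts S)) R" for R by blast
  moreover have "fn S F xs = fn (restr A (verts S)) F xs" for F xs
  proof (cases "F \<in> funs L")
    case True
    show ?thesis
    proof (cases "set xs \<subseteq> verts S")
      case True with e(2)[OF \<open>F \<in> funs L\<close> True] show ?thesis by simp
    next
      case False
      then show ?thesis using structure_fn[OF a(1), of F xs] by (cases "fn S F xs") auto
    qed
  next
    case False
    then have "fn S F = Map.empty" "fn A F = Map.empty" using a(1,2) unfolding is_structure_def by auto
    then show ?thesis by simp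
  qed
  ultimately have 1: "S = restr A (verts S)" by (intro lstruct.equality) (auto simp: fun_eq_iff)
  have "is_closed L {} A (verts S)" unfolding is_closed_def rule_def using a(3) e(2) structure_fn[OF a(1)] by auto
  then show ?thesis using 1 by simp
qed

lemma restr_substructure:
  assumes "is_structure L A" "is_closed L U A X"
  shows "substructure L (restr A X) A"
  using restr_structure[OF assms] restr_embedding[OF assms] assms
  unfolding substructure_def is_closed_def by simp

definition irreducible_in :: "('r, 'f) lang \<Rightarrow> ('r, 'f) closure_descr \<Rightarrow> ('r, 'f, 'v) lstruct \<Rightarrow> 'v set \<Rightarrow> bool" where
  "irreducible_in L U A Z \<longleftrightarrow> is_closed L U A Z \<and> unsplit L U (restr A Z)"

definition rooted :: "('r, 'f) lang \<Rightarrow> ('r, 'f) closure_descr \<Rightarrow> ('r, 'f, 'v) lstruct \<Rightarrow> 'r \<Rightarrow> 'v list \<Rightarrow> bool" where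
  "rooted L U A R t \<longleftrightarrow> (\<exists>S. (R, S) \<in> U \<and> card (verts S) = length t \<and> represents_embedding L S A t)"

lemma U_closed_structure: "U_closed L U A \<Longrightarrow> is_structure L A"
  unfolding U_closed_def by simp

lemma out_degree_eq_0: "out_degree A R t = 0 \<longleftrightarrow> (\<forall>ys. t @ ys \<notin> rel A R)"
proof -
  have "(if finite E then enat (card E) else \<infinity>) = 0 \<longleftrightarrow> E = {}" for E :: "'c list set"
    by (auto simp: zero_enat_def)
  from this[of "{ys. t @ ys \<in> rel A R}"] show ?thesis unfolding out_degree_def Let_def by blast
qed

lemma out_degree_eq_1: "out_degree A R t = 1 \<longleftrightarrow> (\<exists>!ys. t @ ys \<in> rel A R)"
proof -
  have "(if finite E then enat (card E) else \<infinity>) = 1 \<longleftrightarrow> (\<exists>!x. x \<in> E)" for E :: "'c list set"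
  proof -
    have "(if finite E then enat (card E) else \<infinity>) = 1 \<longleftrightarrow> card E = 1"
      by (auto simp: one_enat_def)
    also have "\<dots> \<longleftrightarrow> (\<exists>x. E = {x})" by (simp add: card_1_singleton_iff)
    also have "\<dots> \<longleftrightarrow> (\<exists>!x. x \<in> E)" by auto
    finally show ?thesis .
  qed
  from this[of "{ys. t @ ys \<in> rel A R}"] show ?thesis unfolding out_degree_def Let_def by simp
qed

lemma U_closed_iff:
  "U_closed L U A \<longleftrightarrow> is_structure L A \<and>
     (\<forall>R S t. (R, S) \<in> U \<and> length t = card (verts S) \<and> set t \<subseteq> verts A \<longrightarrow>
        (rooted L U A R t \<longrightarrow> (\<exists>!ys. t @ ys \<in> rel A R)) \<and>
        (\<not> rooted L U A R t \<longrightarrow> (\<forall>ys. t @ ys \<notin> rel A R)))"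
proof -
  have 1: "(out_degree A R t = (if P then 1 else 0)) \<longleftrightarrow>
      (P \<longrightarrow> (\<exists>!ys. t @ ys \<in> rel A R)) \<and> (\<not> P \<longrightarrow> (\<forall>ys. t @ ys \<notin> rel A R))" for R t P
    by (simp add: out_degree_eq_0 out_degree_eq_1)
  show ?thesis unfolding U_closed_def tuples_def 1 rooted_def by fastforce
qed

lemma U_closed_ex1:
  "U_closed L U A \<Longrightarrow> (R, S) \<in> U \<Longrightarrow> length t = card (verts S) \<Longrightarrow> set t \<subseteq> verts A
    \<Longrightarrow> rooted L U A R t \<Longrightarrow> \<exists>!ys. t @ ys \<in> rel A R"
  unfolding U_closed_iff by blast

lemma U_closed_rooted:
  assumes "U_closed L U A" "(R, S) \<in> U" "length t = card (verts S)" "t @ ys \<in> rel A R"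
  shows "rooted L U A R t"
proof -
  have "set t \<subseteq> verts A" using structure_rel[OF U_closed_structure[OF assms(1)] assms(4)] by simp
  then show ?thesis using assms unfolding U_closed_iff by blast
qed

lemma U_closed_unique:
  assumes "U_closed L U A" "(R, S) \<in> U" "length t = card (verts S)" "t @ ys \<in> rel A R" "t @ zs \<in> rel A R"
  shows "ys = zs"
proof -
  have "set t \<subseteq> verts A" using structure_rel[OF U_closed_structure[OF assms(1)] assms(4)] by simp
  then have "\<exists>!ys. t @ ys \<in> rel A R"
    using U_closed_ex1[OF assms(1-3) _ U_closed_rooted[OF assms(1-4)]] by blast
  then show ?thesis using assms(4,5) by blast
qed

lemma U_closedI:
  assumes "is_structure L A"
    and "\<And>R S t. (R, S) \<in> U \<Longrightarrow> length t = card (verts S) \<Longrightarrow> set t \<subseteq> verts A \<Longrightarrow> rooted L U A R t \<Longrightarrow> \<exists>ys. t @ ys \<in> rel A R"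
    and "\<And>R S t ys zs. (R, S) \<in> U \<Longrightarrow> length t = card (verts S) \<Longrightarrow> t @ ys \<in> rel A R \<Longrightarrow> t @ zs \<in> rel A R \<Longrightarrow> ys = zs"
    and "\<And>R S t ys. (R, S) \<in> U \<Longrightarrow> length t = card (verts S) \<Longrightarrow> t @ ys \<in> rel A R \<Longrightarrow> rooted L U A R t"
  shows "U_closed L U A"
  unfolding U_closed_iff using assms(1) assms(2) assms(3) assms(4) by (metis (no_types, lifting))

text \<open>The right cancellation property of embeddings, by which maps into a structure that is
  embedded elsewhere need be examined only there.\<close>
lemma embedding_reflect:
  assumes e: "embedding L S B (f \<circ> g)" "embedding L A B f" and g: "g ` verts S \<subseteq> verts A"
    and st: "is_structure L S" "is_structure L A" "is_structure L B"
  shows "embedding L S A g"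
proof -
  have 1: "inj_on (f \<circ> g) (verts S)"
    "\<And>R xs. R\<in>rels L \<Longrightarrow> set xs \<subseteq> verts S \<Longrightarrow> (map (f \<circ> g) xs \<in> rel B R \<longleftrightarrow> xs \<in> rel S R)"
    "\<And>F xs. F\<in>funs L \<Longrightarrow> set xs \<subseteq> verts S \<Longrightarrow> fn B F (map (f \<circ> g) xs) = map_option (f \<circ> g) (fn S F xs)"
    using e(1) unfolding embedding_iff[OF st(1,3)] by auto
  have 2: "inj_on f (verts A)"
    "\<And>R xs. R\<in>rels L \<Longrightarrow> set xs \<subseteq> verts A \<Longrightarrow> (map f xs \<in> rel B R \<longleftrightarrow> xs \<in> rel A R)"
    "\<And>F xs. F\<in>funs L \<Longrightarrow> set xs \<subseteq> verts A \<Longrightarrow> fn B F (map f xs) = map_option f (fn A F xs)"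
    using e(2) unfolding embedding_iff[OF st(2,3)] by auto
  have im: "set (map g xs) \<subseteq> verts A" if "set xs \<subseteq> verts S" for xs using g that by auto
  show ?thesis unfolding embedding_iff[OF st(1,2)]
  proof (intro conjI ballI allI impI)
    show "g ` verts S \<subseteq> verts A" by (rule g)
    show "inj_on g (verts S)" using 1(1) by (rule inj_on_imageI2)
  next
    fix R xs assume *: "R \<in> rels L" "set xs \<subseteq> verts S"
    show "(map g xs \<in> rel A R) = (xs \<in> rel S R)"
      using 1(2)[OF *] 2(2)[OF *(1) im[OF *(2)]] by simp
  next
    fix F xs assume *: "F \<in> funs L" "set xs \<subseteq> verts S"
    have eq: "map_option f (fn A F (map g xs)) = map_option (f \<circ> g) (fn S F xs)"
      using 1(3)[OF *] 2(3)[OF *(1) im[OF *(2)]] by simp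
    show "fn A F (map g xs) = map_option g (fn S F xs)"
    proof (cases "fn S F xs")
      case None then show ?thesis using eq by simp
    next
      case (Some y)
      then obtain z where z: "fn A F (map g xs) = Some z" "f z = f (g y)" using eq by auto
      have "z \<in> verts A" "g y \<in> verts A" using structure_fn[OF st(2) z(1)] structure_fn[OF st(1) Some] g by auto
      then have "z = g y" using z(2) 2(1) by (meson inj_onD)
      then show ?thesis using z Some by simp
    qed
  qed
qed

lemma embedding_image_closed_empty:
  assumes "embedding L A B f" "is_structure L A" "is_structure L B"
  shows "is_closed L {} B (f ` verts A)"
  unfolding is_closed_def
proof (intro conjI allI impI)
  show "f ` verts A \<subseteq> verts B" using assms(1) unfolding embedding_iff[OF assms(2,3)] by blast
next
  fix t y assume t: "rule L {} B t y \<and> set t \<subseteq> f ` verts A"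
  then obtain F where F: "F \<in> funs L" "fn B F t = Some y" unfolding rule_def by blast
  from t obtain xs where xs: "t = map f xs" "set xs \<subseteq> verts A"
    by (elim conjE list_in_image)
  have "map_option f (fn A F xs) = Some y"
    using assms(1) F xs unfolding embedding_iff[OF assms(2,3)] by metis
  then show "y \<in> f ` verts A" using structure_fn[OF assms(2)] by (auto)
qed

lemma embedding_into_restr:
  assumes e: "embedding L A B f" and "is_structure L A" "is_structure L B" "is_closed L U B X" "f ` verts A \<subseteq> X"
  shows "embedding L A (restr B X) f"
  by (rule embedding_reflect[OF _ restr_embedding[OF assms(3,4)]])
    (use assms restr_structure[OF assms(3,4)] in auto)

lemma embedding_restr:
  assumes e: "embedding L A B f" and "is_structure L A" "is_structure L B" "is_closed L U A X"
  shows "embedding L (restr A X) B f"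
  using embedding_comp[OF restr_embedding[OF assms(2,4)] e restr_structure[OF assms(2,4)] assms(2,3)] by simp

lemma embedding_inv:
  assumes e: "embedding L A B f" and A: "is_structure L A" and B: "is_structure L B"
  shows "embedding L (restr B (f ` verts A)) A (inv_into (verts A) f)"
proof -
  note c = embedding_image_closed_empty[OF assms]
  have "embedding L (restr B (f ` verts A)) B (f \<circ> inv_into (verts A) f)"
    by (rule embedding_cong[OF restr_embedding[OF B c] _ restr_structure[OF B c] B])
      (auto simp: f_inv_into_f)
  then show ?thesis
    by (rule embedding_reflect[OF _ e]) (auto simp: A B restr_structure[OF B c] inv_into_into)
qed

text \<open>Preimages of closed sets under a homomorphism are closed, and edges map to edges. A
  decomposition of the image would therefore pull back to one of \<open>M\<close>.\<close>
lemma unsplit_hom_image: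
  assumes M: "unsplit L U' M" and U': "U' \<subseteq> U" and p: "homomorphism L M Q p"
    and X: "is_closed L U Q X1" "is_closed L U Q X2" "p ` verts M \<subseteq> X1 \<union> X2"
    and e: "\<And>e. edge L Q e \<Longrightarrow> set e \<subseteq> p ` verts M \<Longrightarrow> set e \<subseteq> X1 \<or> set e \<subseteq> X2"
  shows "p ` verts M \<subseteq> X1 \<or> p ` verts M \<subseteq> X2"
proof -
  have Ms: "is_structure L M" using M unfolding unsplit_def by simp
  let ?Y = "\<lambda>X. {x \<in> verts M. p x \<in> X}"
  have c: "is_closed L U' M (?Y X)" if "is_closed L U Q X" for X
    unfolding is_closed_def
  proof (intro conjI allI impI)
    fix t y assume t: "rule L U' M t y \<and> set t \<subseteq> ?Y X"
    then have "rule L U Q (map p t) (p y)" by (intro hom_rule[OF p] rule_mono[OF U']) simp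
    moreover have "set (map p t) \<subseteq> X" using t by auto
    ultimately have "p y \<in> X" using that unfolding is_closed_def by blast
    then show "y \<in> ?Y X" using rule_verts[OF Ms] t by blast
  qed blast
  have "set e \<subseteq> ?Y X1 \<or> set e \<subseteq> ?Y X2" if "edge L M e" for e
  proof -
    have v: "set e \<subseteq> verts M" using edge_verts[OF Ms that] .
    then have "set (map p e) \<subseteq> X1 \<or> set (map p e) \<subseteq> X2"
      by (intro assms(7) hom_edge[OF p that]) auto
    then show ?thesis using v by auto
  qed
  then have "verts M \<subseteq> ?Y X1 \<or> verts M \<subseteq> ?Y X2"
    using X(3) by (intro unsplitD[OF M c[OF X(1)] c[OF X(2)]]) auto
  then show ?thesis by blast
qed

lemma irreducible_inI:
  assumes Q: "is_structure L Q" and Z: "is_closed L U Q Z"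
    and s: "\<And>X1 X2. is_closed L U Q X1 \<Longrightarrow> is_closed L U Q X2 \<Longrightarrow> X1 \<subseteq> Z \<Longrightarrow> X2 \<subseteq> Z \<Longrightarrow> Z \<subseteq> X1 \<union> X2 \<Longrightarrow>
      (\<And>e. edge L Q e \<Longrightarrow> set e \<subseteq> Z \<Longrightarrow> set e \<subseteq> X1 \<or> set e \<subseteq> X2) \<Longrightarrow> Z \<subseteq> X1 \<or> Z \<subseteq> X2"
  shows "irreducible_in L U Q Z"
  unfolding irreducible_in_def unsplit_def restr_closed[OF Q Z] restr_edge restr_simps(1)
proof (intro conjI allI impI)
  show "is_closed L U Q Z" by (rule Z)
  show "is_structure L (restr Q Z)" by (rule restr_structure[OF Q Z])
next
  fix X1 X2
  assume *: "(is_closed L U Q X1 \<and> X1 \<subseteq> Z) \<and> (is_closed L U Q X2 \<and> X2 \<subseteq> Z) \<and> Z \<subseteq> X1 \<union> X2 \<and>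
    (\<forall>e. edge L Q e \<and> set e \<subseteq> Z \<longrightarrow> set e \<subseteq> X1 \<or> set e \<subseteq> X2)"
  show "Z \<subseteq> X1 \<or> Z \<subseteq> X2" by (rule s) (use * in simp_all)
qed

text \<open>Of two closed sets that split the closure of the image, one contains the image and
  hence also its closure. The closure description of \<open>M\<close> may be smaller because the members
  of the class and the roots are irreducible as plain structures.\<close>
lemma irreducible_in_closure:
  assumes M: "unsplit L U' M" and U': "U' \<subseteq> U" and p: "homomorphism L M Q p" and Q: "is_structure L Q"
  shows "irreducible_in L U Q (closure_in L U Q (p ` verts M))"
proof (rule irreducible_inI[OF Q closed_closure_in[OF Q]])
  have pv: "p ` verts M \<subseteq> verts Q" using p unfolding homomorphism_iff by simp
  fix X1 X2
  assume X: "is_closed L U Q X1" "is_closed L U Q X2" "closure_in L U Q (p ` verts M) \<subseteq> X1 \<union> X2"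
    and e: "\<And>e. edge L Q e \<Longrightarrow> set e \<subseteq> closure_in L U Q (p ` verts M) \<Longrightarrow> set e \<subseteq> X1 \<or> set e \<subseteq> X2"
  note sub = closure_in_superset[OF pv, of L U]
  have "p ` verts M \<subseteq> X1 \<or> p ` verts M \<subseteq> X2"
    by (rule unsplit_hom_image[OF M U' p X(1,2) subset_trans[OF sub X(3)]])
      (rule e[OF _ subset_trans[OF _ sub]])
  then show "closure_in L U Q (p ` verts M) \<subseteq> X1 \<or> closure_in L U Q (p ` verts M) \<subseteq> X2"
    using closure_in_least[OF X(1)] closure_in_least[OF X(2)] by auto
qed

lemma irreducible_in_closure_edge:
  assumes Q: "is_structure L Q" and e: "edge L Q e"
  shows "irreducible_in L U Q (closure_in L U Q (set e))"
proof (rule irreducible_inI[OF Q closed_closure_in[OF Q]])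
  fix X1 X2
  assume X: "is_closed L U Q X1" "is_closed L U Q X2"
    and *: "\<And>e'. edge L Q e' \<Longrightarrow> set e' \<subseteq> closure_in L U Q (set e) \<Longrightarrow> set e' \<subseteq> X1 \<or> set e' \<subseteq> X2"
  have "set e \<subseteq> X1 \<or> set e \<subseteq> X2" using *[OF e closure_in_superset[OF edge_verts[OF Q e]]] .
  then show "closure_in L U Q (set e) \<subseteq> X1 \<or> closure_in L U Q (set e) \<subseteq> X2"
    using closure_in_least[OF X(1)] closure_in_least[OF X(2)] by auto
qed

text \<open>A decomposition into closed sets is a free amalgamation of the induced substructures
  over their intersection. This links \<open>unsplit\<close> to both notions of irreducibility.\<close>
lemma split_free_amalgamation:
  assumes C: "is_structure L C" and X: "is_closed L U C X1" "is_closed L U C X2"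
    and cov: "verts C \<subseteq> X1 \<union> X2" and e: "\<And>e. edge L C e \<Longrightarrow> set e \<subseteq> X1 \<or> set e \<subseteq> X2"
  shows "is_structure L (restr C (X1 \<inter> X2))"
    "embedding L (restr C (X1 \<inter> X2)) (restr C X1) id" "embedding L (restr C (X1 \<inter> X2)) (restr C X2) id"
    "free_amalgamation L (restr C (X1 \<inter> X2)) (restr C X1) (restr C X2) id id C id id"
proof -
  note X12 = closed_Int[OF X]
  show s: "is_structure L (restr C (X1 \<inter> X2))" by (rule restr_structure[OF C X12])
  note em = restr_embedding[OF C X12]
  show "embedding L (restr C (X1 \<inter> X2)) (restr C X1) id"
    by (rule embedding_into_restr[OF em s C X(1)]) simp
  show "embedding L (restr C (X1 \<inter> X2)) (restr C X2) id"
    by (rule embedding_into_restr[OF em s C X(2)]) simp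
  have v: "X1 \<subseteq> verts C" "X2 \<subseteq> verts C" using X unfolding is_closed_def by auto
  have free: "\<not> (set xs \<inter> id ` (verts (restr C X1) - id ` verts (restr C (X1 \<inter> X2))) \<noteq> {} \<and>
      set xs \<inter> id ` (verts (restr C X2) - id ` verts (restr C (X1 \<inter> X2))) \<noteq> {})"
    if "xs \<in> (\<Union>R\<in>rels L. rel C R) \<union> (\<Union>F\<in>funs L. dom (fn C F))" for xs
  proof -
    have "edge L C xs" using that unfolding edge_def by blast
    then have "set xs \<subseteq> X1 \<or> set xs \<subseteq> X2" by (rule e)
    then show ?thesis by auto
  qed
  have "verts C = X1 \<union> X2" using v cov by blast
  then show "free_amalgamation L (restr C (X1 \<inter> X2)) (restr C X1) (restr C X2) id id C id id"
    unfolding free_amalgamation_def strong_amalgamation_def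
    using C restr_embedding[OF C X(1)] restr_embedding[OF C X(2)] free by (intro conjI ballI) simp_all
qed

lemma irreducible_unsplit:
  fixes C :: "('a, 'b, 'c) lstruct"
  assumes "irreducible_structure L C"
  shows "unsplit L {} C"
proof (rule ccontr)
  have C: "is_structure L C" using assms unfolding irreducible_structure_def by simp
  assume "\<not> unsplit L {} C"
  then obtain X1 X2 where X: "is_closed L {} C X1" "is_closed L {} C X2" "verts C \<subseteq> X1 \<union> X2"
    "\<And>e. edge L C e \<Longrightarrow> set e \<subseteq> X1 \<or> set e \<subseteq> X2" "\<not> verts C \<subseteq> X1" "\<not> verts C \<subseteq> X2"
    unfolding unsplit_def using C by auto
  have "verts (restr C X1) \<noteq> verts C" "verts (restr C X2) \<noteq> verts C" using X(5,6) by auto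
  then have "restr C X1 \<noteq> C" "restr C X2 \<noteq> C" by metis+
  then have "proper_substructure L (restr C X1) C" "proper_substructure L (restr C X2) C"
    unfolding proper_substructure_def using restr_substructure[OF C X(1)] restr_substructure[OF C X(2)] by simp_all
  then have "\<exists>(A :: ('a, 'b, 'c) lstruct) B1 B2 \<alpha>1 \<alpha>2.
      is_structure L A \<and> proper_substructure L B1 C \<and> proper_substructure L B2 C \<and>
      embedding L A B1 \<alpha>1 \<and> embedding L A B2 \<alpha>2 \<and> free_amalgamation L A B1 B2 \<alpha>1 \<alpha>2 C id id"
    using split_free_amalgamation[OF C X(1-4)]
    by (intro exI[of _ "restr C (X1 \<inter> X2)"] exI[of _ "restr C X1"] exI[of _ "restr C X2"] exI[of _ id] conjI)
  then show False using assms unfolding irreducible_structure_def by argo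
qed

locale closure_setting =
  fixes L :: "('r, 'f) lang" and U :: "('r, 'f) closure_descr"
  assumes lang: "is_language L" and cdescr: "closure_description L U"
begin

lemma root:
  assumes "(R, S) \<in> U"
  shows "R \<in> rels L" "is_structure L S" "verts S = {1..card (verts S)}" "card (verts S) > 0" "unsplit L {} S"
proof -
  have *: "R \<in> rels L" "irreducible_structure L S" "verts S \<noteq> {}" "\<exists>m. verts S = {1..m}"
    using assms cdescr unfolding closure_description_def by blast+
  show "R \<in> rels L" "is_structure L S" using * unfolding irreducible_structure_def by auto
  obtain m where m: "verts S = {1..m}" using *(4) by blast
  then have c: "card (verts S) = m" by simp
  show "verts S = {1..card (verts S)}" unfolding c by (rule m)
  show "card (verts S) > 0" unfolding c using *(3) m by (cases m) simp_all
  show "unsplit L {} S" by (rule irreducible_unsplit[OF *(2)])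
qed

text \<open>Roots have the vertices \<open>1, \<dots>, m\<close> while positions of a list start at \<open>0\<close>.\<close>
lemma root_image:
  assumes "(R, S) \<in> U" "card (verts S) = length t"
  shows "(\<lambda>i. t ! (i - 1)) ` verts S = set t"
proof -
  have "(\<lambda>i. t ! (i - 1)) ` {1..length t} = set t"
  proof (intro equalityI subsetI)
    fix x assume "x \<in> (\<lambda>i. t ! (i - 1)) ` {1..length t}"
    then show "x \<in> set t" by (auto intro!: nth_mem)
  next
    fix x assume "x \<in> set t"
    then obtain j where "j < length t" "t ! j = x" by (auto simp: in_set_conv_nth)
    then show "x \<in> (\<lambda>i. t ! (i - 1)) ` {1..length t}" by (intro image_eqI[of _ _ "Suc j"]) auto
  qed
  then show ?thesis using root(3)[OF assms(1)] assms(2) by simp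
qed

lemma represents_map:
  assumes A: "is_structure L A" and B: "is_structure L B" and f: "embedding L A B f"
    and t: "set t \<subseteq> verts A" and S: "(R, S) \<in> U" "card (verts S) = length t"
  shows "represents_embedding L S B (map f t) \<longleftrightarrow> represents_embedding L S A t"
proof -
  let ?g = "\<lambda>i. t ! (i - 1)"
  have g: "?g ` verts S \<subseteq> verts A" using root_image[OF S] t by simp
  have eq: "map f t ! (i - 1) = (f \<circ> ?g) i" if "i \<in> verts S" for i
  proof -
    have "i \<in> {1..length t}" using that root(3)[OF S(1)] S(2) by simp
    then have "i - 1 < length t" by auto
    then show ?thesis by simp
  qed
  have "represents_embedding L S B (map f t) \<longleftrightarrow> embedding L S B (f \<circ> ?g)"
    unfolding represents_embedding_def
  proof
    assume "embedding L S B (\<lambda>i. map f t ! (i - 1))"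
    then show "embedding L S B (f \<circ> ?g)" by (rule embedding_cong[OF _ eq root(2)[OF S(1)] B])
  next
    assume "embedding L S B (f \<circ> ?g)"
    then show "embedding L S B (\<lambda>i. map f t ! (i - 1))"
      by (rule embedding_cong[OF _ eq[symmetric] root(2)[OF S(1)] B])
  qed
  also have "\<dots> \<longleftrightarrow> embedding L S A ?g"
    by (rule iffI[OF embedding_reflect[OF _ f g root(2)[OF S(1)] A B] embedding_comp[OF _ f root(2)[OF S(1)] A B]])
  finally show ?thesis unfolding represents_embedding_def .
qed

lemma rooted_map:
  assumes "is_structure L A" "is_structure L B" "embedding L A B f" "set t \<subseteq> verts A"
  shows "rooted L U B R (map f t) \<longleftrightarrow> rooted L U A R t"
  unfolding rooted_def using represents_map[OF assms] by auto

text \<open>If \<open>t\<close> has an extension in \<open>B\<close> and comes from \<open>A\<close>, then it is rooted in \<open>B\<close>, hence in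
  \<open>A\<close>, and so extends in \<open>A\<close>. As the extension in \<open>B\<close> is unique, it is the image of the one
  in \<open>A\<close>.\<close>
lemma embedding_image_closed:
  assumes f: "embedding L A B f" and A: "U_closed L U A" and B: "U_closed L U B"
  shows "is_closed L U B (f ` verts A)"
proof -
  note As = U_closed_structure[OF A] and Bs = U_closed_structure[OF B]
  show ?thesis unfolding is_closed_def
  proof (intro conjI allI impI)
    show "f ` verts A \<subseteq> verts B" using f unfolding embedding_iff[OF As Bs] by blast
  next
    fix t y assume t: "rule L U B t y \<and> set t \<subseteq> f ` verts A"
    then have "rule L U B t y" by blast
    then show "y \<in> f ` verts A"
    proof (cases rule: rule_cases)
      case (fn F)
      then have "rule L {} B t y" by (intro rule_fnI)
      then show ?thesis using closedD[OF embedding_image_closed_empty[OF f As Bs]] t by simp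
    next
      case (rel R S ys)
      from t obtain xs where xs: "t = map f xs" "set xs \<subseteq> verts A"
        by (elim conjE list_in_image)
      have "rooted L U B R t" using U_closed_rooted[OF B rel(1,4,3)] .
      then have "rooted L U A R xs" using rooted_map[OF As Bs f xs(2)] xs(1) by simp
      then obtain zs where zs: "xs @ zs \<in> rel A R"
        using U_closed_ex1[OF A rel(1) _ xs(2)] rel(4) xs(1) by auto
      then have "map f (xs @ zs) \<in> rel B R" by (rule hom_rel[OF embedding_hom[OF f] rel(2)])
      then have "t @ map f zs \<in> rel B R" using xs(1) by simp
      then have "ys = map f zs" by (rule U_closed_unique[OF B rel(1,4,3)])
      then show ?thesis using rel(5) structure_rel[OF As zs] by auto
    qed
  qed
qed

lemma restr_U_closed:
  assumes A: "U_closed L U A" and X: "is_closed L U A X"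
  shows "U_closed L U (restr A X)"
proof -
  note As = U_closed_structure[OF A]
  note Rs = restr_structure[OF As X] and em = restr_embedding[OF As X]
  have ro: "rooted L U A R t \<longleftrightarrow> rooted L U (restr A X) R t" if "set t \<subseteq> X" for R t
    using rooted_map[OF Rs As em, of t R] that by simp
  show ?thesis
  proof (rule U_closedI[OF Rs])
    fix R S t assume *: "(R, S) \<in> U" "length t = card (verts S)" "set t \<subseteq> verts (restr A X)" "rooted L U (restr A X) R t"
    then have t: "set t \<subseteq> X" by simp
    have "set t \<subseteq> verts A" using t X unfolding is_closed_def by blast
    then obtain ys where ys: "t @ ys \<in> rel A R" using U_closed_ex1[OF A *(1,2)] ro[OF t] *(4) by blast
    have "y \<in> X" if "y \<in> set ys" for y
      using rule_relI[OF *(1) root(1)[OF *(1)] ys *(2) that] t X unfolding is_closed_def by blast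
    then show "\<exists>ys. t @ ys \<in> rel (restr A X) R" using ys t by (intro exI[of _ ys]) auto
  next
    fix R S t ys zs
    assume "(R, S) \<in> U" "length t = card (verts S)" "t @ ys \<in> rel (restr A X) R" "t @ zs \<in> rel (restr A X) R"
    then show "ys = zs" using U_closed_unique[OF A] by simp
  next
    fix R S t ys
    assume *: "(R, S) \<in> U" "length t = card (verts S)" "t @ ys \<in> rel (restr A X) R"
    then have "rooted L U A R t" "set t \<subseteq> X" using U_closed_rooted[OF A *(1,2)] by auto
    then show "rooted L U (restr A X) R t" using ro by blast
  qed
qed

text \<open>Closed sets induce \<open>\<U>\<close>-closed substructures, so that a splitting is a free
  amalgamation of the forbidden kind.\<close>
lemma U_irreducible_unsplit:
  fixes C :: "('r, 'f, 'v) lstruct"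
  assumes "U_irreducible L U C"
  shows "unsplit L U C"
proof (rule ccontr)
  have Cu: "U_closed L U C" using assms unfolding U_irreducible_def by simp
  note C = U_closed_structure[OF Cu]
  assume "\<not> unsplit L U C"
  then obtain X1 X2 where X: "is_closed L U C X1" "is_closed L U C X2" "verts C \<subseteq> X1 \<union> X2"
    "\<And>e. edge L C e \<Longrightarrow> set e \<subseteq> X1 \<or> set e \<subseteq> X2" "\<not> verts C \<subseteq> X1" "\<not> verts C \<subseteq> X2"
    unfolding unsplit_def using C by auto
  have "verts (restr C X1) \<noteq> verts C" "verts (restr C X2) \<noteq> verts C" using X(5,6) by auto
  then have "restr C X1 \<noteq> C" "restr C X2 \<noteq> C" by metis+
  then have "proper_substructure L (restr C X1) C" "proper_substructure L (restr C X2) C"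
    unfolding proper_substructure_def using restr_substructure[OF C X(1)] restr_substructure[OF C X(2)] by simp_all
  then have "\<exists>(A :: ('r, 'f, 'v) lstruct) B1 B2 \<alpha>1 \<alpha>2.
      is_structure L A \<and> proper_substructure L B1 C \<and> U_closed L U B1 \<and>
      proper_substructure L B2 C \<and> U_closed L U B2 \<and>
      embedding L A B1 \<alpha>1 \<and> embedding L A B2 \<alpha>2 \<and> free_amalgamation L A B1 B2 \<alpha>1 \<alpha>2 C id id"
    using split_free_amalgamation[OF C X(1-4)] restr_U_closed[OF Cu X(1)] restr_U_closed[OF Cu X(2)]
    by (intro exI[of _ "restr C (X1 \<inter> X2)"] exI[of _ "restr C X1"] exI[of _ "restr C X2"] exI[of _ id] conjI)
  then show False using assms unfolding U_irreducible_def by argo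
qed

lemma irreducible_in_image:
  assumes f: "embedding L A B f" and A: "U_closed L U A" and B: "U_closed L U B" and u: "unsplit L U A"
  shows "irreducible_in L U B (f ` verts A)"
proof -
  have c: "is_closed L U B (f ` verts A)" by (rule embedding_image_closed[OF f A B])
  then have "closure_in L U B (f ` verts A) = f ` verts A"
    by (intro equalityI closure_in_least[OF c subset_refl] closure_in_superset[OF closed_subset[OF c]])
  then show ?thesis using irreducible_in_closure[OF u subset_refl embedding_hom[OF f] U_closed_structure[OF B]] by simp
qed

end

section \<open>Fibre powers\<close>

text \<open>A \<open>\<U>\<close>-homomorphism-embedding defined on a closed set \<open>D\<close> of vertices of \<open>P\<close> only.\<close>
definition hom_emb_on :: "('r, 'f) lang \<Rightarrow> ('r, 'f) closure_descr \<Rightarrow> ('r, 'f, 'v) lstruct \<Rightarrow> 'v set \<Rightarrow> ('r, 'f, 'w) lstruct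
    \<Rightarrow> ('v \<Rightarrow> 'w) \<Rightarrow> bool" where
  "hom_emb_on L U P D H h \<longleftrightarrow> is_closed L U P D \<and> homomorphism L (restr P D) H h \<and>
     (\<forall>Z. irreducible_in L U P Z \<and> Z \<subseteq> D \<longrightarrow> embedding L (restr P Z) H h)"

lemma hom_emb_on_embedding:
  assumes u: "hom_emb_on L U P D H h" and P: "is_structure L P" and M: "unsplit L U' M" "U' \<subseteq> U"
    and p: "homomorphism L M P p" "p ` verts M \<subseteq> D"
  obtains Z where "irreducible_in L U P Z" "Z \<subseteq> D" "p ` verts M \<subseteq> Z" "embedding L (restr P Z) H h"
proof
  let ?Z = "closure_in L U P (p ` verts M)"
  show i: "irreducible_in L U P ?Z" by (rule irreducible_in_closure[OF M p(1) P])
  have "is_closed L U P D" using u unfolding hom_emb_on_def by simp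
  then show d: "?Z \<subseteq> D" using p(2) by (rule closure_in_least)
  show "p ` verts M \<subseteq> ?Z" by (rule closure_in_superset[OF hom_verts[OF p(1)]])
  show "embedding L (restr P ?Z) H h" using u i d unfolding hom_emb_on_def by simp
qed

text \<open>A structure can be read off from any of its embeddings.\<close>
lemma embedding_unique_source:
  assumes S: "is_structure L S" and S': "is_structure L S'" and A: "is_structure L A"
    and v: "verts S = verts S'" and g: "embedding L S A g" "embedding L S' A g"
  shows "S = (S' :: ('r, 'f, 'v) lstruct)"
proof -
  have inj: "inj_on g (verts S)" using g(1) unfolding embedding_def by simp
  note g1 = g(1)[unfolded embedding_iff[OF S A]] and g2 = g(2)[unfolded embedding_iff[OF S' A]]
  have r: "xs \<in> rel S R \<longleftrightarrow> xs \<in> rel S' R" for xs R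
  proof (cases "R \<in> rels L \<and> set xs \<subseteq> verts S")
    case True then show ?thesis using g1 g2 v by metis
  next
    case False then show ?thesis using structure_rel[OF S, of xs R] structure_rel[OF S', of xs R] v by blast
  qed
  have f: "fn S F xs = fn S' F xs" for xs F
  proof (cases "F \<in> funs L \<and> set xs \<subseteq> verts S")
    case True
    then have e: "map_option g (fn S F xs) = map_option g (fn S' F xs)" using g1 g2 v by metis
    have "x \<in> verts S" if "x \<in> set_option (fn S F xs) \<union> set_option (fn S' F xs)" for x
      using that structure_fn[OF S, of F xs x] structure_fn[OF S', of F xs x] v by (auto)
    then show ?thesis using e inj
      by (cases "fn S F xs"; cases "fn S' F xs") (auto dest: inj_onD)
  next
    case False
    have "fn S F xs = None" using False structure_fn[OF S, of F xs] by (cases "fn S F xs") blast+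
    moreover have "fn S' F xs = None" using False structure_fn[OF S', of F xs] v by (cases "fn S' F xs") blast+
    ultimately show ?thesis by simp
  qed
  have "rel S = rel S'" using r by blast
  moreover have "fn S = fn S'" using f by (intro ext)
  ultimately show ?thesis using v by (intro lstruct.equality) simp_all
qed

text \<open>The \<open>N\<close>-fold power of the substructure on \<open>D\<close>, restricted to the tuples with constant
  \<open>\<rho>\<close>-image. Relations and functions are defined coordinatewise, so that all coordinate
  projections are homomorphisms.\<close>
definition fibre_power :: "nat \<Rightarrow> 'v set \<Rightarrow> ('v \<Rightarrow> 'w) \<Rightarrow> ('r, 'f, 'v) lstruct \<Rightarrow> ('r, 'f, 'v list) lstruct" where
  "fibre_power N D \<rho> P = (let V = {y. length y = N \<and> set y \<subseteq> D \<and> (\<forall>i<N. \<forall>j<N. \<rho> (y ! i) = \<rho> (y ! j))} in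
     \<lparr>verts = V, rel = \<lambda>R. {xs. set xs \<subseteq> V \<and> (\<forall>j<N. map (\<lambda>y. y ! j) xs \<in> rel P R)},
      fn = \<lambda>F xs. if set xs \<subseteq> V \<and> (\<forall>j<N. map (\<lambda>y. y ! j) xs \<in> dom (fn P F))
        then Some (map (\<lambda>j. the (fn P F (map (\<lambda>y. y ! j) xs))) [0..<N]) else None\<rparr>)"

locale fibre_power_setting = closure_setting L U for L :: "('r, 'f) lang" and U +
  fixes P :: "('r, 'f, 'v) lstruct" and D :: "'v set" and A :: "('r, 'f, 'w) lstruct"
    and \<rho> :: "'v \<Rightarrow> 'w" and N :: nat
  assumes Pu: "U_closed L U P" and Pf: "finite (verts P)" and Au: "U_closed L U A"
    and ue: "hom_emb_on L U P D A \<rho>" and N: "N > 0"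
begin

abbreviation "Y \<equiv> fibre_power N D \<rho> P"

lemma Ps: "is_structure L P" and As: "is_structure L A"
  using Pu Au by (simp_all add: U_closed_structure)

lemma Dc: "is_closed L U P D" and hom_rho: "homomorphism L (restr P D) A \<rho>"
  using ue unfolding hom_emb_on_def by simp_all

lemma Y_verts: "y \<in> verts Y \<longleftrightarrow> length y = N \<and> set y \<subseteq> D \<and> (\<forall>i<N. \<forall>j<N. \<rho> (y ! i) = \<rho> (y ! j))"
  unfolding fibre_power_def Let_def by simp

lemma Y_rel: "xs \<in> rel Y R \<longleftrightarrow> set xs \<subseteq> verts Y \<and> (\<forall>j<N. map (\<lambda>y. y ! j) xs \<in> rel P R)"
  unfolding fibre_power_def Let_def by simp

lemma Y_fn: "fn Y F xs = Some y \<longleftrightarrow> set xs \<subseteq> verts Y \<and> length y = N \<and> (\<forall>j<N. fn P F (map (\<lambda>y. y ! j) xs) = Some (y ! j))"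
proof -
  have *: "fn Y F xs = (if set xs \<subseteq> verts Y \<and> (\<forall>j<N. map (\<lambda>y. y ! j) xs \<in> dom (fn P F))
        then Some (map (\<lambda>j. the (fn P F (map (\<lambda>y. y ! j) xs))) [0..<N]) else None)"
    unfolding fibre_power_def Let_def by simp
  show ?thesis
  proof
    assume l: "fn Y F xs = Some y"
    then have c: "set xs \<subseteq> verts Y" "\<And>j. j < N \<Longrightarrow> map (\<lambda>y. y ! j) xs \<in> dom (fn P F)"
      "y = map (\<lambda>j. the (fn P F (map (\<lambda>y. y ! j) xs))) [0..<N]"
      unfolding * by (auto split: if_splits)
    then show "set xs \<subseteq> verts Y \<and> length y = N \<and> (\<forall>j<N. fn P F (map (\<lambda>y. y ! j) xs) = Some (y ! j))"
      by fastforce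
  next
    assume r: "set xs \<subseteq> verts Y \<and> length y = N \<and> (\<forall>j<N. fn P F (map (\<lambda>y. y ! j) xs) = Some (y ! j))"
    then have "map (\<lambda>j. the (fn P F (map (\<lambda>y. y ! j) xs))) [0..<N] = y"
      by (intro nth_equalityI) auto
    then show "fn Y F xs = Some y" using r unfolding * by (auto simp: dom_def)
  qed
qed

lemma Y_nth: "y \<in> verts Y \<Longrightarrow> j < N \<Longrightarrow> y ! j \<in> D"
  unfolding Y_verts by (metis nth_mem subsetD)

lemma Y_nth_list: "set xs \<subseteq> verts Y \<Longrightarrow> j < N \<Longrightarrow> set (map (\<lambda>y. y ! j) xs) \<subseteq> D"
  using Y_nth by auto

lemma rho_nth: "y \<in> verts Y \<Longrightarrow> i < N \<Longrightarrow> j < N \<Longrightarrow> \<rho> (y ! i) = \<rho> (y ! j)"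
  unfolding Y_verts by blast

lemma rho_nth_list:
  assumes "set xs \<subseteq> verts Y" "i < N" "j < N"
  shows "map \<rho> (map (\<lambda>y. y ! i) xs) = map \<rho> (map (\<lambda>y. y ! j) xs)"
proof -
  have "\<rho> (y ! i) = \<rho> (y ! j)" if "y \<in> set xs" for y using rho_nth assms that by blast
  then show ?thesis by simp
qed

lemma Y_finite: "finite (verts Y)"
proof (rule finite_subset)
  show "verts Y \<subseteq> {xs. set xs \<subseteq> verts P \<and> length xs = N}"
    using closed_subset[OF Dc] unfolding subset_iff Y_verts by blast
  show "finite {xs. set xs \<subseteq> verts P \<and> length xs = N}" using Pf by (rule finite_lists_length_eq)
qed

lemma Y_structure: "is_structure L Y"
  unfolding is_structure_def
proof (intro conjI ballI allI impI subsetI)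
  show "countable (verts Y)" using Y_finite by (rule countable_finite)
next
  fix R xs assume "R \<in> rels L" "xs \<in> rel Y R"
  then have "set xs \<subseteq> verts Y" "map (\<lambda>y. y ! 0) xs \<in> rel P R" unfolding Y_rel using N by auto
  then show "xs \<in> tuples (verts Y) (rel_arity L R)" using structure_rel[OF Ps, of "map (\<lambda>y. y ! 0) xs"] by (simp add: tuples_def)
next
  fix F xs assume "F \<in> funs L" "xs \<in> dom (fn Y F)"
  then obtain y where "fn Y F xs = Some y" by blast
  then have "set xs \<subseteq> verts Y" "fn P F (map (\<lambda>y. y ! 0) xs) = Some (y ! 0)" unfolding Y_fn using N by auto
  then show "xs \<in> tuples (verts Y) (fun_arity L F)" using structure_fn[OF Ps, of F "map (\<lambda>y. y ! 0) xs"] by (simp add: tuples_def)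
next
  fix F y assume F: "F \<in> funs L" and "y \<in> ran (fn Y F)"
  then obtain xs where "fn Y F xs = Some y" unfolding ran_def by blast
  then have xs: "set xs \<subseteq> verts Y" "length y = N" "\<And>j. j < N \<Longrightarrow> fn P F (map (\<lambda>y. y ! j) xs) = Some (y ! j)"
    unfolding Y_fn by auto
  have D: "y ! j \<in> D" if "j < N" for j
    using closedD[OF Dc rule_fnI[OF F xs(3)[OF that]] Y_nth_list[OF xs(1) that]] .
  have r: "fn A F (map \<rho> (map (\<lambda>y. y ! j) xs)) = Some (\<rho> (y ! j))" if "j < N" for j
  proof (rule hom_fn[OF hom_rho F])
    show "fn (restr P D) F (map (\<lambda>y. y ! j) xs) = Some (y ! j)"
      using xs(3)[OF that] Y_nth_list[OF xs(1) that] by simp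
  qed
  have "\<rho> (y ! i) = \<rho> (y ! j)" if "i < N" "j < N" for i j
    using r[OF that(1)] r[OF that(2)] rho_nth_list[OF xs(1) that] by (metis option.inject)
  moreover have "set y \<subseteq> D" using D xs(2) by (auto simp: in_set_conv_nth)
  ultimately show "y \<in> verts Y" unfolding Y_verts using xs(2) by blast
next
  fix R assume "R \<notin> rels L"
  then have "rel P R = {}" using Ps unfolding is_structure_def by blast
  then show "rel Y R = {}" unfolding set_eq_iff Y_rel using N by auto
next
  fix F assume "F \<notin> funs L"
  then have e: "fn P F = Map.empty" using Ps unfolding is_structure_def by blast
  have "fn Y F xs = None" for xs
  proof (cases "fn Y F xs")
    case (Some y)
    then have "fn P F (map (\<lambda>y. y ! 0) xs) = Some (y ! 0)" unfolding Y_fn using N by blast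
    then show ?thesis using e by simp
  qed simp
  then show "fn Y F = Map.empty" by (intro ext)
qed

lemma proj_hom:
  assumes "j < N"
  shows "homomorphism L Y (restr P D) (\<lambda>y. y ! j)"
  unfolding homomorphism_iff
proof (intro conjI ballI allI impI)
  show "(\<lambda>y. y ! j) ` verts Y \<subseteq> verts (restr P D)" using Y_nth assms by auto
next
  fix R xs assume "xs \<in> rel Y R"
  then show "map (\<lambda>y. y ! j) xs \<in> rel (restr P D) R"
    unfolding Y_rel restr_simps using Y_nth_list[OF _ assms] assms by blast
next
  fix F xs y assume "fn Y F xs = Some y"
  then have "set xs \<subseteq> verts Y" "fn P F (map (\<lambda>y. y ! j) xs) = Some (y ! j)" unfolding Y_fn using assms by auto
  then show "fn (restr P D) F (map (\<lambda>y. y ! j) xs) = Some (y ! j)" using Y_nth_list[OF _ assms] by simp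
qed

text \<open>On the closure of an irreducible image, \<open>\<rho>\<close> is an embedding, so that each coordinate
  of a substructure \<open>M\<close> of the power is determined by the common \<open>\<rho>\<close>-image. All coordinates
  then agree on which tuples are related, and a single coordinate already gives an
  embedding.\<close>
lemma fibre_power_embeddings:
  assumes M: "unsplit L U' M" "U' \<subseteq> U" and h: "embedding L M Y h"
  shows proj_embedding: "j < N \<Longrightarrow> embedding L M P (\<lambda>x. h x ! j)"
    and rho_embedding: "embedding L M A (\<lambda>x. \<rho> (h x ! 0))"
proof -
  have Ms: "is_structure L M" using M unfolding unsplit_def by simp
  note Ys = Y_structure
  have hh: "homomorphism L M (restr P D) (\<lambda>x. h x ! i)" if "i < N" for i
    using homomorphism_comp[OF embedding_hom[OF h] proj_hom[OF that]] by (simp add: comp_def)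
  have hP: "homomorphism L M P (\<lambda>x. h x ! i)" if "i < N" for i
    using homomorphism_comp[OF hh[OF that] embedding_hom[OF restr_embedding[OF Ps Dc]]] by (simp add: comp_def)
  have "\<exists>Z. irreducible_in L U P Z \<and> (\<lambda>x. h x ! i) ` verts M \<subseteq> Z \<and> embedding L (restr P Z) A \<rho>" if "i < N" for i
    using hom_emb_on_embedding[OF ue Ps M hP[OF that]] hom_verts[OF hh[OF that]] by (metis restr_simps(1))
  then obtain Z where Z: "\<And>i. i < N \<Longrightarrow> irreducible_in L U P (Z i)" "\<And>i. i < N \<Longrightarrow> (\<lambda>x. h x ! i) ` verts M \<subseteq> Z i"
    "\<And>i. i < N \<Longrightarrow> embedding L (restr P (Z i)) A \<rho>" by metis
  have Zc: "is_closed L U P (Z i)" if "i < N" for i using Z(1)[OF that] unfolding irreducible_in_def by simp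
  note Zs = restr_structure[OF Ps Zc]
  have Zm: "set (map (\<lambda>x. h x ! i) xs) \<subseteq> Z i" if "set xs \<subseteq> verts M" "i < N" for i xs
    using Z(2)[OF that(2)] that(1) by auto
  have hY: "set (map h xs) \<subseteq> verts Y" if "set xs \<subseteq> verts M" for xs
    using hom_verts[OF embedding_hom[OF h]] that by auto
  have same: "map \<rho> (map (\<lambda>x. h x ! i) xs) = map \<rho> (map (\<lambda>x. h x ! 0) xs)" if "set xs \<subseteq> verts M" "i < N" for i xs
    using rho_nth_list[OF hY[OF that(1)] that(2) N] by (simp add: comp_def)
  \<comment> \<open>The right-hand side does not depend on the coordinate \<open>i\<close>.\<close>
  have rl: "map (\<lambda>x. h x ! i) xs \<in> rel P R \<longleftrightarrow> map \<rho> (map (\<lambda>x. h x ! 0) xs) \<in> rel A R"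
    if "i < N" "set xs \<subseteq> verts M" "R \<in> rels L" for i xs R
  proof -
    have "map \<rho> (map (\<lambda>x. h x ! 0) xs) \<in> rel A R \<longleftrightarrow> map (\<lambda>x. h x ! i) xs \<in> rel (restr P (Z i)) R"
      unfolding same[OF that(2,1), symmetric]
      using Z(3)[OF that(1)] that(3) Zm[OF that(2,1)] unfolding embedding_iff[OF Zs[OF that(1)] As] restr_simps(1) by blast
    then show ?thesis using Zm[OF that(2,1)] by simp
  qed
  have fl: "fn A F (map \<rho> (map (\<lambda>x. h x ! 0) xs)) = map_option \<rho> (fn P F (map (\<lambda>x. h x ! i) xs))"
    if "i < N" "set xs \<subseteq> verts M" "F \<in> funs L" for i xs F
  proof -
    have "fn A F (map \<rho> (map (\<lambda>x. h x ! 0) xs)) = map_option \<rho> (fn (restr P (Z i)) F (map (\<lambda>x. h x ! i) xs))"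
      unfolding same[OF that(2,1), symmetric]
      using Z(3)[OF that(1)] that(3) Zm[OF that(2,1)] unfolding embedding_iff[OF Zs[OF that(1)] As] restr_simps(1) by blast
    then show ?thesis using Zm[OF that(2,1)] by simp
  qed
  have emb: "embedding L M P (\<lambda>x. h x ! j)" if j: "j < N" for j
    unfolding embedding_iff[OF Ms Ps]
  proof (intro conjI ballI allI impI)
    show "(\<lambda>x. h x ! j) ` verts M \<subseteq> verts P" using hom_verts[OF hP[OF j]] .
    show "inj_on (\<lambda>x. h x ! j) (verts M)"
    proof (rule inj_onI)
      fix x y assume xy: "x \<in> verts M" "y \<in> verts M" "h x ! j = h y ! j"
      have hv: "h x \<in> verts Y" "h y \<in> verts Y" using hY[of "[x]"] hY[of "[y]"] xy by auto
      have hi: "h x ! i = h y ! i" if i: "i < N" for i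
      proof -
        have "\<rho> (h x ! i) = \<rho> (h y ! i)"
          using rho_nth[OF hv(1) i j] rho_nth[OF hv(2) i j] xy(3) by simp
        moreover have "inj_on \<rho> (Z i)" using Z(3)[OF i] unfolding embedding_def by simp
        moreover have "h x ! i \<in> Z i" "h y ! i \<in> Z i" using Z(2)[OF i] xy by auto
        ultimately show ?thesis by (meson inj_onD)
      qed
      have l: "length (h x) = N" "length (h y) = N" using hv unfolding Y_verts by blast+
      have "h x = h y" by (rule nth_equalityI) (use l hi in simp_all)
      moreover have "inj_on h (verts M)" using h unfolding embedding_def by simp
      ultimately show "x = y" using xy by (meson inj_onD)
    qed
  next
    fix R xs assume *: "R \<in> rels L" "set xs \<subseteq> verts M"
    have "xs \<in> rel M R \<longleftrightarrow> map h xs \<in> rel Y R" using h * unfolding embedding_iff[OF Ms Ys] by blast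
    also have "\<dots> \<longleftrightarrow> (\<forall>i<N. map (\<lambda>x. h x ! i) xs \<in> rel P R)"
      unfolding Y_rel using hY[OF *(2)] by (simp add: comp_def)
    also have "\<dots> \<longleftrightarrow> map (\<lambda>x. h x ! j) xs \<in> rel P R"
      using rl[OF _ *(2,1)] j by blast
    finally show "map (\<lambda>x. h x ! j) xs \<in> rel P R \<longleftrightarrow> xs \<in> rel M R" by simp
  next
    fix F xs assume *: "F \<in> funs L" "set xs \<subseteq> verts M"
    show "fn P F (map (\<lambda>x. h x ! j) xs) = map_option (\<lambda>x. h x ! j) (fn M F xs)"
    proof (cases "fn M F xs")
      case (Some y)
      then show ?thesis using hom_fn[OF hP[OF j] *(1) Some] by simp
    next
      case None
      have "fn Y F (map h xs) = None" using h * None unfolding embedding_iff[OF Ms Ys] by simp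
      \<comment> \<open>If the function were defined in all coordinates, it would be defined in the power.\<close>
      have "\<exists>i<N. fn P F (map (\<lambda>x. h x ! i) xs) = None"
      proof (rule ccontr)
        assume "\<not> ?thesis"
        then have "\<forall>i<N. \<exists>z. fn P F (map (\<lambda>x. h x ! i) xs) = Some z" by auto
        then obtain z where "\<And>i. i < N \<Longrightarrow> fn P F (map (\<lambda>x. h x ! i) xs) = Some (z i)" by metis
        then have "fn Y F (map h xs) = Some (map z [0..<N])"
          unfolding Y_fn using hY[OF *(2)] by (simp add: comp_def)
        then show False using \<open>fn Y F (map h xs) = None\<close> by simp
      qed
      then have "fn P F (map (\<lambda>x. h x ! j) xs) = None" using fl[OF _ *(2,1)] j by (metis option.map_disc_iff)
      then show ?thesis using None by simp
    qed
  qed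
  then show "j < N \<Longrightarrow> embedding L M P (\<lambda>x. h x ! j)" .
  have "embedding L M (restr P (Z 0)) (\<lambda>x. h x ! 0)"
    by (rule embedding_into_restr[OF emb[OF N] Ms Ps Zc[OF N] Z(2)[OF N]])
  from embedding_comp[OF this Z(3)[OF N] Ms Zs[OF N] As]
  show "embedding L M A (\<lambda>x. \<rho> (h x ! 0))" by (simp add: comp_def)
qed

lemma nth_lists_eq:
  assumes "set xs \<subseteq> verts Y" "set ys \<subseteq> verts Y" "\<And>j. j < N \<Longrightarrow> map (\<lambda>y. y ! j) xs = map (\<lambda>y. y ! j) ys"
  shows "xs = ys"
proof (rule nth_equalityI)
  show l: "length xs = length ys" using assms(3)[OF N] by (metis length_map)
  fix k assume k: "k < length xs"
  show "xs ! k = ys ! k"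
  proof (rule nth_equalityI)
    have v: "xs ! k \<in> verts Y" "ys ! k \<in> verts Y" using assms(1,2) k l by (metis nth_mem subsetD)+
    then show "length (xs ! k) = length (ys ! k)" unfolding Y_verts by simp
    fix j assume "j < length (xs ! k)"
    then have "j < N" using v unfolding Y_verts by simp
    from assms(3)[OF this] show "xs ! k ! j = ys ! k ! j" using k l by (metis nth_map)
  qed
qed

text \<open>A rooted tuple is rooted in each coordinate and has an extension there. These
  extensions have the same \<open>\<rho>\<close>-image because \<open>A\<close> is \<open>\<U>\<close>-closed, and thus together form an
  extension in the power. Conversely, an extended tuple is rooted in each coordinate; the
  roots found there coincide because they all embed into \<open>A\<close> by the same map.\<close>
lemma Y_U_closed: "U_closed L U Y"
proof (rule U_closedI[OF Y_structure])
  fix R S t assume RS: "(R, S) \<in> U" "length t = card (verts S)" and tY: "set t \<subseteq> verts Y" and "rooted L U Y R t"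
  then obtain S' where S': "(R, S') \<in> U" "card (verts S') = length t" "represents_embedding L S' Y t"
    unfolding rooted_def by blast
  have rt: "rooted L U P R (map (\<lambda>y. y ! j) t)" if j: "j < N" for j
  proof -
    have "embedding L S' P (\<lambda>i. t ! (i - 1) ! j)"
      using proj_embedding[OF root(5)[OF S'(1)] empty_subsetI S'(3)[unfolded represents_embedding_def] j] .
    then have "embedding L S' P (\<lambda>i. map (\<lambda>y. y ! j) t ! (i - 1))"
    proof (rule embedding_cong[OF _ _ root(2)[OF S'(1)] Ps])
      fix i assume "i \<in> verts S'"
      then have "i \<in> {1..length t}" using root(3)[OF S'(1)] S'(2) by simp
      then have "i - 1 < length t" by auto
      then show "t ! (i - 1) ! j = map (\<lambda>y. y ! j) t ! (i - 1)" by simp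
    qed
    then show ?thesis unfolding rooted_def represents_embedding_def using S' by auto
  qed
  have "\<exists>ys. map (\<lambda>y. y ! j) t @ ys \<in> rel P R" if j: "j < N" for j
  proof -
    have "set (map (\<lambda>y. y ! j) t) \<subseteq> verts P" using Y_nth_list[OF tY j] closed_subset[OF Dc] by blast
    then show ?thesis using U_closed_ex1[OF Pu RS(1) _ _ rt[OF j]] RS(2) by auto
  qed
  then obtain s where s: "\<And>j. j < N \<Longrightarrow> map (\<lambda>y. y ! j) t @ s j \<in> rel P R" by metis
  let ?m = "rel_arity L R - length t"
  have len: "length (s j) = ?m" if "j < N" for j using structure_rel[OF Ps s[OF that]] by auto
  have sD: "set (s j) \<subseteq> D" if j: "j < N" for j
  proof
    fix y assume y: "y \<in> set (s j)"
    have "rule L U P (map (\<lambda>y. y ! j) t) y" by (rule rule_relI[OF RS(1) root(1)[OF RS(1)] s[OF j] _ y]) (simp add: RS(2))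
    then show "y \<in> D" by (rule closedD[OF Dc _ Y_nth_list[OF tY j]])
  qed
  have sA: "map \<rho> (map (\<lambda>y. y ! j) t) @ map \<rho> (s j) \<in> rel A R" if j: "j < N" for j
  proof -
    have "map (\<lambda>y. y ! j) t @ s j \<in> rel (restr P D) R" using s[OF j] Y_nth_list[OF tY j] sD[OF j] by simp
    from hom_rel[OF hom_rho root(1)[OF RS(1)] this] show ?thesis by simp
  qed
  \<comment> \<open>Both extend the common image of \<open>t\<close> in \<open>A\<close>.\<close>
  have sr: "map \<rho> (s i) = map \<rho> (s j)" if "i < N" "j < N" for i j
  proof (rule U_closed_unique[OF Au RS(1) _ sA[OF that(1)]])
    show "length (map \<rho> (map (\<lambda>y. y ! i) t)) = card (verts S)" using RS(2) by simp
    show "map \<rho> (map (\<lambda>y. y ! i) t) @ map \<rho> (s j) \<in> rel A R"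
      using sA[OF that(2)] rho_nth_list[OF tY that] by metis
  qed
  define zs where "zs = map (\<lambda>k. map (\<lambda>j. s j ! k) [0..<N]) [0..<?m]"
  have zj: "map (\<lambda>y. y ! j) zs = s j" if "j < N" for j
    unfolding zs_def using len[OF that] that by (intro nth_equalityI) auto
  have "set zs \<subseteq> verts Y"
  proof
    fix z assume "z \<in> set zs"
    then obtain k where k: "k < ?m" "z = map (\<lambda>j. s j ! k) [0..<N]" unfolding zs_def by auto
    have zD: "s j ! k \<in> D" if "j < N" for j using sD[OF that] len[OF that] k(1) by (metis nth_mem subsetD)
    have zr: "\<rho> (s i ! k) = \<rho> (s j ! k)" if "i < N" "j < N" for i j
      using sr[OF that] len[OF that(1)] len[OF that(2)] k(1) by (metis nth_map)
    have zn: "z ! i = s i ! k" if "i < N" for i unfolding k(2) using that by simp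
    show "z \<in> verts Y" unfolding Y_verts
    proof (intro conjI allI impI)
      show "length z = N" unfolding k(2) by simp
      show "set z \<subseteq> D" unfolding k(2) using zD by auto
      show "\<rho> (z ! i) = \<rho> (z ! j)" if "i < N" "j < N" for i j
        unfolding zn[OF that(1)] zn[OF that(2)] by (rule zr[OF that])
    qed
  qed
  then have "t @ zs \<in> rel Y R" unfolding Y_rel using tY zj s by simp
  then show "\<exists>ys. t @ ys \<in> rel Y R" ..
next
  fix R S t ys zs assume RS: "(R, S) \<in> U" "length t = card (verts S)" and r: "t @ ys \<in> rel Y R" "t @ zs \<in> rel Y R"
  show "ys = zs"
  proof (rule nth_lists_eq)
    show "set ys \<subseteq> verts Y" "set zs \<subseteq> verts Y" using r unfolding Y_rel by auto
    fix j assume "j < N"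
    then have "map (\<lambda>y. y ! j) t @ map (\<lambda>y. y ! j) ys \<in> rel P R" "map (\<lambda>y. y ! j) t @ map (\<lambda>y. y ! j) zs \<in> rel P R"
      using r unfolding Y_rel by auto
    then show "map (\<lambda>y. y ! j) ys = map (\<lambda>y. y ! j) zs"
      by (intro U_closed_unique[OF Pu RS(1), of "map (\<lambda>y. y ! j) t"]) (simp_all add: RS(2))
  qed
next
  fix R S t ys assume RS: "(R, S) \<in> U" "length t = card (verts S)" and r: "t @ ys \<in> rel Y R"
  have tY: "set t \<subseteq> verts Y" using r unfolding Y_rel by simp
  have "\<exists>S'. (R, S') \<in> U \<and> card (verts S') = length t \<and> embedding L S' P (\<lambda>i. map (\<lambda>y. y ! j) t ! (i - 1))" if "j < N" for j
  proof -
    have "map (\<lambda>y. y ! j) t @ map (\<lambda>y. y ! j) ys \<in> rel P R" using r that unfolding Y_rel by simp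
    then have "rooted L U P R (map (\<lambda>y. y ! j) t)" by (intro U_closed_rooted[OF Pu RS(1)]) (simp_all add: RS(2))
    then show ?thesis unfolding rooted_def represents_embedding_def by simp
  qed
  then obtain T where T: "\<And>j. j < N \<Longrightarrow> (R, T j) \<in> U" "\<And>j. j < N \<Longrightarrow> card (verts (T j)) = length t"
    "\<And>j. j < N \<Longrightarrow> embedding L (T j) P (\<lambda>i. map (\<lambda>y. y ! j) t ! (i - 1))" by metis
  have Tv: "verts (T j) = {1..length t}" if "j < N" for j using root(3)[OF T(1)[OF that]] T(2)[OF that] by simp
  have idx: "i - 1 < length t" if "i \<in> {1..length t}" for i using that by auto
  have Tp: "embedding L (T j) P (\<lambda>i. t ! (i - 1) ! j)" if "j < N" for j
    by (rule embedding_cong[OF T(3)[OF that] _ root(2)[OF T(1)[OF that]] Ps]) (use idx Tv[OF that] in simp)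
  have im: "(\<lambda>i. t ! (i - 1)) ` verts (T j) \<subseteq> verts Y" if "j < N" for j
    unfolding root_image[OF T(1)[OF that] T(2)[OF that]] by (rule tY)
  have TA: "embedding L (T j) A (\<lambda>i. \<rho> (t ! (i - 1) ! 0))" if "j < N" for j
  proof -
    note j = that
    have imD: "(\<lambda>i. t ! (i - 1) ! j) ` verts (T j) \<subseteq> D" using im[OF that] Y_nth[OF _ that] by blast
    obtain Z where Z: "irreducible_in L U P Z" "Z \<subseteq> D" "(\<lambda>i. t ! (i - 1) ! j) ` verts (T j) \<subseteq> Z" "embedding L (restr P Z) A \<rho>"
      by (rule hom_emb_on_embedding[OF ue Ps root(5)[OF T(1)[OF j]] empty_subsetI embedding_hom[OF Tp[OF j]] imD])
    have Zc: "is_closed L U P Z" using Z(1) unfolding irreducible_in_def by simp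
    have "embedding L (T j) (restr P Z) (\<lambda>i. t ! (i - 1) ! j)"
      by (rule embedding_into_restr[OF Tp[OF that] root(2)[OF T(1)[OF that]] Ps Zc Z(3)])
    from embedding_comp[OF this Z(4) root(2)[OF T(1)[OF that]] restr_structure[OF Ps Zc] As]
    have "embedding L (T j) A (\<lambda>i. \<rho> (t ! (i - 1) ! j))" by (simp add: comp_def)
    then show ?thesis
      by (rule embedding_cong[OF _ _ root(2)[OF T(1)[OF that]] As])
        (rule rho_nth[OF subsetD[OF im[OF that] imageI] that N])
  qed
  \<comment> \<open>A priori, different coordinates could have different roots of the same size.\<close>
  have Teq: "T j = T 0" if "j < N" for j
    by (rule embedding_unique_source[OF root(2)[OF T(1)[OF that]] root(2)[OF T(1)[OF N]] As _ TA[OF that] TA[OF N]])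
      (simp add: Tv that N)
  note T0 = root(2)[OF T(1)[OF N]]
  have P0: "embedding L (T 0) P (\<lambda>i. t ! (i - 1) ! j)" if "j < N" for j using Tp[OF that] Teq[OF that] by simp
  have mapY: "set (map (\<lambda>i. t ! (i - 1)) xs) \<subseteq> verts Y" if "set xs \<subseteq> verts (T 0)" for xs using im[OF N] that by auto
  have "embedding L (T 0) Y (\<lambda>i. t ! (i - 1))"
    unfolding embedding_iff[OF T0 Y_structure]
  proof (intro conjI ballI allI impI)
    show "(\<lambda>i. t ! (i - 1)) ` verts (T 0) \<subseteq> verts Y" by (rule im[OF N])
    have "inj_on (\<lambda>i. t ! (i - 1) ! 0) (verts (T 0))" using P0[OF N] unfolding embedding_def by simp
    then show "inj_on (\<lambda>i. t ! (i - 1)) (verts (T 0))" unfolding inj_on_def by metis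
  next
    fix R xs assume *: "R \<in> rels L" "set xs \<subseteq> verts (T 0)"
    have "map (\<lambda>i. t ! (i - 1) ! j) xs \<in> rel P R \<longleftrightarrow> xs \<in> rel (T 0) R" if "j < N" for j
      using P0[OF that] * unfolding embedding_iff[OF T0 Ps] by blast
    then show "map (\<lambda>i. t ! (i - 1)) xs \<in> rel Y R \<longleftrightarrow> xs \<in> rel (T 0) R"
      unfolding Y_rel using mapY[OF *(2)] N by (auto simp: comp_def)
  next
    fix F xs assume *: "F \<in> funs L" "set xs \<subseteq> verts (T 0)"
    have e: "fn P F (map (\<lambda>i. t ! (i - 1) ! j) xs) = map_option (\<lambda>i. t ! (i - 1) ! j) (fn (T 0) F xs)" if "j < N" for j
      using P0[OF that] * unfolding embedding_iff[OF T0 Ps] by blast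
    show "fn Y F (map (\<lambda>i. t ! (i - 1)) xs) = map_option (\<lambda>i. t ! (i - 1)) (fn (T 0) F xs)"
    proof (cases "fn (T 0) F xs")
      case (Some y)
      have "y \<in> verts (T 0)" using structure_fn[OF T0 Some] by simp
      then have "t ! (y - 1) \<in> verts Y" using im[OF N] by blast
      then have "length (t ! (y - 1)) = N" unfolding Y_verts by simp
      then have "fn Y F (map (\<lambda>i. t ! (i - 1)) xs) = Some (t ! (y - 1))"
        unfolding Y_fn using e Some mapY[OF *(2)] by (auto simp: comp_def)
      then show ?thesis using Some by simp
    next
      case None
      have "fn Y F (map (\<lambda>i. t ! (i - 1)) xs) = None"
      proof (rule ccontr)
        assume "fn Y F (map (\<lambda>i. t ! (i - 1)) xs) \<noteq> None"
        then obtain y where "fn Y F (map (\<lambda>i. t ! (i - 1)) xs) = Some y" by blast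
        then have "fn P F (map (\<lambda>i. t ! (i - 1) ! 0) xs) = Some (y ! 0)" unfolding Y_fn using N by (auto simp: comp_def)
        then show False using e[OF N] None by simp
      qed
      then show ?thesis using None by simp
    qed
  qed
  then show "rooted L U Y R t" unfolding rooted_def represents_embedding_def using T(1,2)[OF N] by blast
qed

text \<open>A combinatorial line over the alphabet of sections of \<open>\<rho>\<close>: the coordinates marked
  \<open>None\<close> carry the moving vertex \<open>x\<close>, the others the vertex that the given section puts over
  \<open>\<rho> x\<close>.\<close>
definition line :: "('w \<Rightarrow> 'v) option list \<Rightarrow> 'v \<Rightarrow> 'v list" where
  "line l x = map (\<lambda>s. case s of None \<Rightarrow> x | Some e \<Rightarrow> e (\<rho> x)) l"

text \<open>Fixed coordinates are homomorphisms, being compositions of \<open>\<rho>\<close> with a section, and a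
  moving coordinate recovers the vertex. Hence the line is an embedding although \<open>\<rho>\<close> is not.\<close>
lemma line_embedding:
  assumes l: "length l = N" "None \<in> set l"
    and e: "\<And>e. Some e \<in> set l \<Longrightarrow> embedding L A P e"
      "\<And>e a. Some e \<in> set l \<Longrightarrow> a \<in> verts A \<Longrightarrow> e a \<in> D \<and> \<rho> (e a) = a"
  shows "embedding L (restr P D) Y (line l)"
proof -
  note Rs = restr_structure[OF Ps Dc]
  obtain k where k: "k < N" "l ! k = None" using l by (auto simp: in_set_conv_nth)
  have nth: "line l x ! j = (case l ! j of None \<Rightarrow> x | Some e \<Rightarrow> e (\<rho> x))" if "j < N" for j x
    unfolding line_def using that l by simp
  have nk: "line l x ! k = x" for x using nth[OF k(1)] k(2) by simp
  have rA: "\<rho> x \<in> verts A" if "x \<in> D" for x using hom_verts[OF hom_rho] that by auto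
  have h: "homomorphism L (restr P D) P (\<lambda>x. line l x ! j)" if j: "j < N" for j
  proof (cases "l ! j")
    case None
    then show ?thesis using nth[OF j] embedding_hom[OF restr_embedding[OF Ps Dc]] by (simp add: id_def)
  next
    case (Some e0)
    then have "Some e0 \<in> set l" using j l by (metis nth_mem)
    then have "homomorphism L (restr P D) P (e0 \<circ> \<rho>)"
      using homomorphism_comp[OF hom_rho embedding_hom[OF e(1)]] by simp
    then show ?thesis using nth[OF j] Some by (simp add: comp_def)
  qed
  have inD: "line l x ! j \<in> D \<and> \<rho> (line l x ! j) = \<rho> x" if "j < N" "x \<in> D" for j x
  proof (cases "l ! j")
    case None then show ?thesis using nth[OF that(1)] that by simp
  next
    case (Some e0)
    then have "Some e0 \<in> set l" using that l by (metis nth_mem)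
    then show ?thesis using nth[OF that(1)] Some e(2) rA[OF that(2)] by simp
  qed
  have len: "length (line l x) = N" for x unfolding line_def using l by simp
  have v: "line l x \<in> verts Y" if "x \<in> D" for x
    unfolding Y_verts using inD[OF _ that] len by (auto simp: in_set_conv_nth)
  have vs: "set (map (line l) xs) \<subseteq> verts Y" if "set xs \<subseteq> D" for xs using v that by auto
  show ?thesis unfolding embedding_iff[OF Rs Y_structure]
  proof (intro conjI ballI allI impI)
    show "line l ` verts (restr P D) \<subseteq> verts Y" using v by auto
    show "inj_on (line l) (verts (restr P D))" using nk by (metis inj_onI)
  next
    fix R xs assume *: "R \<in> rels L" "set xs \<subseteq> verts (restr P D)"
    then have xD: "set xs \<subseteq> D" by simp
    show "map (line l) xs \<in> rel Y R \<longleftrightarrow> xs \<in> rel (restr P D) R"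
    proof
      assume "map (line l) xs \<in> rel Y R"
      then have "map (\<lambda>x. line l x ! k) xs \<in> rel P R" unfolding Y_rel using k(1) by (auto simp: comp_def)
      then show "xs \<in> rel (restr P D) R" using nk xD by simp
    next
      assume "xs \<in> rel (restr P D) R"
      then have "map (\<lambda>x. line l x ! j) xs \<in> rel P R" if "j < N" for j using hom_rel[OF h[OF that] *(1)] by blast
      then show "map (line l) xs \<in> rel Y R" unfolding Y_rel using vs[OF xD] by (simp add: comp_def)
    qed
  next
    fix F xs assume *: "F \<in> funs L" "set xs \<subseteq> verts (restr P D)"
    then have xD: "set xs \<subseteq> D" by simp
    show "fn Y F (map (line l) xs) = map_option (line l) (fn (restr P D) F xs)"
    proof (cases "fn (restr P D) F xs")
      case (Some y)
      then have "fn P F (map (\<lambda>x. line l x ! j) xs) = Some (line l y ! j)" if "j < N" for j using hom_fn[OF h[OF that] *(1)] by blast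
      then have "fn Y F (map (line l) xs) = Some (line l y)" unfolding Y_fn using vs[OF xD] len by (simp add: comp_def)
      then show ?thesis using Some by simp
    next
      case None
      have "fn Y F (map (line l) xs) = None"
      proof (rule ccontr)
        assume "fn Y F (map (line l) xs) \<noteq> None"
        then obtain y where "fn Y F (map (line l) xs) = Some y" by blast
        then have "fn P F (map (\<lambda>x. line l x ! k) xs) = Some (y ! k)" unfolding Y_fn using k(1) by (auto simp: comp_def)
        then show False using nk None xD by simp
      qed
      then show ?thesis using None by simp
    qed
  qed
qed

end

section \<open>Gluing copies along a closed set\<close>

text \<open>The graph of a function in the amalgam, first as a relation.\<close>
definition glue_fn ::
  "('r, 'f, 'y) lstruct \<Rightarrow> ('r, 'f, 'p) lstruct \<Rightarrow> 'i set \<Rightarrow> ('y \<Rightarrow> 'q) \<Rightarrow> ('i \<Rightarrow> 'p \<Rightarrow> 'q) \<Rightarrow> 'f \<Rightarrow> 'q list \<Rightarrow> 'q \<Rightarrow> bool" where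
  "glue_fn Y P I a J F zs v \<longleftrightarrow> (\<exists>xs u. fn Y F xs = Some u \<and> zs = map a xs \<and> v = a u) \<or>
     (\<exists>i\<in>I. \<exists>xs u. fn P F xs = Some u \<and> zs = map (J i) xs \<and> v = J i u)"

text \<open>The free amalgam of \<open>Y\<close> with copies \<open>J i\<close> of \<open>P\<close>, the maps \<open>a\<close> and \<open>J i\<close> being the
  inclusions. They are parameters, which leaves open the type of the vertices.\<close>
definition glue ::
  "('r, 'f, 'y) lstruct \<Rightarrow> ('r, 'f, 'p) lstruct \<Rightarrow> 'i set \<Rightarrow> ('y \<Rightarrow> 'q) \<Rightarrow> ('i \<Rightarrow> 'p \<Rightarrow> 'q) \<Rightarrow> ('r, 'f, 'q) lstruct" where
  "glue Y P I a J = \<lparr>verts = a ` verts Y \<union> (\<Union>i\<in>I. J i ` verts P),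
     rel = \<lambda>R. map a ` rel Y R \<union> (\<Union>i\<in>I. map (J i) ` rel P R),
     fn = \<lambda>F zs. if \<exists>v. glue_fn Y P I a J F zs v then Some (THE v. glue_fn Y P I a J F zs v) else None\<rparr>"

text \<open>The copy of \<open>D\<close> in the \<open>i\<close>-th copy of \<open>P\<close> is identified with its image under \<open>lam i\<close>,
  and there are no other identifications.\<close>
locale glue_setting = closure_setting L U for L :: "('r, 'f) lang" and U +
  fixes Y :: "('r, 'f, 'y) lstruct" and P :: "('r, 'f, 'p) lstruct" and D :: "'p set" and I :: "'i set"
    and lam :: "'i \<Rightarrow> 'p \<Rightarrow> 'y" and a :: "'y \<Rightarrow> 'q" and J :: "'i \<Rightarrow> 'p \<Rightarrow> 'q"
  assumes Yu: "U_closed L U Y" and Pu: "U_closed L U P" and Dc: "is_closed L U P D"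
    and Yf: "finite (verts Y)" and Pf: "finite (verts P)" and If: "finite I"
    and lam: "\<And>i. i \<in> I \<Longrightarrow> embedding L (restr P D) Y (lam i)"
    and a_inj: "inj_on a (verts Y)"
    and J_inj: "\<And>i. i \<in> I \<Longrightarrow> inj_on (J i) (verts P)"
    and J_D: "\<And>i x. i \<in> I \<Longrightarrow> x \<in> D \<Longrightarrow> J i x = a (lam i x)"
    and J_a: "\<And>i x. i \<in> I \<Longrightarrow> x \<in> verts P \<Longrightarrow> x \<notin> D \<Longrightarrow> J i x \<notin> a ` verts Y"
    and J_J: "\<And>i i' x x'. i \<in> I \<Longrightarrow> i' \<in> I \<Longrightarrow> i \<noteq> i' \<Longrightarrow> x \<in> verts P \<Longrightarrow> x \<notin> D \<Longrightarrow> x' \<in> verts P \<Longrightarrow> J i x \<noteq> J i' x'"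
begin

abbreviation "Q \<equiv> glue Y P I a J"

lemma Ys: "is_structure L Y" and Ps: "is_structure L P"
  using Yu Pu by (simp_all add: U_closed_structure)

lemma Ds: "is_structure L (restr P D)" by (rule restr_structure[OF Ps Dc])

lemma D_sub: "D \<subseteq> verts P" using Dc by (rule closed_subset)

lemma lam_verts: "i \<in> I \<Longrightarrow> x \<in> D \<Longrightarrow> lam i x \<in> verts Y"
  using hom_verts[OF embedding_hom[OF lam]] by auto

lemma J_in_a: "i \<in> I \<Longrightarrow> x \<in> verts P \<Longrightarrow> J i x \<in> a ` verts Y \<longleftrightarrow> x \<in> D"
  using J_a J_D lam_verts by blast

lemma Q_verts: "verts Q = a ` verts Y \<union> (\<Union>i\<in>I. J i ` verts P)"
  unfolding glue_def by simp

lemma Q_rel: "zs \<in> rel Q R \<longleftrightarrow> (\<exists>xs\<in>rel Y R. zs = map a xs) \<or> (\<exists>i\<in>I. \<exists>xs\<in>rel P R. zs = map (J i) xs)"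
  unfolding glue_def by auto

lemma Q_rel_cases [consumes 1, case_names Y P]:
  assumes "zs \<in> rel Q R"
  obtains xs where "xs \<in> rel Y R" "zs = map a xs" | i xs where "i \<in> I" "xs \<in> rel P R" "zs = map (J i) xs"
  using assms unfolding Q_rel by blast

lemma glue_fn_cases [consumes 1, case_names Y P]:
  assumes "glue_fn Y P I a J F zs v"
  obtains xs u where "fn Y F xs = Some u" "zs = map a xs" "v = a u"
  | i xs u where "i \<in> I" "fn P F xs = Some u" "zs = map (J i) xs" "v = J i u"
  using assms unfolding glue_fn_def by blast

lemma map_J_in_a:
  assumes "i \<in> I" "set xs \<subseteq> verts P" "set (map (J i) xs) \<subseteq> a ` verts Y"
  shows "set xs \<subseteq> D"
proof
  fix x assume "x \<in> set xs"
  then show "x \<in> D" using J_in_a[OF assms(1), of x] assms(2,3) by auto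
qed

lemma map_J_D:
  assumes "i \<in> I" "set xs \<subseteq> D"
  shows "map (J i) xs = map a (map (lam i) xs)" "set (map (lam i) xs) \<subseteq> verts Y"
  using J_D[OF assms(1)] lam_verts[OF assms(1)] assms(2) by auto

lemma map_a_inj: "set xs \<subseteq> verts Y \<Longrightarrow> set ys \<subseteq> verts Y \<Longrightarrow> map a xs = map a ys \<Longrightarrow> xs = ys"
  using a_inj by (meson inj_on_map_eq_map inj_on_subset le_sup_iff)

lemma map_J_inj: "i \<in> I \<Longrightarrow> set xs \<subseteq> verts P \<Longrightarrow> set ys \<subseteq> verts P \<Longrightarrow> map (J i) xs = map (J i) ys \<Longrightarrow> xs = ys"
  using J_inj[of i] by (meson inj_on_map_eq_map inj_on_subset le_sup_iff)

lemma J_a_eq: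
  assumes "i \<in> I" "set xs \<subseteq> verts P" "set ys \<subseteq> verts Y" "map (J i) xs = map a ys"
  shows "set xs \<subseteq> D \<and> ys = map (lam i) xs"
proof -
  have "set (map (J i) xs) \<subseteq> a ` verts Y" unfolding assms(4) using assms(3) by auto
  then have D: "set xs \<subseteq> D" by (rule map_J_in_a[OF assms(1,2)])
  then have "map a ys = map a (map (lam i) xs)" using map_J_D(1)[OF assms(1) D] assms(4) by simp
  then show ?thesis using D map_a_inj[OF assms(3) map_J_D(2)[OF assms(1) D]] by blast
qed

lemma J_J_eq:
  assumes "i \<in> I" "i' \<in> I" "i \<noteq> i'" "set xs \<subseteq> verts P" "set xs' \<subseteq> verts P" "set (map (J i) xs) \<subseteq> J i' ` verts P"
  shows "set xs \<subseteq> D"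
proof
  fix x assume x: "x \<in> set xs"
  then obtain x' where "x' \<in> verts P" "J i x = J i' x'" using assms(6) by auto
  then show "x \<in> D" using J_J[OF assms(1-3), of x x'] x assms(4) by auto
qed

lemma fn_D:
  assumes "i \<in> I" "F \<in> funs L" "set xs \<subseteq> D"
  shows "fn Y F (map (lam i) xs) = map_option (lam i) (fn P F xs)"
  using lam[OF assms(1)] assms(2,3) unfolding embedding_iff[OF Ds Ys] by simp

lemma glue_fn_a:
  assumes "set zs \<subseteq> a ` verts Y" "glue_fn Y P I a J F zs v"
  shows "\<exists>xs u. fn Y F xs = Some u \<and> zs = map a xs \<and> v = a u"
proof (rule ccontr)
  assume n: "\<not> ?thesis"
  then obtain i xs u where i: "i \<in> I" "fn P F xs = Some u" "zs = map (J i) xs" "v = J i u"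
    using assms(2) unfolding glue_fn_def by metis
  note s = structure_fn[OF Ps i(2)]
  have D: "set xs \<subseteq> D" using map_J_in_a[OF i(1), of xs] s assms(1) i(3) by auto
  have "u \<in> D" using closedD[OF Dc rule_fnI[OF _ i(2)] D] s by simp
  then have "v = a (lam i u)" using i(1,4) J_D by simp
  moreover have "fn Y F (map (lam i) xs) = Some (lam i u)" using fn_D[OF i(1) _ D] s i(2) by simp
  ultimately show False using n map_J_D(1)[OF i(1) D] i(3) by blast
qed

lemma glue_fn_J:
  assumes i: "i \<in> I" and xs: "set xs \<subseteq> verts P" "\<not> set xs \<subseteq> D" and g: "glue_fn Y P I a J F (map (J i) xs) v"
  shows "\<exists>u. fn P F xs = Some u \<and> v = J i u"
proof -
  have "\<not> (\<exists>ys u. fn Y F ys = Some u \<and> map (J i) xs = map a ys \<and> v = a u)"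
  proof
    assume "\<exists>ys u. fn Y F ys = Some u \<and> map (J i) xs = map a ys \<and> v = a u"
    then obtain ys u where y: "fn Y F ys = Some u" "map (J i) xs = map a ys" by blast
    then show False using J_a_eq[OF i xs(1) _ y(2)] structure_fn[OF Ys y(1)] xs(2) by simp
  qed
  then obtain i' xs' u where i': "i' \<in> I" "fn P F xs' = Some u" "map (J i) xs = map (J i') xs'" "v = J i' u"
    using g unfolding glue_fn_def by metis
  have s: "set xs' \<subseteq> verts P" using structure_fn[OF Ps i'(2)] by simp
  have "i = i'"
  proof (rule ccontr)
    assume ne: "i \<noteq> i'"
    have "set (map (J i) xs) \<subseteq> J i' ` verts P" unfolding i'(3) using s by auto
    then show False using J_J_eq[OF i i'(1) ne xs(1) s] xs(2) by simp
  qed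
  then have "xs = xs'" using map_J_inj[OF i xs(1) s] i'(3) by simp
  then show ?thesis using i' \<open>i = i'\<close> by simp
qed

text \<open>A tuple inside the image of \<open>Y\<close> takes its value there, since \<open>D\<close> is closed under
  functions and \<open>lam i\<close> is an embedding. A tuple outside lies in a single copy of \<open>P\<close>.\<close>
lemma glue_fn_unique:
  assumes "glue_fn Y P I a J F zs v" "glue_fn Y P I a J F zs w"
  shows "v = w"
proof (cases "set zs \<subseteq> a ` verts Y")
  case True
  obtain xs u where 1: "fn Y F xs = Some u" "zs = map a xs" "v = a u" using glue_fn_a[OF True assms(1)] by blast
  obtain ys w' where 2: "fn Y F ys = Some w'" "zs = map a ys" "w = a w'" using glue_fn_a[OF True assms(2)] by blast
  have "xs = ys" using map_a_inj[of xs ys] structure_fn[OF Ys 1(1)] structure_fn[OF Ys 2(1)] 1(2) 2(2) by simp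
  then show ?thesis using 1 2 by simp
next
  case False
  obtain i xs u where 1: "i \<in> I" "fn P F xs = Some u" "zs = map (J i) xs" "v = J i u"
  proof -
    have "\<not> (\<exists>xs u. fn Y F xs = Some u \<and> zs = map a xs \<and> v = a u)"
    proof
      assume "\<exists>xs u. fn Y F xs = Some u \<and> zs = map a xs \<and> v = a u"
      then obtain xs u where y: "fn Y F xs = Some u" "zs = map a xs" by blast
      have "set zs \<subseteq> a ` verts Y" unfolding y(2) set_map using structure_fn[OF Ys y(1)] by blast
      then show False using False by simp
    qed
    then show ?thesis using that assms(1) unfolding glue_fn_def by metis
  qed
  have xs: "set xs \<subseteq> verts P" using structure_fn[OF Ps 1(2)] by simp
  have "\<not> set xs \<subseteq> D"
  proof
    assume "set xs \<subseteq> D"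
    then have "set zs \<subseteq> a ` verts Y" unfolding 1(3) using J_in_a[OF 1(1)] xs by auto
    then show False using False by simp
  qed
  then show ?thesis using glue_fn_J[OF 1(1) xs _ assms(2)[unfolded 1(3)]] 1(2,4) by auto
qed

lemma Q_fn: "fn Q F zs = Some v \<longleftrightarrow> glue_fn Y P I a J F zs v"
proof -
  have *: "fn Q F zs = (if \<exists>v. glue_fn Y P I a J F zs v then Some (THE v. glue_fn Y P I a J F zs v) else None)"
    unfolding glue_def by simp
  show ?thesis
  proof
    assume l: "fn Q F zs = Some v"
    then obtain w where w: "glue_fn Y P I a J F zs w" unfolding * by (auto split: if_splits)
    have "(THE v. glue_fn Y P I a J F zs v) = w" using w by (rule the_equality) (rule glue_fn_unique[OF _ w])
    then show "glue_fn Y P I a J F zs v" using l w unfolding * by (auto split: if_splits)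
  next
    assume r: "glue_fn Y P I a J F zs v"
    have "(THE v. glue_fn Y P I a J F zs v) = v" using r by (rule the_equality) (rule glue_fn_unique[OF _ r])
    then show "fn Q F zs = Some v" using r unfolding * by auto
  qed
qed

lemma Q_finite: "finite (verts Q)"
  unfolding Q_verts using Yf Pf If by simp

lemma Q_structure: "is_structure L Q"
  unfolding is_structure_def
proof (intro conjI ballI allI impI subsetI)
  show "countable (verts Q)" using Q_finite by (rule countable_finite)
next
  fix R zs assume "R \<in> rels L" and zs: "zs \<in> rel Q R"
  from zs show "zs \<in> tuples (verts Q) (rel_arity L R)"
  proof (cases rule: Q_rel_cases)
    case (Y xs)
    then have "set zs \<subseteq> a ` verts Y" using structure_rel[OF Ys Y(1)] by auto
    then show ?thesis using Y structure_rel[OF Ys Y(1)] unfolding tuples_def Q_verts by auto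
  next
    case (P i xs)
    then have "set zs \<subseteq> J i ` verts P" using structure_rel[OF Ps P(2)] by auto
    then show ?thesis using P structure_rel[OF Ps P(2)] unfolding tuples_def Q_verts by auto
  qed
next
  fix F zs assume "F \<in> funs L" "zs \<in> dom (fn Q F)"
  then obtain v where "fn Q F zs = Some v" by blast
  then have "glue_fn Y P I a J F zs v" unfolding Q_fn .
  then show "zs \<in> tuples (verts Q) (fun_arity L F)"
  proof (cases rule: glue_fn_cases)
    case (Y xs u)
    then have "set zs \<subseteq> a ` verts Y" using structure_fn[OF Ys Y(1)] by auto
    then show ?thesis using Y structure_fn[OF Ys Y(1)] unfolding tuples_def Q_verts by auto
  next
    case (P i xs u)
    then have "set zs \<subseteq> J i ` verts P" using structure_fn[OF Ps P(2)] by auto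
    then show ?thesis using P structure_fn[OF Ps P(2)] unfolding tuples_def Q_verts by auto
  qed
next
  fix F v assume "F \<in> funs L" "v \<in> ran (fn Q F)"
  then obtain zs where "fn Q F zs = Some v" unfolding ran_def by blast
  then have "glue_fn Y P I a J F zs v" unfolding Q_fn .
  then show "v \<in> verts Q"
  proof (cases rule: glue_fn_cases)
    case (Y xs u)
    then show ?thesis using structure_fn[OF Ys Y(1)] unfolding Q_verts by blast
  next
    case (P i xs u)
    then show ?thesis using structure_fn[OF Ps P(2)] unfolding Q_verts by blast
  qed
next
  fix R assume "R \<notin> rels L"
  then have "rel P R = {}" "rel Y R = {}" using Ps Ys unfolding is_structure_def by blast+
  then show "rel Q R = {}" unfolding glue_def by simp
next
  fix F assume "F \<notin> funs L"
  then have e: "fn P F = Map.empty" "fn Y F = Map.empty" using Ps Ys unfolding is_structure_def by blast+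
  have "\<not> glue_fn Y P I a J F zs v" for zs v unfolding glue_fn_def e by simp
  then have "fn Q F zs = None" for zs using Q_fn by (metis not_Some_eq)
  then show "fn Q F = Map.empty" by (intro ext)
qed

lemma a_embedding: "embedding L Y Q a"
  unfolding embedding_iff[OF Ys Q_structure]
proof (intro conjI ballI allI impI)
  show "a ` verts Y \<subseteq> verts Q" unfolding Q_verts by blast
  show "inj_on a (verts Y)" by (rule a_inj)
next
  fix R ys assume R: "R \<in> rels L" and ys: "set ys \<subseteq> verts Y"
  show "map a ys \<in> rel Q R \<longleftrightarrow> ys \<in> rel Y R"
  proof
    assume "map a ys \<in> rel Q R"
    then consider (y) xs where "xs \<in> rel Y R" "map a ys = map a xs"
      | (p) i xs where "i \<in> I" "xs \<in> rel P R" "map a ys = map (J i) xs"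
      unfolding Q_rel by blast
    then show "ys \<in> rel Y R"
    proof cases
      case y
      have "ys = xs" by (rule map_a_inj[OF ys _ y(2)]) (simp add: structure_rel[OF Ys y(1)])
      then show ?thesis using y(1) by simp
    next
      case p
      have D: "set xs \<subseteq> D \<and> ys = map (lam i) xs" using J_a_eq[OF p(1) _ ys p(3)[symmetric]] structure_rel[OF Ps p(2)] by simp
      then have "xs \<in> rel (restr P D) R" using p(2) by simp
      then show ?thesis using hom_rel[OF embedding_hom[OF lam[OF p(1)]] R] D by simp
    qed
  next
    assume "ys \<in> rel Y R"
    then show "map a ys \<in> rel Q R" unfolding Q_rel by blast
  qed
next
  fix F ys assume F: "F \<in> funs L" and ys: "set ys \<subseteq> verts Y"
  show "fn Q F (map a ys) = map_option a (fn Y F ys)"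
  proof (cases "fn Y F ys")
    case (Some u)
    then have "glue_fn Y P I a J F (map a ys) (a u)" unfolding glue_fn_def by blast
    then show ?thesis using Q_fn Some by simp
  next
    case None
    have "fn Q F (map a ys) = None"
    proof (rule ccontr)
      assume "fn Q F (map a ys) \<noteq> None"
      then obtain v where "glue_fn Y P I a J F (map a ys) v" using Q_fn by blast
      moreover have "set (map a ys) \<subseteq> a ` verts Y" using ys by auto
      ultimately obtain xs u where "fn Y F xs = Some u" "map a ys = map a xs" using glue_fn_a by blast
      then show False using map_a_inj[OF ys] structure_fn[OF Ys] None by (metis option.distinct(1))
    qed
    then show ?thesis using None by simp
  qed
qed

lemma J_embedding:
  assumes i: "i \<in> I"
  shows "embedding L P Q (J i)"
  unfolding embedding_iff[OF Ps Q_structure]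
proof (intro conjI ballI allI impI)
  show "J i ` verts P \<subseteq> verts Q" unfolding Q_verts using i by blast
  show "inj_on (J i) (verts P)" by (rule J_inj[OF i])
next
  fix R xs assume R: "R \<in> rels L" and xs: "set xs \<subseteq> verts P"
  have lamR: "map (lam j) ys \<in> rel Y R \<longleftrightarrow> ys \<in> rel P R" if "j \<in> I" "set ys \<subseteq> D" for j ys
  proof -
    have "map (lam j) ys \<in> rel Y R \<longleftrightarrow> ys \<in> rel (restr P D) R"
      using lam[OF that(1)] R that(2) unfolding embedding_iff[OF Ds Ys] restr_simps(1) by blast
    then show ?thesis using that(2) by simp
  qed
  show "map (J i) xs \<in> rel Q R \<longleftrightarrow> xs \<in> rel P R"
  proof
    assume "map (J i) xs \<in> rel Q R"
    then consider (y) ys where "ys \<in> rel Y R" "map (J i) xs = map a ys"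
      | (p) j ys where "j \<in> I" "ys \<in> rel P R" "map (J i) xs = map (J j) ys"
      unfolding Q_rel by blast
    then show "xs \<in> rel P R"
    proof cases
      case y
      then have "set xs \<subseteq> D \<and> ys = map (lam i) xs" using J_a_eq[OF i xs _ y(2)] structure_rel[OF Ys y(1)] by simp
      then show ?thesis using lamR[OF i, of xs] y(1) by simp
    next
      case p
      have ys: "set ys \<subseteq> verts P" using structure_rel[OF Ps p(2)] by simp
      show ?thesis
      proof (cases "i = j")
        case True
        then show ?thesis using map_J_inj[OF i xs ys] p by simp
      next
        case False
        have "set (map (J i) xs) \<subseteq> J j ` verts P" unfolding p(3) using ys by auto
        then have 1: "set xs \<subseteq> D" by (rule J_J_eq[OF i p(1) False xs ys])
        have "set (map (J j) ys) \<subseteq> J i ` verts P" unfolding p(3)[symmetric] using xs by auto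
        then have 2: "set ys \<subseteq> D" by (rule J_J_eq[OF p(1) i False[symmetric] ys xs])
        have "map a (map (lam i) xs) = map a (map (lam j) ys)"
          using p(3) map_J_D(1)[OF i 1] map_J_D(1)[OF p(1) 2] by simp
        then have "map (lam i) xs = map (lam j) ys" by (rule map_a_inj[OF map_J_D(2)[OF i 1] map_J_D(2)[OF p(1) 2]])
        then show ?thesis using lamR[OF i 1] lamR[OF p(1) 2] p(2) by simp
      qed
    qed
  next
    assume "xs \<in> rel P R"
    then show "map (J i) xs \<in> rel Q R" unfolding Q_rel using i by blast
  qed
next
  fix F xs assume F: "F \<in> funs L" and xs: "set xs \<subseteq> verts P"
  show "fn Q F (map (J i) xs) = map_option (J i) (fn P F xs)"
  proof (cases "fn P F xs")
    case (Some u)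
    then have "glue_fn Y P I a J F (map (J i) xs) (J i u)" unfolding glue_fn_def using i by blast
    then show ?thesis using Q_fn Some by simp
  next
    case None
    have "fn Q F (map (J i) xs) = None"
    proof (rule ccontr)
      assume "fn Q F (map (J i) xs) \<noteq> None"
      then obtain v where v: "glue_fn Y P I a J F (map (J i) xs) v" using Q_fn by blast
      show False
      proof (cases "set xs \<subseteq> D")
        case True
        have "set (map (J i) xs) \<subseteq> a ` verts Y" using J_in_a[OF i] True xs by auto
        then obtain ys u where y: "fn Y F ys = Some u" "map (J i) xs = map a ys" using glue_fn_a[OF _ v] by blast
        have "ys = map (lam i) xs" using J_a_eq[OF i xs _ y(2)] structure_fn[OF Ys y(1)] by simp
        then show False using fn_D[OF i F True] y(1) None by simp
      next
        case False
        then show False using glue_fn_J[OF i xs False v] None by simp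
      qed
    qed
    then show ?thesis using None by simp
  qed
qed

lemma Q_rule:
  assumes "rule L U' Q t y"
  shows "(\<exists>t' y'. rule L U' Y t' y' \<and> t = map a t' \<and> y = a y') \<or>
    (\<exists>i\<in>I. \<exists>t' y'. rule L U' P t' y' \<and> t = map (J i) t' \<and> y = J i y')"
  using assms
proof (cases rule: rule_cases)
  case (fn F)
  then have "glue_fn Y P I a J F t y" using Q_fn by simp
  then consider (y) xs u where "fn Y F xs = Some u" "t = map a xs" "y = a u"
    | (p) i xs u where "i \<in> I" "fn P F xs = Some u" "t = map (J i) xs" "y = J i u"
    unfolding glue_fn_def by blast
  then show ?thesis
  proof cases
    case y then show ?thesis using rule_fnI[OF fn(1) y(1)] by blast
  next
    case p then show ?thesis using rule_fnI[OF fn(1) p(2)] by blast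
  qed
next
  case (rel R S ys)
  have *: "\<exists>t' ys' y'. xs = t' @ ys' \<and> t = map f t' \<and> y = f y' \<and> length t' = card (verts S) \<and> y' \<in> set ys'"
    if "t @ ys = map f xs" for xs and f :: "'z \<Rightarrow> 'q"
  proof -
    obtain t' ys' where 1: "xs = t' @ ys'" "t = map f t'" "ys = map f ys'"
      using \<open>t @ ys = map f xs\<close> by (metis append_eq_map_conv)
    then show ?thesis using rel(4,5) by auto
  qed
  consider (y) xs where "xs \<in> rel Y R" "t @ ys = map a xs" | (p) i xs where "i \<in> I" "xs \<in> rel P R" "t @ ys = map (J i) xs"
    using rel(3) unfolding Q_rel by blast
  then show ?thesis
  proof cases
    case y
    obtain t' ys' y' where 1: "xs = t' @ ys'" "t = map a t'" "y = a y'" "length t' = card (verts S)" "y' \<in> set ys'"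
      using *[OF y(2)] by blast
    have "rule L U' Y t' y'" by (rule rule_relI[OF rel(1,2) _ 1(4,5)]) (use y(1) 1(1) in simp)
    then show ?thesis using 1 by blast
  next
    case p
    obtain t' ys' y' where 1: "xs = t' @ ys'" "t = map (J i) t'" "y = J i y'" "length t' = card (verts S)" "y' \<in> set ys'"
      using *[OF p(3)] by blast
    have "rule L U' P t' y'" by (rule rule_relI[OF rel(1,2) _ 1(4,5)]) (use p(2) 1(1) in simp)
    then show ?thesis using 1 p(1) by blast
  qed
qed

lemma Q_edge:
  assumes "edge L Q e"
  shows "set e \<subseteq> a ` verts Y \<or> (\<exists>i\<in>I. set e \<subseteq> J i ` verts P)"
  using assms unfolding edge_def
proof (elim disjE bexE)
  fix R assume "R \<in> rels L" "e \<in> rel Q R"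
  then consider (y) xs where "xs \<in> rel Y R" "e = map a xs" | (p) i xs where "i \<in> I" "xs \<in> rel P R" "e = map (J i) xs"
    unfolding Q_rel by blast
  then show ?thesis
  proof cases
    case y then show ?thesis using structure_rel[OF Ys y(1)] by auto
  next
    case p
    then have "set e \<subseteq> J i ` verts P" using structure_rel[OF Ps p(2)] by auto
    then show ?thesis using p(1) by blast
  qed
next
  fix F assume "F \<in> funs L" "e \<in> dom (fn Q F)"
  then obtain v where "fn Q F e = Some v" by blast
  then have "glue_fn Y P I a J F e v" unfolding Q_fn .
  then consider (y) xs u where "fn Y F xs = Some u" "e = map a xs" | (p) i xs u where "i \<in> I" "fn P F xs = Some u" "e = map (J i) xs"
    unfolding glue_fn_def by blast
  then show ?thesis
  proof cases
    case y then show ?thesis using structure_fn[OF Ys y(1)] by auto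
  next
    case p
    then have "set e \<subseteq> J i ` verts P" using structure_fn[OF Ps p(2)] by auto
    then show ?thesis using p(1) by blast
  qed
qed

lemma Q_closedI:
  assumes "X \<subseteq> verts Q"
    and "\<And>t y. rule L U Y t y \<Longrightarrow> set t \<subseteq> verts Y \<Longrightarrow> set (map a t) \<subseteq> X \<Longrightarrow> a y \<in> X"
    and "\<And>i t y. i \<in> I \<Longrightarrow> rule L U P t y \<Longrightarrow> set t \<subseteq> verts P \<Longrightarrow> set (map (J i) t) \<subseteq> X \<Longrightarrow> J i y \<in> X"
  shows "is_closed L U Q X"
  unfolding is_closed_def
proof (intro conjI allI impI)
  fix t y assume *: "rule L U Q t y \<and> set t \<subseteq> X"
  then consider (y) t' y' where "rule L U Y t' y'" "t = map a t'" "y = a y'"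
    | (p) i t' y' where "i \<in> I" "rule L U P t' y'" "t = map (J i) t'" "y = J i y'"
    using Q_rule[of U t y] by blast
  then show "y \<in> X"
  proof cases
    case y
    then show ?thesis using assms(2)[OF y(1)] rule_verts[OF Ys y(1)] * by simp
  next
    case p
    then show ?thesis using assms(3)[OF p(1,2)] rule_verts[OF Ps p(2)] * by simp
  qed
qed (rule assms(1))

lemma rule_D:
  assumes "rule L U P t y" "set t \<subseteq> D"
  shows "y \<in> D"
  using closedD[OF Dc assms] .

lemma closed_a: "is_closed L U Q (a ` verts Y)"
proof (rule Q_closedI)
  show "a ` verts Y \<subseteq> verts Q" unfolding Q_verts by blast
  fix t y assume "rule L U Y t y" then show "a y \<in> a ` verts Y" using rule_verts[OF Ys] by blast
next
  fix i t y assume *: "i \<in> I" "rule L U P t y" "set t \<subseteq> verts P" "set (map (J i) t) \<subseteq> a ` verts Y"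
  have "y \<in> D" by (rule rule_D[OF *(2) map_J_in_a[OF *(1,3,4)]])
  then show "J i y \<in> a ` verts Y" using J_in_a[OF *(1)] D_sub by blast
qed

lemma lam_closed:
  assumes "i \<in> I"
  shows "is_closed L U Y (lam i ` D)"
  using embedding_image_closed[OF lam[OF assms] restr_U_closed[OF Pu Dc] Yu] by simp

lemma a_in_J:
  assumes "i \<in> I" "y \<in> verts Y" "a y \<in> J i ` verts P"
  shows "y \<in> lam i ` D"
proof -
  obtain x where x: "x \<in> verts P" "a y = J i x" using assms(3) by blast
  then have "x \<in> D" using J_in_a[OF assms(1) x(1)] assms(2) by (metis imageI)
  then have "a y = a (lam i x)" using J_D[OF assms(1)] x(2) by simp
  then have "y = lam i x" using a_inj assms(2) lam_verts[OF assms(1) \<open>x \<in> D\<close>] by (meson inj_onD)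
  then show ?thesis using \<open>x \<in> D\<close> by blast
qed

lemma J_a_lam:
  assumes "i \<in> I"
  shows "a ` lam i ` D \<subseteq> J i ` verts P"
proof
  fix v assume "v \<in> a ` lam i ` D"
  then obtain x where x: "x \<in> D" "v = a (lam i x)" by blast
  then have "v = J i x" using J_D[OF assms] by simp
  then show "v \<in> J i ` verts P" using x(1) D_sub by blast
qed

text \<open>If a rule of another copy \<open>j\<close> applies to vertices shared with copy \<open>i\<close>, then these
  vertices come from \<open>D\<close> and the rule holds in \<open>Y\<close> already, where the image of \<open>D\<close> under
  \<open>lam i\<close> is closed.\<close>
lemma closed_J:
  assumes i: "i \<in> I"
  shows "is_closed L U Q (J i ` verts P)"
proof (rule Q_closedI)
  show "J i ` verts P \<subseteq> verts Q" unfolding Q_verts using i by blast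
next
  fix t y assume *: "rule L U Y t y" "set t \<subseteq> verts Y" "set (map a t) \<subseteq> J i ` verts P"
  have "x \<in> lam i ` D" if "x \<in> set t" for x
  proof (rule a_in_J[OF i])
    show "x \<in> verts Y" "a x \<in> J i ` verts P" using *(2,3) that by (auto simp: image_subset_iff)
  qed
  then have "set t \<subseteq> lam i ` D" by blast
  then have "y \<in> lam i ` D" by (rule closedD[OF lam_closed[OF i] *(1)])
  then show "a y \<in> J i ` verts P" using J_a_lam[OF i] by blast
next
  fix j t y assume *: "j \<in> I" "rule L U P t y" "set t \<subseteq> verts P" "set (map (J j) t) \<subseteq> J i ` verts P"
  show "J j y \<in> J i ` verts P"
  proof (cases "j = i")
    case True then show ?thesis using rule_verts[OF Ps *(2)] by blast
  next
    case False
    have D: "set t \<subseteq> D" by (rule J_J_eq[OF *(1) i False *(3) *(3) *(4)])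
    have y: "y \<in> D" by (rule rule_D[OF *(2) D])
    have "rule L U (restr P D) t y" using restr_rule[OF Ps Dc subset_refl] *(2) D by simp
    then have r: "rule L U Y (map (lam j) t) (lam j y)" by (rule hom_rule[OF embedding_hom[OF lam[OF *(1)]]])
    have "set (map a (map (lam j) t)) \<subseteq> J i ` verts P" using *(4) map_J_D(1)[OF *(1) D] by simp
    then have "x \<in> lam i ` D" if "x \<in> set (map (lam j) t)" for x
      using a_in_J[OF i, of x] map_J_D(2)[OF *(1) D] that by auto
    then have "set (map (lam j) t) \<subseteq> lam i ` D" by blast
    then have "lam j y \<in> lam i ` D" by (rule closedD[OF lam_closed[OF i] r])
    then show ?thesis using J_D[OF *(1) y] J_a_lam[OF i] by auto
  qed
qed

text \<open>Together with \<open>closed_J\<close> this gives a decomposition into closed sets that separates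
  the \<open>i\<close>-th copy of \<open>P\<close> from everything else.\<close>
lemma closed_without_copy:
  assumes i: "i \<in> I"
  shows "is_closed L U Q (a ` verts Y \<union> (\<Union>j\<in>I - {i}. J j ` verts P))" (is "is_closed L U Q ?X")
proof (rule Q_closedI)
  show "?X \<subseteq> verts Q" unfolding Q_verts by blast
next
  fix t y assume "rule L U Y t y" then show "a y \<in> ?X" using rule_verts[OF Ys] by blast
next
  fix j t y assume *: "j \<in> I" "rule L U P t y" "set t \<subseteq> verts P" "set (map (J j) t) \<subseteq> ?X"
  show "J j y \<in> ?X"
  proof (cases "j = i")
    case False then show ?thesis using rule_verts[OF Ps *(2)] *(1) by blast
  next
    case True
    have "x \<in> D" if "x \<in> set t" for x
    proof (rule ccontr)
      assume n: "x \<notin> D"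
      have x: "x \<in> verts P" using that *(3) by blast
      have "J i x \<in> ?X" using *(4) that True by auto
      then show False using J_a[OF i x n] J_J[OF i _ _ x n] by blast
    qed
    then have "y \<in> D" by (intro rule_D[OF *(2)]) blast
    then have "J j y \<in> a ` verts Y" using J_in_a[OF *(1)] D_sub by blast
    then show ?thesis by blast
  qed
qed

text \<open>The amalgam is free, so that irreducible structures map into one of its parts.\<close>
lemma unsplit_image_cases:
  assumes M: "unsplit L U' M" "U' \<subseteq> U" and p: "homomorphism L M Q p"
  shows "p ` verts M \<subseteq> a ` verts Y \<or> (\<exists>i\<in>I. p ` verts M \<subseteq> J i ` verts P)"
proof (cases "p ` verts M \<subseteq> a ` verts Y")
  case False
  then obtain x where x: "x \<in> verts M" "p x \<notin> a ` verts Y" by blast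
  then obtain i x' where i: "i \<in> I" "x' \<in> verts P" "p x = J i x'" using hom_verts[OF p] unfolding Q_verts by blast
  let ?R = "a ` verts Y \<union> (\<Union>j\<in>I - {i}. J j ` verts P)"
  have "p x \<notin> ?R" using x i J_in_a[OF i(1,2)] J_J[OF i(1) _ _ i(2)] by auto
  moreover have "p ` verts M \<subseteq> J i ` verts P \<or> p ` verts M \<subseteq> ?R"
  proof (rule unsplit_hom_image[OF M p closed_J[OF i(1)] closed_without_copy[OF i(1)]])
    show "p ` verts M \<subseteq> J i ` verts P \<union> ?R" using hom_verts[OF p] unfolding Q_verts by blast
    fix e assume "edge L Q e"
    from Q_edge[OF this] show "set e \<subseteq> J i ` verts P \<or> set e \<subseteq> ?R"
    proof (elim disjE bexE)
      assume "set e \<subseteq> a ` verts Y" then show ?thesis by (intro disjI2 le_supI1)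
    next
      fix j assume "j \<in> I" "set e \<subseteq> J j ` verts P"
      then show ?thesis by (cases "j = i") auto
    qed
  qed
  ultimately show ?thesis using i(1) x(1) by blast
qed simp

text \<open>A root is irreducible and therefore embedded in one of the parts, which is \<open>\<U>\<close>-closed
  and provides the extension. Extensions stay in this part as it is a closed set, which
  gives uniqueness.\<close>
lemma Q_U_closed: "U_closed L U Q"
proof (rule U_closedI[OF Q_structure])
  fix R S t assume RS: "(R, S) \<in> U" "length t = card (verts S)" and "rooted L U Q R t"
  then obtain S' where S': "(R, S') \<in> U" "card (verts S') = length t" "represents_embedding L S' Q t"
    unfolding rooted_def by blast
  have "set t \<subseteq> a ` verts Y \<or> (\<exists>i\<in>I. set t \<subseteq> J i ` verts P)"
    using unsplit_image_cases[OF root(5)[OF S'(1)] empty_subsetI embedding_hom[OF S'(3)[unfolded represents_embedding_def]]]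
    unfolding root_image[OF S'(1,2)] .
  then show "\<exists>ys. t @ ys \<in> rel Q R"
  proof (elim disjE bexE)
    assume "set t \<subseteq> a ` verts Y"
    then obtain t' where t': "t = map a t'" "set t' \<subseteq> verts Y" by (rule list_in_image)
    have "rooted L U Y R t'" using rooted_map[OF Ys Q_structure a_embedding t'(2)] \<open>rooted L U Q R t\<close> t'(1) by simp
    then obtain ys where "t' @ ys \<in> rel Y R" using U_closed_ex1[OF Yu RS(1) _ t'(2)] RS(2) t'(1) by auto
    from hom_rel[OF embedding_hom[OF a_embedding] root(1)[OF RS(1)] this] show ?thesis using t'(1) by auto
  next
    fix i assume i: "i \<in> I" "set t \<subseteq> J i ` verts P"
    obtain t' where t': "t = map (J i) t'" "set t' \<subseteq> verts P" using i(2) by (rule list_in_image)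
    have "rooted L U P R t'" using rooted_map[OF Ps Q_structure J_embedding[OF i(1)] t'(2)] \<open>rooted L U Q R t\<close> t'(1) by simp
    then obtain ys where "t' @ ys \<in> rel P R" using U_closed_ex1[OF Pu RS(1) _ t'(2)] RS(2) t'(1) by auto
    from hom_rel[OF embedding_hom[OF J_embedding[OF i(1)]] root(1)[OF RS(1)] this] show ?thesis using t'(1) by auto
  qed
next
  fix R S t ys zs
  assume RS: "(R, S) \<in> U" "length t = card (verts S)" and r: "t @ ys \<in> rel Q R" "t @ zs \<in> rel Q R"
  have R: "R \<in> rels L" by (rule root(1)[OF RS(1)])
  have key: "ys = zs" if X: "is_closed L U Q (f ` verts X)" "set t \<subseteq> f ` verts X" and Xu: "U_closed L U X" and f: "embedding L X Q f"
    for X :: "('r, 'f, 'z) lstruct" and f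
  proof -
    have sub: "set us \<subseteq> f ` verts X" if "t @ us \<in> rel Q R" for us
      using closedD[OF X(1) rule_relI[OF RS(1) R that RS(2)] X(2)] by blast
    obtain t' where t': "t = map f t'" "set t' \<subseteq> verts X" using X(2) by (rule list_in_image)
    obtain ys' where y': "ys = map f ys'" "set ys' \<subseteq> verts X" using sub[OF r(1)] by (rule list_in_image)
    obtain zs' where z': "zs = map f zs'" "set zs' \<subseteq> verts X" using sub[OF r(2)] by (rule list_in_image)
    note Xs = U_closed_structure[OF Xu]
    have m: "map f us \<in> rel Q R \<longleftrightarrow> us \<in> rel X R" if "set us \<subseteq> verts X" for us
      using f R that unfolding embedding_iff[OF Xs Q_structure] by blast
    have "t' @ ys' \<in> rel X R" "t' @ zs' \<in> rel X R"
      using m[of "t' @ ys'"] m[of "t' @ zs'"] r t' y' z' by auto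
    then have "ys' = zs'" using U_closed_unique[OF Xu RS(1), of t'] RS(2) t'(1) by simp
    then show ?thesis using y' z' by simp
  qed
  consider (y) xs where "xs \<in> rel Y R" "t @ ys = map a xs" | (p) i xs where "i \<in> I" "xs \<in> rel P R" "t @ ys = map (J i) xs"
    using r(1) unfolding Q_rel by blast
  then show "ys = zs"
  proof cases
    case y
    have "set (t @ ys) \<subseteq> a ` verts Y" unfolding y(2) using structure_rel[OF Ys y(1)] by auto
    then show ?thesis by (intro key[OF closed_a _ Yu a_embedding]) simp
  next
    case p
    have "set (t @ ys) \<subseteq> J i ` verts P" unfolding p(3) using structure_rel[OF Ps p(2)] by auto
    then show ?thesis by (intro key[OF closed_J[OF p(1)] _ Pu J_embedding[OF p(1)]]) simp
  qed
next
  fix R S t ys assume RS: "(R, S) \<in> U" "length t = card (verts S)" and r: "t @ ys \<in> rel Q R"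
  consider (y) xs where "xs \<in> rel Y R" "t @ ys = map a xs" | (p) i xs where "i \<in> I" "xs \<in> rel P R" "t @ ys = map (J i) xs"
    using r unfolding Q_rel by blast
  then show "rooted L U Q R t"
  proof cases
    case y
    obtain t' ys' where 1: "xs = t' @ ys'" "t = map a t'" using y(2) by (metis append_eq_map_conv)
    have "rooted L U Y R t'" using U_closed_rooted[OF Yu RS(1), of t' ys'] y(1) 1 RS(2) by simp
    then show ?thesis using rooted_map[OF Ys Q_structure a_embedding, of t'] structure_rel[OF Ys y(1)] 1 by simp
  next
    case p
    obtain t' ys' where 1: "xs = t' @ ys'" "t = map (J i) t'" using p(3) by (metis append_eq_map_conv)
    have "rooted L U P R t'" using U_closed_rooted[OF Pu RS(1), of t' ys'] p(2) 1 RS(2) by simp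
    then show ?thesis using rooted_map[OF Ps Q_structure J_embedding[OF p(1)], of t'] structure_rel[OF Ps p(2)] 1 by simp
  qed
qed

end

section \<open>The Hales--Jewett theorem\<close>

text \<open>A combinatorial line is a word with the entry \<open>None\<close> at its moving coordinates, and
  \<open>line_word l s\<close> is its point for the letter \<open>s\<close>.\<close>
definition line_word :: "'a option list \<Rightarrow> 'a \<Rightarrow> 'a list" where
  "line_word l s = map (\<lambda>u. case u of None \<Rightarrow> s | Some t \<Rightarrow> t) l"

definition comb_line :: "'a set \<Rightarrow> nat \<Rightarrow> 'a option list \<Rightarrow> bool" where
  "comb_line S N l \<longleftrightarrow> length l = N \<and> None \<in> set l \<and> set l \<subseteq> insert None (Some ` S)"

lemma line_word_append: "line_word (l @ l') s = line_word l s @ line_word l' s"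
  unfolding line_word_def by simp

lemma line_word_const: "line_word (map Some w) s = w"
  unfolding line_word_def by (simp add: comp_def)

lemma line_word_in_alphabet:
  assumes "comb_line S N l" "s \<in> S"
  shows "length (line_word l s) = N" "set (line_word l s) \<subseteq> S"
  using assms unfolding comb_line_def line_word_def by (auto split: option.splits)

definition hales_jewett :: "'a set \<Rightarrow> nat \<Rightarrow> nat \<Rightarrow> bool" where
  "hales_jewett S k N \<longleftrightarrow> (\<forall>\<chi> :: 'a list \<Rightarrow> nat. (\<forall>w. \<chi> w < k) \<longrightarrow>
     (\<exists>l c. comb_line S N l \<and> (\<forall>s\<in>S. \<chi> (line_word l s) = c)))"

text \<open>The induction statement of the colour focusing argument: either a monochromatic line
  over the whole alphabet exists, or there are \<open>r\<close> lines with a common end point \<open>f\<close> at the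
  letter \<open>a\<close>, each monochromatic on the remaining letters, with \<open>r\<close> different colours.\<close>
definition focused :: "'a set \<Rightarrow> 'a \<Rightarrow> nat \<Rightarrow> nat \<Rightarrow> nat \<Rightarrow> bool" where
  "focused S a k r N \<longleftrightarrow> (\<forall>\<chi> :: 'a list \<Rightarrow> nat. (\<forall>w. \<chi> w < k) \<longrightarrow>
     (\<exists>l c. comb_line (insert a S) N l \<and> (\<forall>s\<in>insert a S. \<chi> (line_word l s) = c)) \<or>
     (\<exists>f C. length f = N \<and> set f \<subseteq> insert a S \<and> C \<subseteq> {..<k} \<and> card C = r \<and>
        (\<forall>c\<in>C. \<exists>l. comb_line (insert a S) N l \<and> line_word l a = f \<and> (\<forall>s\<in>S. \<chi> (line_word l s) = c))))"

text \<open>Words of length \<open>N'\<close> are coloured by the colourings of the words of length \<open>N\<close> that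
  they induce. The theorem for the smaller alphabet yields a line \<open>l0\<close> on which this
  colouring is constant as long as the letter \<open>a\<close> is avoided. Each focused line \<open>l\<close> is
  prolonged to \<open>l @ l0\<close>, and the focus itself followed by \<open>l0\<close> is a new line with the same
  end point. Its colour is new unless one of the old lines is monochromatic on all letters.\<close>
lemma focused_Suc:
  fixes S :: "'a set"
  assumes fin: "finite S" and ne: "S \<noteq> {}" and HJ: "\<And>k. \<exists>N. hales_jewett S k N" and foc: "focused S a k r N"
  shows "\<exists>M. focused S a k (Suc r) M"
proof -
  let ?W = "{w. set w \<subseteq> insert a S \<and> length w = N}"
  have W: "finite ?W" using fin by (intro finite_lists_length_eq) simp
  let ?F = "?W \<rightarrow>\<^sub>E {..<k}"
  have "finite ?F" using W by (intro finite_PiE) auto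
  \<comment> \<open>Colourings of the words of length \<open>N\<close>, coded as numbers to serve as colours.\<close>
  then obtain enc where enc: "bij_betw enc ?F {0..<card ?F}" using ex_bij_betw_finite_nat by blast
  obtain N' where N': "hales_jewett S (card ?F) N'" using HJ by blast
  obtain s0 where s0: "s0 \<in> S" using ne by blast
  have "focused S a k (Suc r) (N + N')"
    unfolding focused_def
  proof (intro allI impI)
    fix \<chi> :: "'a list \<Rightarrow> nat" assume \<chi>: "\<forall>w. \<chi> w < k"
    define g where "g w = restrict (\<lambda>x. \<chi> (x @ w)) ?W" for w
    have gF: "g w \<in> ?F" for w unfolding g_def using \<chi> by auto
    have "enc (g w) < card ?F" for w using bij_betw_apply[OF enc gF[of w]] by simp
    then have "\<forall>w. (\<lambda>w. enc (g w)) w < card ?F" by blast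
    then have "\<exists>l c. comb_line S N' l \<and> (\<forall>s\<in>S. (\<lambda>w. enc (g w)) (line_word l s) = c)"
      using N' unfolding hales_jewett_def by fast
    then obtain l0 c0 where l0: "comb_line S N' l0" "\<forall>s\<in>S. enc (g (line_word l0 s)) = c0" by blast
    have geq: "g (line_word l0 s) = g (line_word l0 s0)" if "s \<in> S" for s
      by (rule inj_onD[OF bij_betw_imp_inj_on[OF enc] _ gF gF]) (use l0(2) that s0 in simp)
    define \<psi> where "\<psi> x = \<chi> (x @ line_word l0 s0)" for x
    have eq: "\<chi> (x @ line_word l0 s) = \<psi> x" if "s \<in> S" "x \<in> ?W" for s x
      using fun_cong[OF geq[OF that(1)], of x] that(2) unfolding g_def \<psi>_def by simp
    have l0': "comb_line (insert a S) N' l0" using l0(1) unfolding comb_line_def by auto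
    have w0: "set (line_word l0 s0) \<subseteq> S" "length (line_word l0 s0) = N'" using line_word_in_alphabet[OF l0(1) s0] by auto
    have mono: "\<exists>l c. comb_line (insert a S) (N + N') l \<and> (\<forall>s\<in>insert a S. \<chi> (line_word l s) = c)"
      if l: "comb_line (insert a S) N l" "\<forall>s\<in>insert a S. \<psi> (line_word l s) = c" for l c
    proof (intro exI conjI ballI)
      show "comb_line (insert a S) (N + N') (l @ map Some (line_word l0 s0))"
        using l(1) w0 unfolding comb_line_def by auto
      fix s assume "s \<in> insert a S"
      then show "\<chi> (line_word (l @ map Some (line_word l0 s0)) s) = c"
        using l(2) unfolding \<psi>_def line_word_append line_word_const by blast
    qed
    have "\<forall>w. \<psi> w < k" unfolding \<psi>_def using \<chi> by blast
    then consider (line) l c where "comb_line (insert a S) N l" "\<forall>s\<in>insert a S. \<psi> (line_word l s) = c"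
      | (focus) f C where "length f = N" "set f \<subseteq> insert a S" "C \<subseteq> {..<k}" "card C = r"
        "\<And>c. c \<in> C \<Longrightarrow> \<exists>l. comb_line (insert a S) N l \<and> line_word l a = f \<and> (\<forall>s\<in>S. \<psi> (line_word l s) = c)"
      using foc unfolding focused_def by (metis (no_types, lifting))
    then show "(\<exists>l c. comb_line (insert a S) (N + N') l \<and> (\<forall>s\<in>insert a S. \<chi> (line_word l s) = c)) \<or>
      (\<exists>f C. length f = N + N' \<and> set f \<subseteq> insert a S \<and> C \<subseteq> {..<k} \<and> card C = Suc r \<and>
        (\<forall>c\<in>C. \<exists>l. comb_line (insert a S) (N + N') l \<and> line_word l a = f \<and> (\<forall>s\<in>S. \<chi> (line_word l s) = c)))"
    proof cases
      case line
      then show ?thesis using mono by blast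
    next
      case focus
      show ?thesis
      proof (cases "\<psi> f \<in> C")
        case True
        then obtain l where "comb_line (insert a S) N l" "line_word l a = f" "\<forall>s\<in>S. \<psi> (line_word l s) = \<psi> f"
          using focus(5) by blast
        then show ?thesis using mono[of l "\<psi> f"] by auto
      next
        case False
        have f: "f \<in> ?W" using focus(1,2) by simp
        have finC: "finite C" using focus(3) finite_subset by blast
        have la: "length (line_word l0 a) = N'" "set (line_word l0 a) \<subseteq> insert a S" using line_word_in_alphabet[OF l0'] by auto
        have "\<exists>l. comb_line (insert a S) (N + N') l \<and> line_word l a = f @ line_word l0 a \<and> (\<forall>s\<in>S. \<chi> (line_word l s) = c)"
          if c: "c \<in> insert (\<psi> f) C" for c
        proof (cases "c = \<psi> f")
          case True
          have "comb_line (insert a S) (N + N') (map Some f @ l0)"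
            using l0' focus(1,2) unfolding comb_line_def by auto
          moreover have "\<forall>s\<in>S. \<chi> (line_word (map Some f @ l0) s) = c"
            unfolding line_word_append line_word_const using eq[OF _ f] True by simp
          ultimately show ?thesis by (intro exI[of _ "map Some f @ l0"]) (simp add: line_word_append line_word_const)
        next
          case False
          then obtain l where l: "comb_line (insert a S) N l" "line_word l a = f" "\<forall>s\<in>S. \<psi> (line_word l s) = c"
            using focus(5) c by blast
          have "comb_line (insert a S) (N + N') (l @ l0)"
            using l0' l(1) unfolding comb_line_def by auto
          moreover have "\<chi> (line_word (l @ l0) s) = c" if "s \<in> S" for s
          proof -
            have "line_word l s \<in> ?W" using line_word_in_alphabet[OF l(1)] that by simp
            then show ?thesis unfolding line_word_append using eq[OF that] l(3) that by simp
          qed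
          ultimately show ?thesis using l(2) by (intro exI[of _ "l @ l0"]) (simp add: line_word_append)
        qed
        then show ?thesis
          using focus(1-4) False finC la \<chi>
          by (intro disjI2 exI[of _ "f @ line_word l0 a"] exI[of _ "insert (\<psi> f) C"]) (auto simp: \<psi>_def)
      qed
    qed
  qed
  then show ?thesis by blast
qed

text \<open>With \<open>k\<close> focused lines of different colours, the focus has the colour of one of them.\<close>
theorem hales_jewett_theorem:
  assumes "finite S"
  shows "\<exists>N. hales_jewett S k N"
  using assms
proof (induction S arbitrary: k rule: finite_induct)
  case empty
  have "hales_jewett ({} :: 'a set) k 1" unfolding hales_jewett_def comb_line_def
    by (intro allI impI exI[of _ "[None]"]) simp
  then show ?case by blast
next
  case (insert a S)
  show ?case
  proof (cases "S = {}")
    case True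
    have "hales_jewett (insert a S) k 1" unfolding hales_jewett_def comb_line_def True
      by (intro allI impI exI[of _ "[None]"]) simp
    then show ?thesis by blast
  next
    case False
    have "\<exists>N. focused S a k r N" for r
    proof (induction r)
      case 0
      have "focused S a k 0 0" unfolding focused_def
        by (intro allI impI disjI2 exI[of _ "[]"] exI[of _ "{}"]) simp
      then show ?case by blast
    next
      case (Suc r)
      then show ?case using focused_Suc[OF insert.hyps(1) False insert.IH] by blast
    qed
    then obtain N where N: "focused S a k k N" by blast
    have "hales_jewett (insert a S) k N" unfolding hales_jewett_def
    proof (intro allI impI)
      fix \<chi> :: "'a list \<Rightarrow> nat" assume \<chi>: "\<forall>w. \<chi> w < k"
      then consider (line) "\<exists>l c. comb_line (insert a S) N l \<and> (\<forall>s\<in>insert a S. \<chi> (line_word l s) = c)"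
        | (focus) f C where "C \<subseteq> {..<k}" "card C = k"
          "\<And>c. c \<in> C \<Longrightarrow> \<exists>l. comb_line (insert a S) N l \<and> line_word l a = f \<and> (\<forall>s\<in>S. \<chi> (line_word l s) = c)"
        using N unfolding focused_def by (metis (no_types, lifting))
      then show "\<exists>l c. comb_line (insert a S) N l \<and> (\<forall>s\<in>insert a S. \<chi> (line_word l s) = c)"
      proof cases
        case focus
        have "C = {..<k}" using focus(1,2) by (intro card_subset_eq) auto
        then have "\<chi> f \<in> C" using \<chi> by simp
        then obtain l where "comb_line (insert a S) N l" "line_word l a = f" "\<forall>s\<in>S. \<chi> (line_word l s) = \<chi> f"
          using focus(3) by blast
        then show ?thesis by (intro exI[of _ l] exI[of _ "\<chi> f"]) auto
      qed simp
    qed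
    then show ?thesis by blast
  qed
qed

section \<open>Local embeddability and partial completions\<close>

text \<open>Every irreducible piece of \<open>Q\<close> is found in \<open>P\<close> with the same labels. As each edge lies
  in an irreducible set, this transfers homomorphisms which factor through the labels.\<close>
definition locally_in :: "('r, 'f) lang \<Rightarrow> ('r, 'f) closure_descr \<Rightarrow> ('r, 'f, 'v) lstruct \<Rightarrow> ('v \<Rightarrow> 'l)
    \<Rightarrow> ('r, 'f, 'w) lstruct \<Rightarrow> ('w \<Rightarrow> 'l) \<Rightarrow> bool" where
  "locally_in L U Q lab' P lab \<longleftrightarrow>
     (\<forall>Z. irreducible_in L U Q Z \<longrightarrow> (\<exists>p. embedding L (restr Q Z) P p \<and> (\<forall>z\<in>Z. lab (p z) = lab' z)))"

definition generates :: "('r, 'f) lang \<Rightarrow> ('r, 'f) closure_descr \<Rightarrow> ('r, 'f, 'v) lstruct \<Rightarrow> 'v set \<Rightarrow> bool" where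
  "generates L U M X \<longleftrightarrow> (\<forall>Y. is_closed L U M Y \<and> X \<subseteq> Y \<longrightarrow> verts M \<subseteq> Y)"

text \<open>The map \<open>f\<close> on \<open>S\<close> extends to an embedding into \<open>E\<close> of every member \<open>M\<close> of the class
  that sits in \<open>C\<close> and is generated by its vertices in \<open>S\<close>. Speaking about all such \<open>M\<close>, and
  not only about the substructure induced on \<open>S\<close>, makes the notion compatible with
  amalgamation over closures.\<close>
definition completes :: "('r, 'f) lang \<Rightarrow> ('r, 'f) closure_descr \<Rightarrow> ('r, 'f, nat) lstruct set \<Rightarrow> ('r, 'f, 'v) lstruct
    \<Rightarrow> 'v set \<Rightarrow> ('r, 'f, nat) lstruct \<Rightarrow> ('v \<Rightarrow> nat) \<Rightarrow> bool" where
  "completes L U K C S E f \<longleftrightarrow>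
     (\<forall>M\<in>K. \<forall>h. embedding L M C h \<and> generates L U M {x \<in> verts M. h x \<in> S} \<longrightarrow>
        (\<exists>\<alpha>. embedding L M E \<alpha> \<and> (\<forall>x\<in>verts M. h x \<in> S \<longrightarrow> \<alpha> x = f (h x))))"

definition completable :: "('r, 'f) lang \<Rightarrow> ('r, 'f) closure_descr \<Rightarrow> ('r, 'f, nat) lstruct set \<Rightarrow> ('r, 'f, 'v) lstruct
    \<Rightarrow> nat \<Rightarrow> bool" where
  "completable L U K C n \<longleftrightarrow>
     (\<forall>S. S \<subseteq> verts C \<and> finite S \<and> card S \<le> n \<longrightarrow> (\<exists>E\<in>K. \<exists>f. completes L U K C S E f))"

lemma completesI:
  assumes "\<And>M h. M \<in> K \<Longrightarrow> embedding L M C h \<Longrightarrow> generates L U M {x \<in> verts M. h x \<in> S} \<Longrightarrow>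
    \<exists>\<alpha>. embedding L M E \<alpha> \<and> (\<forall>x\<in>verts M. h x \<in> S \<longrightarrow> \<alpha> x = f (h x))"
  shows "completes L U K C S E f"
  unfolding completes_def using assms by simp

lemma completesE:
  assumes "completes L U K C S E f" "M \<in> K" "embedding L M C h" "generates L U M {x \<in> verts M. h x \<in> S}"
  obtains \<alpha> where "embedding L M E \<alpha>" "\<forall>x\<in>verts M. h x \<in> S \<longrightarrow> \<alpha> x = f (h x)"
proof -
  have "\<exists>\<alpha>. embedding L M E \<alpha> \<and> (\<forall>x\<in>verts M. h x \<in> S \<longrightarrow> \<alpha> x = f (h x))"
    using assms unfolding completes_def by simp
  then show ?thesis using that by (elim exE conjE)
qed

lemma completableE:
  assumes "completable L U K C n" "S \<subseteq> verts C" "finite S" "card S \<le> n"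
  obtains E f where "E \<in> K" "completes L U K C S E f"
proof -
  have "\<exists>E\<in>K. \<exists>f. completes L U K C S E f" using assms unfolding completable_def by simp
  then show ?thesis using that by (elim bexE exE)
qed

lemma generates_mono: "generates L U M X \<Longrightarrow> X \<subseteq> Y \<Longrightarrow> generates L U M Y"
  unfolding generates_def by (meson subset_trans)

lemma closed_vimage:
  assumes h: "homomorphism L M Q h" and M: "is_structure L M" and X: "is_closed L U Q X"
  shows "is_closed L U M {x \<in> verts M. h x \<in> X}"
  unfolding is_closed_def
proof (intro conjI allI impI)
  fix t y assume t: "rule L U M t y \<and> set t \<subseteq> {x \<in> verts M. h x \<in> X}"
  then have "rule L U M t y" by simp
  then have "rule L U Q (map h t) (h y)" by (rule hom_rule[OF h])
  moreover have "set (map h t) \<subseteq> X" using t by auto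
  ultimately have "h y \<in> X" by (rule closedD[OF X])
  then show "y \<in> {x \<in> verts M. h x \<in> X}" using rule_verts[OF M \<open>rule L U M t y\<close>] by simp
qed blast

lemma embedding_factor:
  assumes h: "embedding L M Q h" and j: "embedding L P Q j" and sub: "h ` verts M \<subseteq> j ` verts P"
    and st: "is_structure L M" "is_structure L P" "is_structure L Q"
  shows "embedding L M P (inv_into (verts P) j \<circ> h)"
    "\<And>x. x \<in> verts M \<Longrightarrow> j ((inv_into (verts P) j \<circ> h) x) = h x"
proof -
  show eq: "j ((inv_into (verts P) j \<circ> h) x) = h x" if "x \<in> verts M" for x
  proof -
    have "h x \<in> j ` verts P" using sub that by blast
    then show ?thesis by (simp add: f_inv_into_f)
  qed
  have "embedding L M Q (j \<circ> (inv_into (verts P) j \<circ> h))"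
    by (rule embedding_cong[OF h _ st(1,3)]) (use eq in simp)
  then show "embedding L M P (inv_into (verts P) j \<circ> h)"
  proof (rule embedding_reflect[OF _ j _ st])
    show "(inv_into (verts P) j \<circ> h) ` verts M \<subseteq> verts P"
      using sub by (auto intro!: inv_into_into)
  qed
qed

lemma irreducible_in_closure_vertex:
  assumes Q: "is_structure L Q" and x: "x \<in> verts Q"
  shows "irreducible_in L U Q (closure_in L U Q {x})"
proof (rule irreducible_inI[OF Q closed_closure_in[OF Q]])
  fix X1 X2
  assume X: "is_closed L U Q X1" "is_closed L U Q X2" and *: "closure_in L U Q {x} \<subseteq> X1 \<union> X2"
  have "{x} \<subseteq> closure_in L U Q {x}" using x by (intro closure_in_superset) simp
  then have "{x} \<subseteq> X1 \<or> {x} \<subseteq> X2" using * by blast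
  then show "closure_in L U Q {x} \<subseteq> X1 \<or> closure_in L U Q {x} \<subseteq> X2"
    using closure_in_least[OF X(1), of "{x}"] closure_in_least[OF X(2), of "{x}"] by argo
qed

context closure_setting
begin

lemma irreducible_in_push:
  assumes Q: "U_closed L U Q" and P: "U_closed L U P" and Z: "irreducible_in L U Q Z" and p: "embedding L (restr Q Z) P p"
  shows "irreducible_in L U P (p ` Z)" "embedding L (restr Q Z) (restr P (p ` Z)) p"
proof -
  have Zc: "is_closed L U Q Z" "unsplit L U (restr Q Z)" using Z unfolding irreducible_in_def by auto
  have Zu: "U_closed L U (restr Q Z)" by (rule restr_U_closed[OF Q Zc(1)])
  show 1: "irreducible_in L U P (p ` Z)" using irreducible_in_image[OF p Zu P Zc(2)] by simp
  then have "is_closed L U P (p ` Z)" unfolding irreducible_in_def by simp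
  then show "embedding L (restr Q Z) (restr P (p ` Z)) p"
    using embedding_into_restr[OF p U_closed_structure[OF Zu] U_closed_structure[OF P]] by simp
qed

lemma locally_in_trans:
  assumes Q: "U_closed L U Q" and P: "U_closed L U P" and H: "is_structure L H"
    and 1: "locally_in L U Q lQ P lP" and 2: "locally_in L U P lP H lH"
  shows "locally_in L U Q lQ H lH"
  unfolding locally_in_def
proof (intro allI impI)
  fix Z assume Z: "irreducible_in L U Q Z"
  then obtain p where p: "embedding L (restr Q Z) P p" "\<forall>z\<in>Z. lP (p z) = lQ z"
    using 1 unfolding locally_in_def by blast
  note pZ = irreducible_in_push[OF Q P Z p(1)]
  obtain q where q: "embedding L (restr P (p ` Z)) H q" "\<forall>z\<in>p ` Z. lH (q z) = lP z"
    using 2 pZ(1) unfolding locally_in_def by blast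
  have s: "is_structure L (restr Q Z)" "is_structure L (restr P (p ` Z))"
    using Z pZ(1) restr_structure[OF U_closed_structure[OF Q]] restr_structure[OF U_closed_structure[OF P]]
    unfolding irreducible_in_def by auto
  have "embedding L (restr Q Z) H (q \<circ> p)" by (rule embedding_comp[OF pZ(2) q(1) s H])
  moreover have "\<forall>z\<in>Z. lH ((q \<circ> p) z) = lQ z" using p(2) q(2) by simp
  ultimately show "\<exists>p. embedding L (restr Q Z) H p \<and> (\<forall>z\<in>Z. lH (p z) = lQ z)" by blast
qed

lemma locally_in_refl:
  assumes P: "is_structure L P"
  shows "locally_in L U P lab P lab"
  unfolding locally_in_def irreducible_in_def using restr_embedding[OF P] by (metis id_apply)

text \<open>Being closed, being a homomorphism and being an embedding on irreducible sets all
  concern a single irreducible set at a time, namely the closure of an edge or of a vertex.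
  On such a set the claim is the one for \<open>P\<close>, carried over by the local embedding.\<close>
lemma locally_in_hom_emb_on:
  assumes Q: "U_closed L U Q" and P: "U_closed L U P" and H: "is_structure L H"
    and le: "locally_in L U Q lQ P lP" and ue: "hom_emb_on L U P {x \<in> verts P. lP x \<in> V} H (h \<circ> lP)"
  shows "hom_emb_on L U Q {x \<in> verts Q. lQ x \<in> V} H (h \<circ> lQ)"
proof -
  note Qs = U_closed_structure[OF Q] and Ps = U_closed_structure[OF P]
  let ?DP = "{x \<in> verts P. lP x \<in> V}" and ?DQ = "{x \<in> verts Q. lQ x \<in> V}"
  have DP: "is_closed L U P ?DP" and hP: "homomorphism L (restr P ?DP) H (h \<circ> lP)"
    and eP: "\<And>Z. irreducible_in L U P Z \<Longrightarrow> Z \<subseteq> ?DP \<Longrightarrow> embedding L (restr P Z) H (h \<circ> lP)"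
    using ue unfolding hom_emb_on_def by auto
  have loc: "\<exists>p. homomorphism L (restr Q Z) P p \<and> (\<forall>z\<in>Z. lP (p z) = lQ z)" if "irreducible_in L U Q Z" for Z
    using le that unfolding locally_in_def by (meson embedding_hom)
  have mem: "p x \<in> ?DP" if "homomorphism L (restr Q Z) P p" "\<forall>z\<in>Z. lP (p z) = lQ z" "x \<in> Z" "x \<in> ?DQ" for p Z x
    using hom_verts[OF that(1)] that(2-4) by (simp add: image_subset_iff)
  have mems: "set (map p xs) \<subseteq> ?DP"
    if "homomorphism L (restr Q Z) P p" "\<forall>z\<in>Z. lP (p z) = lQ z" "set xs \<subseteq> Z" "set xs \<subseteq> ?DQ" for p Z xs
  proof
    fix v assume "v \<in> set (map p xs)"
    then obtain x where "x \<in> set xs" "v = p x" by auto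
    then show "v \<in> ?DP" using mem[OF that(1,2), of x] that(3,4) by blast
  qed
  have DQ: "is_closed L U Q ?DQ"
    unfolding is_closed_def
  proof (intro conjI allI impI)
    fix t y assume "rule L U Q t y \<and> set t \<subseteq> ?DQ"
    then have r: "rule L U Q t y" and t: "set t \<subseteq> ?DQ" by auto
    obtain e where e: "edge L Q e" "set t \<subseteq> set e" using rule_edge[OF r] by blast
    let ?Z = "closure_in L U Q (set e)"
    have Zi: "irreducible_in L U Q ?Z" by (rule irreducible_in_closure_edge[OF Qs e(1)])
    then have Zc: "is_closed L U Q ?Z" unfolding irreducible_in_def by simp
    have tZ: "set t \<subseteq> ?Z" using e(2) closure_in_superset[OF edge_verts[OF Qs e(1)]] by blast
    have yZ: "y \<in> ?Z" by (rule closedD[OF Zc r tZ])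
    obtain p where p: "homomorphism L (restr Q ?Z) P p" "\<forall>z\<in>?Z. lP (p z) = lQ z" using loc[OF Zi] by blast
    have "rule L U (restr Q ?Z) t y" using restr_rule[OF Qs Zc subset_refl] r tZ by simp
    then have "rule L U P (map p t) (p y)" by (rule hom_rule[OF p(1)])
    moreover have "set (map p t) \<subseteq> ?DP" by (rule mems[OF p tZ t])
    ultimately have "p y \<in> ?DP" by (rule closedD[OF DP])
    then show "y \<in> ?DQ" using p(2) yZ rule_verts[OF Qs r] by simp
  qed blast
  have "homomorphism L (restr Q ?DQ) H (h \<circ> lQ)"
    unfolding homomorphism_iff
  proof (intro conjI ballI allI impI)
    show "(h \<circ> lQ) ` verts (restr Q ?DQ) \<subseteq> verts H"
    proof
      fix v assume "v \<in> (h \<circ> lQ) ` verts (restr Q ?DQ)"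
      then obtain x where x: "x \<in> ?DQ" "v = h (lQ x)" by auto
      have xv: "x \<in> verts Q" using x by simp
      note Zi = irreducible_in_closure_vertex[OF Qs xv, of U]
      have xZ: "x \<in> closure_in L U Q {x}" using closure_in_superset[of "{x}" Q L U] xv by blast
      obtain p where p: "homomorphism L (restr Q (closure_in L U Q {x})) P p" "\<forall>z\<in>closure_in L U Q {x}. lP (p z) = lQ z"
        using loc[OF Zi] by blast
      have "p x \<in> ?DP" by (rule mem[OF p xZ x(1)])
      then have "(h \<circ> lP) (p x) \<in> verts H" using hom_verts[OF hP] by (simp add: image_subset_iff)
      then show "v \<in> verts H" using p(2) xZ x(2) by simp
    qed
  next
    fix R xs assume R: "R \<in> rels L" and "xs \<in> rel (restr Q ?DQ) R"
    then have xs: "xs \<in> rel Q R" "set xs \<subseteq> ?DQ" by auto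
    then have e: "edge L Q xs" using R unfolding edge_def by blast
    let ?Z = "closure_in L U Q (set xs)"
    have Z: "set xs \<subseteq> ?Z" by (rule closure_in_superset[OF edge_verts[OF Qs e]])
    obtain p where p: "homomorphism L (restr Q ?Z) P p" "\<forall>z\<in>?Z. lP (p z) = lQ z"
      using loc[OF irreducible_in_closure_edge[OF Qs e]] by blast
    have "map p xs \<in> rel P R" by (rule hom_rel[OF p(1) R]) (use xs Z in simp)
    moreover have "set (map p xs) \<subseteq> ?DP" by (rule mems[OF p Z xs(2)])
    ultimately have "map (h \<circ> lP) (map p xs) \<in> rel H R" by (intro hom_rel[OF hP R]) simp
    moreover have "map (h \<circ> lP) (map p xs) = map (h \<circ> lQ) xs" using p(2) Z by auto
    ultimately show "map (h \<circ> lQ) xs \<in> rel H R" by metis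
  next
    fix F xs y assume F: "F \<in> funs L" and "fn (restr Q ?DQ) F xs = Some y"
    then have xs: "fn Q F xs = Some y" "set xs \<subseteq> ?DQ" unfolding restr_simps by (metis option.distinct(1))+
    then have e: "edge L Q xs" using F unfolding edge_def by blast
    let ?Z = "closure_in L U Q (set xs)"
    have Z: "set xs \<subseteq> ?Z" by (rule closure_in_superset[OF edge_verts[OF Qs e]])
    have yZ: "y \<in> ?Z" by (rule closedD[OF closed_closure_in[OF Qs] rule_fnI[OF F xs(1)] Z])
    obtain p where p: "homomorphism L (restr Q ?Z) P p" "\<forall>z\<in>?Z. lP (p z) = lQ z"
      using loc[OF irreducible_in_closure_edge[OF Qs e]] by blast
    have "fn P F (map p xs) = Some (p y)" by (rule hom_fn[OF p(1) F]) (use xs Z in simp)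
    moreover have "set (map p xs) \<subseteq> ?DP" by (rule mems[OF p Z xs(2)])
    ultimately have "fn H F (map (h \<circ> lP) (map p xs)) = Some ((h \<circ> lP) (p y))" by (intro hom_fn[OF hP F]) simp
    moreover have "map (h \<circ> lP) (map p xs) = map (h \<circ> lQ) xs" using p(2) Z by auto
    moreover have "(h \<circ> lP) (p y) = (h \<circ> lQ) y" using p(2) yZ by simp
    ultimately show "fn H F (map (h \<circ> lQ) xs) = Some ((h \<circ> lQ) y)" by metis
  qed
  moreover have "embedding L (restr Q Z) H (h \<circ> lQ)" if Z: "irreducible_in L U Q Z" "Z \<subseteq> ?DQ" for Z
  proof -
    obtain p where p: "embedding L (restr Q Z) P p" "\<forall>z\<in>Z. lP (p z) = lQ z"
      using le Z(1) unfolding locally_in_def by blast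
    note pZ = irreducible_in_push[OF Q P Z(1) p(1)]
    have s: "is_structure L (restr Q Z)" "is_structure L (restr P (p ` Z))"
      using Z(1) pZ(1) restr_structure[OF Qs] restr_structure[OF Ps] unfolding irreducible_in_def by auto
    have "p ` Z \<subseteq> ?DP" using mem[OF embedding_hom[OF p(1)] p(2)] Z(2) by blast
    then have "embedding L (restr P (p ` Z)) H (h \<circ> lP)" by (rule eP[OF pZ(1)])
    from embedding_comp[OF pZ(2) this s H] show ?thesis
      by (rule embedding_cong[OF _ _ s(1) H]) (use p(2) in simp)
  qed
  ultimately show ?thesis unfolding hom_emb_on_def using DQ by simp
qed

text \<open>The vertices of the amalgam form a finite set, which is coded by natural numbers.\<close>
lemma glue_exists:
  fixes Y :: "('r, 'f, 'y) lstruct" and P :: "('r, 'f, 'p) lstruct" and I :: "'i set"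
  assumes "U_closed L U Y" "U_closed L U P" and D: "is_closed L U P D"
    and fin: "finite (verts Y)" "finite (verts P)" "finite I"
    and lam: "\<And>i. i \<in> I \<Longrightarrow> embedding L (restr P D) Y (lam i)"
  shows "\<exists>(a :: 'y \<Rightarrow> nat) J. glue_setting L U Y P D I lam a J"
proof -
  define K where "K = (\<lambda>i x. if x \<in> D then Inl (lam i x) else Inr (i, x) :: 'y + 'i \<times> 'p)"
  define V where "V = Inl ` verts Y \<union> (\<Union>i\<in>I. K i ` verts P)"
  have "finite V" unfolding V_def using fin by simp
  from finite_imp_inj_to_nat_seg[OF this] obtain c :: "('y + 'i \<times> 'p) \<Rightarrow> nat" and n :: nat
    where c: "inj_on c V" by metis
  have Dv: "D \<subseteq> verts P" using D by (rule closed_subset)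
  have lv: "lam i x \<in> verts Y" if "i \<in> I" "x \<in> D" for i x
    using hom_verts[OF embedding_hom[OF lam[OF that(1)]]] that(2) by auto
  have li: "inj_on (lam i) D" if "i \<in> I" for i using lam[OF that] unfolding embedding_def by simp
  have KV: "K i x \<in> V" if "i \<in> I" "x \<in> verts P" for i x unfolding V_def using that by blast
  have YV: "Inl y \<in> V" if "y \<in> verts Y" for y unfolding V_def using that by blast
  have "glue_setting L U Y P D I lam (c \<circ> Inl) (\<lambda>i. c \<circ> K i)"
  proof (unfold_locales)
    show "inj_on (c \<circ> Inl) (verts Y)"
    proof (rule comp_inj_on)
      show "inj_on c (Inl ` verts Y)" using YV by (intro inj_on_subset[OF c]) blast
    qed simp
    show "inj_on (c \<circ> K i) (verts P)" if "i \<in> I" for i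
    proof (rule comp_inj_on)
      show "inj_on (K i) (verts P)"
        unfolding inj_on_def K_def using inj_onD[OF li[OF that]] by simp
      show "inj_on c (K i ` verts P)" using KV[OF that] by (intro inj_on_subset[OF c]) blast
    qed
    show "(c \<circ> K i) x = (c \<circ> Inl) (lam i x)" if "i \<in> I" "x \<in> D" for i x using that by (simp add: K_def)
    show "(c \<circ> K i) x \<notin> (c \<circ> Inl) ` verts Y" if "i \<in> I" "x \<in> verts P" "x \<notin> D" for i x
    proof
      assume "(c \<circ> K i) x \<in> (c \<circ> Inl) ` verts Y"
      then obtain y where y: "y \<in> verts Y" "c (K i x) = c (Inl y)" by auto
      have "K i x = Inl y" by (rule inj_onD[OF c y(2) KV[OF that(1,2)] YV[OF y(1)]])
      then show False using that(3) by (simp add: K_def)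
    qed
    show "(c \<circ> K i) x \<noteq> (c \<circ> K i') x'"
      if *: "i \<in> I" "i' \<in> I" "i \<noteq> i'" "x \<in> verts P" "x \<notin> D" "x' \<in> verts P" for i i' x x'
    proof
      assume "(c \<circ> K i) x = (c \<circ> K i') x'"
      then have "c (K i x) = c (K i' x')" by simp
      then have "K i x = K i' x'" by (rule inj_onD[OF c _ KV[OF *(1,4)] KV[OF *(2,6)]])
      then show False using *(3,5) by (simp add: K_def split: if_splits)
    qed
  qed (use assms in simp_all)
  then show ?thesis by blast
qed

end

context glue_setting
begin

text \<open>The map on the amalgam that is induced by maps on its parts. Vertices shared with \<open>Y\<close>
  get their value from \<open>Y\<close>.\<close>
definition glue_map :: "('y \<Rightarrow> 'b) \<Rightarrow> ('i \<Rightarrow> 'p \<Rightarrow> 'b) \<Rightarrow> 'q \<Rightarrow> 'b" where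
  "glue_map f g z = (if z \<in> a ` verts Y then f (inv_into (verts Y) a z)
     else (THE v. \<exists>i\<in>I. \<exists>x\<in>verts P. z = J i x \<and> v = g i x))"

lemma glue_map_a: "y \<in> verts Y \<Longrightarrow> glue_map f g (a y) = f y"
  unfolding glue_map_def using a_inj by simp

lemma glue_map_J:
  assumes i: "i \<in> I" and x: "x \<in> verts P" and eq: "x \<in> D \<Longrightarrow> g i x = f (lam i x)"
  shows "glue_map f g (J i x) = g i x"
proof (cases "x \<in> D")
  case True
  then show ?thesis using glue_map_a[OF lam_verts[OF i True]] J_D[OF i True] eq by simp
next
  case False
  have "(THE v. \<exists>i'\<in>I. \<exists>x'\<in>verts P. J i x = J i' x' \<and> v = g i' x') = g i x"
  proof (rule the_equality)
    show "\<exists>i'\<in>I. \<exists>x'\<in>verts P. J i x = J i' x' \<and> g i x = g i' x'" using i x by blast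
    fix v assume "\<exists>i'\<in>I. \<exists>x'\<in>verts P. J i x = J i' x' \<and> v = g i' x'"
    then obtain i' x' where *: "i' \<in> I" "x' \<in> verts P" "J i x = J i' x'" "v = g i' x'" by blast
    have "i = i'" using J_J[OF i *(1) _ x False *(2)] *(3) by blast
    moreover have "x = x'" using inj_onD[OF J_inj[OF i]] x * \<open>i = i'\<close> by blast
    ultimately show "v = g i x" using * by simp
  qed
  then show ?thesis unfolding glue_map_def using J_a[OF i x False] by simp
qed

end

section \<open>The partite construction over charts\<close>

locale class_setting = closure_setting L U for L :: "('r, 'f) lang" and U +
  fixes K :: "('r, 'f, nat) lstruct set"
  assumes K_iso: "A \<in> K \<Longrightarrow> is_structure L B \<Longrightarrow> isomorphic L A B \<Longrightarrow> B \<in> K"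
    and K_finite: "A \<in> K \<Longrightarrow> finite (verts A)"
    and K_closed: "A \<in> K \<Longrightarrow> U_closed L U A"
    and K_irr: "A \<in> K \<Longrightarrow> irreducible_structure L A"
    and K_restr: "A \<in> K \<Longrightarrow> is_closed L U A X \<Longrightarrow> restr A X \<in> K"
    and K_amalg: "A \<in> K \<Longrightarrow> B1 \<in> K \<Longrightarrow> B2 \<in> K \<Longrightarrow> embedding L A B1 \<alpha>1 \<Longrightarrow> embedding L A B2 \<alpha>2 \<Longrightarrow>
      \<exists>C\<in>K. \<exists>\<beta>1 \<beta>2. embedding L B1 C \<beta>1 \<and> embedding L B2 C \<beta>2 \<and> (\<forall>x\<in>verts A. \<beta>1 (\<alpha>1 x) = \<beta>2 (\<alpha>2 x))"
begin

lemma K_structure: "A \<in> K \<Longrightarrow> is_structure L A"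
  using K_closed U_closed_structure by blast

lemma K_unsplit: "A \<in> K \<Longrightarrow> unsplit L {} A"
  using K_irr irreducible_unsplit by blast

end

text \<open>One step of the construction for the copies of \<open>A\<close> over a single projection \<open>w\<close>: the
  set \<open>D\<close> of vertices labelled in \<open>w(A)\<close> with its map \<open>\<rho>\<close> to \<open>A\<close>, and copies of \<open>P\<close> glued to
  the fibre power of \<open>D\<close> along the maps \<open>lam i\<close>, which commute with the projections to \<open>A\<close>.\<close>
locale fibre_power_gluing = class_setting L U K +
    pw: fibre_power_setting L U P D A \<rho> N +
    gl: glue_setting L U "fibre_power N D \<rho> P" P D I lam a J
  for L :: "('r, 'f) lang" and U and K and P :: "('r, 'f, nat) lstruct" and D and A :: "('r, 'f, nat) lstruct"
    and \<rho> N and I :: "'i set" and lam and a :: "nat list \<Rightarrow> nat" and J +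
  fixes lab :: "nat \<Rightarrow> 'l" and w :: "nat \<Rightarrow> 'l"
  assumes AK: "A \<in> K"
    and lab_D: "x \<in> D \<Longrightarrow> lab x = w (\<rho> x)"
    and lam_rho: "i \<in> I \<Longrightarrow> x \<in> D \<Longrightarrow> \<rho> (lam i x ! 0) = \<rho> x"
begin

definition lab' :: "nat \<Rightarrow> 'l" where
  "lab' = gl.glue_map (\<lambda>y. lab (y ! 0)) (\<lambda>i. lab)"

lemma lab'_a: "y \<in> verts pw.Y \<Longrightarrow> lab' (a y) = lab (y ! 0)"
  unfolding lab'_def by (rule gl.glue_map_a)

lemma lab'_J: "i \<in> I \<Longrightarrow> x \<in> verts P \<Longrightarrow> lab' (J i x) = lab x"
proof -
  assume i: "i \<in> I" and x: "x \<in> verts P"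
  have "lab x = lab (lam i x ! 0)" if "x \<in> D"
    using lab_D[OF that] lab_D[OF pw.Y_nth[OF gl.lam_verts[OF i that] pw.N]] lam_rho[OF i that] by simp
  then show ?thesis unfolding lab'_def by (intro gl.glue_map_J[OF i x])
qed

text \<open>An irreducible set lies in a copy of \<open>P\<close> or in the fibre power; from the latter one
  coordinate projects to \<open>P\<close>, preserving the label because all coordinates have the same
  one.\<close>
lemma locally_in_step: "locally_in L U gl.Q lab' P lab"
  unfolding locally_in_def
proof (intro allI impI)
  fix Z assume "irreducible_in L U gl.Q Z"
  then have Zc: "is_closed L U gl.Q Z" and Zu: "unsplit L U (restr gl.Q Z)" unfolding irreducible_in_def by auto
  note Zs = restr_structure[OF gl.Q_structure Zc] and Ze = restr_embedding[OF gl.Q_structure Zc]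
  have "id ` verts (restr gl.Q Z) \<subseteq> a ` verts pw.Y \<or> (\<exists>i\<in>I. id ` verts (restr gl.Q Z) \<subseteq> J i ` verts P)"
    by (rule gl.unsplit_image_cases[OF Zu subset_refl embedding_hom[OF Ze]])
  then show "\<exists>p. embedding L (restr gl.Q Z) P p \<and> (\<forall>z\<in>Z. lab (p z) = lab' z)"
  proof (elim disjE bexE)
    assume sub: "id ` verts (restr gl.Q Z) \<subseteq> a ` verts pw.Y"
    note f = embedding_factor[OF Ze gl.a_embedding sub Zs pw.Y_structure gl.Q_structure]
    let ?h = "inv_into (verts pw.Y) a \<circ> id"
    have "embedding L (restr gl.Q Z) P (\<lambda>x. ?h x ! 0)"
      by (rule pw.proj_embedding[OF Zu subset_refl f(1) pw.N])
    moreover have "lab (?h z ! 0) = lab' z" if "z \<in> Z" for z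
    proof -
      have "?h z \<in> verts pw.Y" using hom_verts[OF embedding_hom[OF f(1)]] that by (simp add: image_subset_iff)
      then have "lab' (a (?h z)) = lab (?h z ! 0)" by (rule lab'_a)
      then show ?thesis using f(2)[of z] that by simp
    qed
    ultimately show ?thesis by blast
  next
    fix i assume i: "i \<in> I" and sub: "id ` verts (restr gl.Q Z) \<subseteq> J i ` verts P"
    note f = embedding_factor[OF Ze gl.J_embedding[OF i] sub Zs gl.Ps gl.Q_structure]
    let ?h = "inv_into (verts P) (J i) \<circ> id"
    have "lab (?h z) = lab' z" if "z \<in> Z" for z
    proof -
      have "?h z \<in> verts P" using hom_verts[OF embedding_hom[OF f(1)]] that by (simp add: image_subset_iff)
      then have "lab' (J i (?h z)) = lab (?h z)" by (rule lab'_J[OF i])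
      then show ?thesis using f(2)[of z] that by simp
    qed
    then show ?thesis using f(1) by blast
  qed
qed

text \<open>Copies are closed sets, so that with the generators they contain everything generated.\<close>
lemma generated_image_in_copy:
  fixes S :: "nat set" and E :: "('r, 'f, nat) lstruct" and f :: "nat \<Rightarrow> nat"
  assumes i: "i \<in> I" and S: "S \<subseteq> J i ` verts P" and M: "M \<in> K" and h: "embedding L M gl.Q h"
    and g: "generates L U M {x \<in> verts M. h x \<in> S}"
  shows "h ` verts M \<subseteq> J i ` verts P"
proof -
  have "is_closed L U M {x \<in> verts M. h x \<in> J i ` verts P}"
    by (rule closed_vimage[OF embedding_hom[OF h] K_structure[OF M] gl.closed_J[OF i]])
  moreover have "{x \<in> verts M. h x \<in> S} \<subseteq> {x \<in> verts M. h x \<in> J i ` verts P}" using S by blast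
  ultimately have "verts M \<subseteq> {x \<in> verts M. h x \<in> J i ` verts P}" using g unfolding generates_def by blast
  then show ?thesis by blast
qed

text \<open>The inductive core. Either \<open>S\<close> lies in one copy of \<open>P\<close>, and a completion in \<open>P\<close> can be
  used. Or each copy has at most \<open>n\<close> vertices of \<open>S\<close>; their images in the base \<open>G\<close> are
  completed there. One then collects the completions of all copies in a single \<open>E\<close> into
  which also \<open>A\<close> is embedded, by an embedding \<open>\<alpha>\<close> that agrees on \<open>D\<close> with all of them. This
  \<open>\<alpha>\<close> takes care of the fibre power, whose members of the class project to \<open>A\<close>.\<close>
lemma completable_step:
  fixes G :: "('r, 'f, nat) lstruct" and gm :: "'l \<Rightarrow> nat"
  assumes Gs: "is_structure L G" and ue: "hom_emb_on L U P (verts P) G (gm \<circ> lab)"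
    and gA: "embedding L A G (gm \<circ> w)"
    and CG: "completable L U K G n" and CP: "completable L U K P (Suc n)"
  shows "completable L U K gl.Q (Suc n)"
  unfolding completable_def
proof (intro allI impI)
  fix S assume S: "S \<subseteq> verts gl.Q \<and> finite S \<and> card S \<le> Suc n"
  let ?\<gamma> = "gm \<circ> lab"
  define Si where "Si i = {x \<in> verts P. J i x \<in> S}" for i
  have Si_fin: "finite (Si i)" for i unfolding Si_def using gl.Pf by simp
  have JSi: "J i ` Si i = S \<inter> J i ` verts P" for i unfolding Si_def by blast
  have card_Si: "card (Si i) = card (S \<inter> J i ` verts P)" if "i \<in> I" for i
  proof -
    have "inj_on (J i) (Si i)" using gl.J_inj[OF that] by (rule inj_on_subset) (auto simp: Si_def)
    from card_image[OF this] show ?thesis unfolding JSi by simp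
  qed
  show "\<exists>E\<in>K. \<exists>f. completes L U K gl.Q S E f"
  proof (cases "\<exists>i\<in>I. S \<subseteq> J i ` verts P")
    case True
    then obtain i where i: "i \<in> I" "S \<subseteq> J i ` verts P" by blast
    have "S \<inter> J i ` verts P = S" using i(2) by blast
    then have ci: "card (Si i) \<le> Suc n" using card_Si[OF i(1)] S by simp
    have vi: "Si i \<subseteq> verts P" unfolding Si_def by blast
    obtain E f where E: "E \<in> K" "completes L U K P (Si i) E f"
      by (rule completableE[OF CP vi Si_fin ci])
    have "completes L U K gl.Q S E (f \<circ> inv_into (verts P) (J i))"
    proof (rule completesI)
      fix M h assume M: "M \<in> K" and h: "embedding L M gl.Q h" and g: "generates L U M {x \<in> verts M. h x \<in> S}"
      note sub = generated_image_in_copy[OF i M h g]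
      note fac = embedding_factor[OF h gl.J_embedding[OF i(1)] sub K_structure[OF M] gl.Ps gl.Q_structure]
      let ?h = "inv_into (verts P) (J i) \<circ> h"
      have eq: "?h x \<in> Si i \<longleftrightarrow> h x \<in> S" if "x \<in> verts M" for x
        using fac(2)[OF that] hom_verts[OF embedding_hom[OF fac(1)]] that unfolding Si_def
        by (simp add: image_subset_iff)
      then have "{x \<in> verts M. ?h x \<in> Si i} = {x \<in> verts M. h x \<in> S}" by blast
      then have gi: "generates L U M {x \<in> verts M. ?h x \<in> Si i}" using g by simp
      obtain \<alpha> where \<alpha>: "embedding L M E \<alpha>" "\<forall>x\<in>verts M. ?h x \<in> Si i \<longrightarrow> \<alpha> x = f (?h x)"
        by (rule completesE[OF E(2) M fac(1) gi])
      have "\<alpha> x = (f \<circ> inv_into (verts P) (J i)) (h x)" if "x \<in> verts M" "h x \<in> S" for x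
        using \<alpha>(2) eq[OF that(1)] that by simp
      then show "\<exists>\<alpha>. embedding L M E \<alpha> \<and> (\<forall>x\<in>verts M. h x \<in> S \<longrightarrow> \<alpha> x = (f \<circ> inv_into (verts P) (J i)) (h x))"
        using \<alpha>(1) by blast
    qed
    then show ?thesis using E(1) by blast
  next
    case False
    have small: "card (Si i) \<le> n" if "i \<in> I" for i
    proof -
      have "S \<inter> J i ` verts P \<subset> S" using False that by blast
      then have "card (S \<inter> J i ` verts P) < card S" using S by (intro psubset_card_mono) auto
      then show ?thesis using card_Si[OF that] S by simp
    qed
    \<comment> \<open>The completion of the \<open>i\<close>-th copy by \<open>f\<close> agrees with \<open>\<alpha>\<close> on the part shared with the
      fibre power.\<close>
    define ok where "ok E \<alpha> i f \<longleftrightarrow> (\<forall>x\<in>D. J i x \<in> S \<longrightarrow> f x = \<alpha> (\<rho> x)) \<and> completes L U K P (Si i) E f"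
      for E \<alpha> i and f :: "nat \<Rightarrow> nat"
    \<comment> \<open>Completions survive an enlargement of their target, so that copies can be added one at a
      time.\<close>
    have ok_push: "ok E' (b \<circ> \<alpha>) i (b \<circ> f)"
      if ok: "ok E \<alpha> i f" and E: "E \<in> K" "E' \<in> K" "embedding L E E' b" for E E' \<alpha> i f b
      unfolding ok_def
    proof (intro conjI ballI impI completesI)
      show "(b \<circ> f) x = (b \<circ> \<alpha>) (\<rho> x)" if "x \<in> D" "J i x \<in> S" for x
        using ok that unfolding ok_def by simp
      fix M h assume M: "M \<in> K" and h: "embedding L M P h" "generates L U M {x \<in> verts M. h x \<in> Si i}"
      obtain \<beta> where \<beta>: "embedding L M E \<beta>" "\<forall>x\<in>verts M. h x \<in> Si i \<longrightarrow> \<beta> x = f (h x)"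
        by (rule completesE[OF conjunct2[OF ok[unfolded ok_def]] M h])
      have "embedding L M E' (b \<circ> \<beta>)"
        by (rule embedding_comp[OF \<beta>(1) E(3) K_structure[OF M] K_structure[OF E(1)] K_structure[OF E(2)]])
      then show "\<exists>\<beta>. embedding L M E' \<beta> \<and> (\<forall>x\<in>verts M. h x \<in> Si i \<longrightarrow> \<beta> x = (b \<circ> f) (h x))"
        using \<beta>(2) by (intro exI[of _ "b \<circ> \<beta>"]) simp
    qed
    have As: "is_structure L A" by (rule K_structure[OF AK])
    have "\<exists>E\<in>K. \<exists>\<alpha> f. embedding L A E \<alpha> \<and> (\<forall>i\<in>I'. ok E \<alpha> i (f i))" if "finite I'" "I' \<subseteq> I" for I'
      using that
    proof (induction I' rule: finite_induct)
      case empty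
      have "embedding L A A id" using restr_embedding[OF As closed_verts[OF As, of U]] restr_verts[OF As] by simp
      then show ?case using AK by blast
    next
      case (insert i I')
      then obtain E \<alpha> f where E: "E \<in> K" "embedding L A E \<alpha>" "\<forall>j\<in>I'. ok E \<alpha> j (f j)"
        using insert.IH insert.prems by (auto elim!: bexE)
      have i: "i \<in> I" using insert.prems by simp
      let ?S = "?\<gamma> ` Si i"
      have vS: "?S \<subseteq> verts G"
      proof -
        have "homomorphism L (restr P (verts P)) G ?\<gamma>" using ue unfolding hom_emb_on_def by simp
        from hom_verts[OF this] show ?thesis unfolding Si_def by auto
      qed
      have fS: "finite ?S" using Si_fin by simp
      have cS: "card ?S \<le> n" using card_image_le[OF Si_fin, of ?\<gamma> i] small[OF i] by linarith
      obtain Ei fi where Ei: "Ei \<in> K" "completes L U K G ?S Ei fi"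
        by (rule completableE[OF CG vS fS cS])
      have \<gamma>D: "?\<gamma> x = (gm \<circ> w) (\<rho> x)" if "x \<in> D" for x using lab_D[OF that] by simp
      let ?X = "\<rho> ` (Si i \<inter> D)"
      have rv: "?X \<subseteq> verts A" using hom_verts[OF pw.hom_rho] by auto
      \<comment> \<open>The substructure of \<open>A\<close> over which the next completion is amalgamated: generated by the
        vertices that the \<open>i\<close>-th copy shares with \<open>D\<close>.\<close>
      let ?A = "closure_in L U A ?X"
      have Ac: "is_closed L U A ?A" by (rule closed_closure_in[OF As])
      have MA: "restr A ?A \<in> K" by (rule K_restr[OF AK Ac])
      have XA: "?X \<subseteq> ?A" by (rule closure_in_superset[OF rv])
      have gAr: "embedding L (restr A ?A) G (gm \<circ> w)" by (rule embedding_restr[OF gA As Gs Ac])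
      have genA: "generates L U (restr A ?A) {x \<in> verts (restr A ?A). (gm \<circ> w) x \<in> ?S}"
        unfolding generates_def
      proof (intro allI impI)
        fix Y assume Y: "is_closed L U (restr A ?A) Y \<and> {x \<in> verts (restr A ?A). (gm \<circ> w) x \<in> ?S} \<subseteq> Y"
        have "?X \<subseteq> Y"
        proof
          fix v assume v: "v \<in> ?X"
          then obtain x where x: "x \<in> Si i" "x \<in> D" "v = \<rho> x" by blast
          have "(gm \<circ> w) v = ?\<gamma> x" using \<gamma>D[OF x(2)] x(3) by simp
          then have "(gm \<circ> w) v \<in> ?S" using x(1) by (metis imageI)
          moreover have "v \<in> verts (restr A ?A)" using v XA by auto
          ultimately show "v \<in> Y" using Y by blast
        qed
        moreover have "is_closed L U A Y" using Y restr_closed[OF As Ac] by simp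
        ultimately show "verts (restr A ?A) \<subseteq> Y" by (simp add: closure_in_least)
      qed
      obtain \<beta>0 where \<beta>0: "embedding L (restr A ?A) Ei \<beta>0"
        "\<forall>x\<in>verts (restr A ?A). (gm \<circ> w) x \<in> ?S \<longrightarrow> \<beta>0 x = fi ((gm \<circ> w) x)"
        by (rule completesE[OF Ei(2) MA gAr genA])
      have \<alpha>A: "embedding L (restr A ?A) E \<alpha>" by (rule embedding_restr[OF E(2) As K_structure[OF E(1)] Ac])
      obtain E2 b1 b2 where E2: "E2 \<in> K" "embedding L E E2 b1" "embedding L Ei E2 b2"
        "\<forall>x\<in>verts (restr A ?A). b1 (\<alpha> x) = b2 (\<beta>0 x)"
        using K_amalg[OF MA E(1) Ei(1) \<alpha>A \<beta>0(1)] by blast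
      define f2 where "f2 = (\<lambda>j. if j = i then b2 \<circ> fi \<circ> ?\<gamma> else b1 \<circ> f j)"
      have "embedding L A E2 (b1 \<circ> \<alpha>)"
        by (rule embedding_comp[OF E(2) E2(2) As K_structure[OF E(1)] K_structure[OF E2(1)]])
      moreover have "ok E2 (b1 \<circ> \<alpha>) j (f2 j)" if "j \<in> I'" for j
      proof -
        have "j \<noteq> i" using that insert.hyps by blast
        then show ?thesis using ok_push[OF bspec[OF E(3) that] E(1) E2(1,2)] unfolding f2_def by simp
      qed
      moreover have "ok E2 (b1 \<circ> \<alpha>) i (f2 i)"
        unfolding ok_def
      proof (intro conjI ballI impI completesI)
        fix x assume x: "x \<in> D" "J i x \<in> S"
        have xS: "x \<in> Si i" unfolding Si_def using x gl.D_sub by blast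
        have rA: "\<rho> x \<in> verts (restr A ?A)" using XA x(1) xS by auto
        have rS: "(gm \<circ> w) (\<rho> x) \<in> ?S" using \<gamma>D[OF x(1)] xS by (metis imageI)
        have "b1 (\<alpha> (\<rho> x)) = b2 (\<beta>0 (\<rho> x))" using E2(4) rA by (rule bspec)
        also have "\<beta>0 (\<rho> x) = fi ((gm \<circ> w) (\<rho> x))" using bspec[OF \<beta>0(2) rA] rS by (rule mp)
        finally have "b1 (\<alpha> (\<rho> x)) = b2 (fi ((gm \<circ> w) (\<rho> x)))" .
        then show "f2 i x = (b1 \<circ> \<alpha>) (\<rho> x)" unfolding f2_def using \<gamma>D[OF x(1)] by simp
      next
        fix M h assume M: "M \<in> K" and h: "embedding L M P h" and hg: "generates L U M {x \<in> verts M. h x \<in> Si i}"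
        have hv: "h ` verts M \<subseteq> verts P" by (rule hom_verts[OF embedding_hom[OF h]])
        obtain Z where Z: "irreducible_in L U P Z" "Z \<subseteq> verts P" "h ` verts M \<subseteq> Z" "embedding L (restr P Z) G ?\<gamma>"
          by (rule hom_emb_on_embedding[OF ue gl.Ps K_unsplit[OF M] empty_subsetI embedding_hom[OF h] hv])
        have Zc: "is_closed L U P Z" using Z(1) unfolding irreducible_in_def by simp
        have hG: "embedding L M G (?\<gamma> \<circ> h)"
          by (rule embedding_comp[OF embedding_into_restr[OF h K_structure[OF M] gl.Ps Zc Z(3)] Z(4)
            K_structure[OF M] restr_structure[OF gl.Ps Zc] Gs])
        have gG: "generates L U M {x \<in> verts M. (?\<gamma> \<circ> h) x \<in> ?S}"
          by (rule generates_mono[OF hg]) auto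
        obtain \<beta> where \<beta>: "embedding L M Ei \<beta>"
          "\<forall>x\<in>verts M. (?\<gamma> \<circ> h) x \<in> ?S \<longrightarrow> \<beta> x = fi ((?\<gamma> \<circ> h) x)"
          by (rule completesE[OF Ei(2) M hG gG])
        have "embedding L M E2 (b2 \<circ> \<beta>)"
          by (rule embedding_comp[OF \<beta>(1) E2(3) K_structure[OF M] K_structure[OF Ei(1)] K_structure[OF E2(1)]])
        then show "\<exists>\<beta>. embedding L M E2 \<beta> \<and> (\<forall>x\<in>verts M. h x \<in> Si i \<longrightarrow> \<beta> x = f2 i (h x))"
          using \<beta>(2) by (intro exI[of _ "b2 \<circ> \<beta>"]) (simp add: f2_def)
      qed
      ultimately have "embedding L A E2 (b1 \<circ> \<alpha>) \<and> (\<forall>j\<in>insert i I'. ok E2 (b1 \<circ> \<alpha>) j (f2 j))" by blast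
      then show ?case using E2(1) by blast
    qed
    from this[OF gl.If subset_refl] obtain E \<alpha> f where E: "E \<in> K" "embedding L A E \<alpha>"
      and ok_all: "\<forall>i\<in>I. ok E \<alpha> i (f i)" by (elim bexE exE conjE)
    note ok = bspec[OF ok_all]
    \<comment> \<open>The maps on the parts agree on shared vertices in \<open>S\<close>; the default value \<open>0\<close> makes them
      agree on all shared vertices.\<close>
    define f' where "f' = gl.glue_map (\<lambda>y. if a y \<in> S then \<alpha> (\<rho> (y ! 0)) else 0) (\<lambda>i x. if J i x \<in> S then f i x else 0)"
    have f'J: "f' (J i x) = f i x" if "i \<in> I" "x \<in> Si i" for i x
    proof -
      have x: "x \<in> verts P" "J i x \<in> S" using that(2) unfolding Si_def by auto
      have "f' (J i x) = (if J i x \<in> S then f i x else 0)"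
        unfolding f'_def
      proof (rule gl.glue_map_J[OF that(1) x(1)])
        assume xD: "x \<in> D"
        have "f i x = \<alpha> (\<rho> x)" using ok[OF that(1)] xD x(2) unfolding ok_def by blast
        then show "(if J i x \<in> S then f i x else 0) = (if a (lam i x) \<in> S then \<alpha> (\<rho> (lam i x ! 0)) else 0)"
          using gl.J_D[OF that(1) xD] lam_rho[OF that(1) xD] by simp
      qed
      then show ?thesis using x(2) by simp
    qed
    have f'a: "f' (a y) = \<alpha> (\<rho> (y ! 0))" if "y \<in> verts pw.Y" "a y \<in> S" for y
      unfolding f'_def gl.glue_map_a[OF that(1)] using that(2) by simp
    have "completes L U K gl.Q S E f'"
    proof (rule completesI)
      fix M h assume M: "M \<in> K" and h: "embedding L M gl.Q h" and g: "generates L U M {x \<in> verts M. h x \<in> S}"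
      have "h ` verts M \<subseteq> a ` verts pw.Y \<or> (\<exists>i\<in>I. h ` verts M \<subseteq> J i ` verts P)"
        by (rule gl.unsplit_image_cases[OF K_unsplit[OF M] empty_subsetI embedding_hom[OF h]])
      then show "\<exists>\<alpha>. embedding L M E \<alpha> \<and> (\<forall>x\<in>verts M. h x \<in> S \<longrightarrow> \<alpha> x = f' (h x))"
      proof (elim disjE bexE)
        assume sub: "h ` verts M \<subseteq> a ` verts pw.Y"
        note fac = embedding_factor[OF h gl.a_embedding sub K_structure[OF M] pw.Y_structure gl.Q_structure]
        let ?h = "inv_into (verts pw.Y) a \<circ> h"
        have r: "embedding L M A (\<lambda>x. \<rho> (?h x ! 0))" by (rule pw.rho_embedding[OF K_unsplit[OF M] empty_subsetI fac(1)])
        have "embedding L M E (\<alpha> \<circ> (\<lambda>x. \<rho> (?h x ! 0)))"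
          by (rule embedding_comp[OF r E(2) K_structure[OF M] As K_structure[OF E(1)]])
        moreover have "(\<alpha> \<circ> (\<lambda>x. \<rho> (?h x ! 0))) x = f' (h x)" if "x \<in> verts M" "h x \<in> S" for x
        proof -
          have "?h x \<in> verts pw.Y" using hom_verts[OF embedding_hom[OF fac(1)]] that(1) by (simp add: image_subset_iff)
          then show ?thesis using f'a[of "?h x"] fac(2)[OF that(1)] that(2) by simp
        qed
        ultimately show ?thesis by blast
      next
        fix i assume i: "i \<in> I" and sub: "h ` verts M \<subseteq> J i ` verts P"
        note fac = embedding_factor[OF h gl.J_embedding[OF i] sub K_structure[OF M] gl.Ps gl.Q_structure]
        let ?h = "inv_into (verts P) (J i) \<circ> h"
        have eq: "?h x \<in> Si i \<longleftrightarrow> h x \<in> S" if "x \<in> verts M" for x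
          using fac(2)[OF that] hom_verts[OF embedding_hom[OF fac(1)]] that unfolding Si_def
          by (simp add: image_subset_iff)
        then have "{x \<in> verts M. ?h x \<in> Si i} = {x \<in> verts M. h x \<in> S}" by blast
        then have gi: "generates L U M {x \<in> verts M. ?h x \<in> Si i}" using g by simp
        obtain \<beta> where \<beta>: "embedding L M E \<beta>" "\<forall>x\<in>verts M. ?h x \<in> Si i \<longrightarrow> \<beta> x = f i (?h x)"
          by (rule completesE[OF conjunct2[OF ok[OF i, unfolded ok_def]] M fac(1) gi])
        have "\<beta> x = f' (h x)" if "x \<in> verts M" "h x \<in> S" for x
        proof -
          have "?h x \<in> Si i" using eq that by blast
          then have "f' (J i (?h x)) = f i (?h x)" by (rule f'J[OF i])
          then show ?thesis using \<beta>(2) \<open>?h x \<in> Si i\<close> fac(2)[OF that(1)] that(1) by simp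
        qed
        then show ?thesis using \<beta>(1) by blast
      qed
    qed
    then show ?thesis using E(1) by blast
  qed
qed

end

text \<open>For every colouring, \<open>P\<close> has a copy in \<open>Q\<close> with the same labels in which the colour of
  a copy of \<open>A\<close> over \<open>w \<in> W\<close> depends on \<open>w\<close> only.\<close>
definition uniform_copies :: "('r, 'f) lang \<Rightarrow> nat \<Rightarrow> ('r, 'f, nat) lstruct \<Rightarrow> (nat \<Rightarrow> 'l) set
    \<Rightarrow> ('r, 'f, nat) lstruct \<Rightarrow> (nat \<Rightarrow> 'l) \<Rightarrow> ('r, 'f, nat) lstruct \<Rightarrow> (nat \<Rightarrow> 'l) \<Rightarrow> bool" where
  "uniform_copies L k A W P lab Q lab' \<longleftrightarrow>
     (\<forall>\<chi> :: nat set \<Rightarrow> nat. (\<forall>X. \<chi> X < k) \<longrightarrow>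
        (\<exists>j. embedding L P Q j \<and> (\<forall>x\<in>verts P. lab' (j x) = lab x) \<and>
           (\<forall>w\<in>W. \<exists>c. \<forall>e. embedding L A P e \<and> (\<forall>x\<in>verts A. lab (e x) = w x) \<longrightarrow> \<chi> (j ` e ` verts A) = c)))"

lemma uniform_copiesI:
  assumes "\<And>\<chi> :: nat set \<Rightarrow> nat. (\<And>X. \<chi> X < k) \<Longrightarrow>
        \<exists>j. embedding L P Q j \<and> (\<forall>x\<in>verts P. lab' (j x) = lab x) \<and>
           (\<forall>w\<in>W. \<exists>c. \<forall>e. embedding L A P e \<and> (\<forall>x\<in>verts A. lab (e x) = w x) \<longrightarrow> \<chi> (j ` e ` verts A) = c)"
  shows "uniform_copies L k A W P lab Q lab'"
  unfolding uniform_copies_def using assms by simp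

lemma uniform_copiesE:
  fixes \<chi> :: "nat set \<Rightarrow> nat"
  assumes "uniform_copies L k A W P lab Q lab'" "\<And>X. \<chi> X < k"
  obtains j where "embedding L P Q j" "\<forall>x\<in>verts P. lab' (j x) = lab x"
    "\<forall>w\<in>W. \<exists>c. \<forall>e. embedding L A P e \<and> (\<forall>x\<in>verts A. lab (e x) = w x) \<longrightarrow> \<chi> (j ` e ` verts A) = c"
proof -
  have "\<exists>j. embedding L P Q j \<and> (\<forall>x\<in>verts P. lab' (j x) = lab x) \<and>
           (\<forall>w\<in>W. \<exists>c. \<forall>e. embedding L A P e \<and> (\<forall>x\<in>verts A. lab (e x) = w x) \<longrightarrow> \<chi> (j ` e ` verts A) = c)"
    using assms unfolding uniform_copies_def by simp
  then show ?thesis using that by (elim exE conjE)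
qed

lemma uniform_copies_trans:
  assumes 1: "uniform_copies L k A W1 P lP Q lQ" and 2: "uniform_copies L k A W2 Q lQ H lH"
    and st: "is_structure L A" "is_structure L P" "is_structure L Q" "is_structure L H"
  shows "uniform_copies L k A (W1 \<union> W2) P lP H lH"
proof (rule uniform_copiesI)
  fix \<chi> :: "nat set \<Rightarrow> nat" assume \<chi>: "\<And>X. \<chi> X < k"
  obtain j2 where j2: "embedding L Q H j2" "\<forall>x\<in>verts Q. lH (j2 x) = lQ x"
    "\<forall>w\<in>W2. \<exists>c. \<forall>e. embedding L A Q e \<and> (\<forall>x\<in>verts A. lQ (e x) = w x) \<longrightarrow> \<chi> (j2 ` e ` verts A) = c"
    by (rule uniform_copiesE[OF 2 \<chi>])
  obtain j1 where j1: "embedding L P Q j1" "\<forall>x\<in>verts P. lQ (j1 x) = lP x"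
    "\<forall>w\<in>W1. \<exists>c. \<forall>e. embedding L A P e \<and> (\<forall>x\<in>verts A. lP (e x) = w x) \<longrightarrow> \<chi> (j2 ` (j1 ` e ` verts A)) = c"
    by (rule uniform_copiesE[OF 1, of "\<lambda>X. \<chi> (j2 ` X)"]) (rule \<chi>)
  have jv: "j1 x \<in> verts Q" if "x \<in> verts P" for x
    using hom_verts[OF embedding_hom[OF j1(1)]] that by blast
  have "\<exists>c. \<forall>e. embedding L A P e \<and> (\<forall>x\<in>verts A. lP (e x) = w x) \<longrightarrow> \<chi> ((j2 \<circ> j1) ` e ` verts A) = c"
    if w: "w \<in> W1 \<union> W2" for w
  proof (cases "w \<in> W1")
    case True
    then show ?thesis using j1(3) by (simp add: image_comp comp_assoc)
  next
    case False
    then obtain c where c: "\<forall>e. embedding L A Q e \<and> (\<forall>x\<in>verts A. lQ (e x) = w x) \<longrightarrow> \<chi> (j2 ` e ` verts A) = c"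
      using j2(3) w by blast
    have "\<chi> ((j2 \<circ> j1) ` e ` verts A) = c" if e: "embedding L A P e" "\<forall>x\<in>verts A. lP (e x) = w x" for e
    proof -
      have "embedding L A Q (j1 \<circ> e)" by (rule embedding_comp[OF e(1) j1(1) st(1-3)])
      moreover have "\<forall>x\<in>verts A. lQ ((j1 \<circ> e) x) = w x"
        using e(2) j1(2) hom_verts[OF embedding_hom[OF e(1)]] by (simp add: image_subset_iff)
      ultimately have "\<chi> (j2 ` (j1 \<circ> e) ` verts A) = c" using c by blast
      then show ?thesis by (simp add: image_comp comp_assoc)
    qed
    then show ?thesis by blast
  qed
  then show "\<exists>j. embedding L P H j \<and> (\<forall>x\<in>verts P. lH (j x) = lP x) \<and>
      (\<forall>w\<in>W1 \<union> W2. \<exists>c. \<forall>e. embedding L A P e \<and> (\<forall>x\<in>verts A. lP (e x) = w x) \<longrightarrow> \<chi> (j ` e ` verts A) = c)"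
    using embedding_comp[OF j1(1) j2(1) st(2-4)] j1(2) j2(2) jv by (intro exI[of _ "j2 \<circ> j1"]) simp
qed

lemma id_embedding:
  assumes "is_structure L P"
  shows "embedding L P P id"
  using restr_embedding[OF assms closed_verts[OF assms, of "{}"]] restr_verts[OF assms] by simp

lemma uniform_copies_refl: "is_structure L P \<Longrightarrow> uniform_copies L k A {} P lab P lab"
  using id_embedding[of L P] by (intro uniform_copiesI exI[of _ id]) simp

text \<open>What is needed about a partite construction with base \<open>G\<close>, whose vertices are the
  images of the labels under \<open>gm\<close>. The last clause is quantified over all \<open>G\<close>, so that the
  construction itself does not depend on the base.\<close>
definition partite_extension :: "('r, 'f) lang \<Rightarrow> ('r, 'f) closure_descr \<Rightarrow> ('r, 'f, nat) lstruct set \<Rightarrow> nat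
    \<Rightarrow> ('r, 'f, nat) lstruct \<Rightarrow> (nat \<Rightarrow> 'l) set
    \<Rightarrow> ('r, 'f, nat) lstruct \<Rightarrow> (nat \<Rightarrow> 'l) \<Rightarrow> ('r, 'f, nat) lstruct \<Rightarrow> (nat \<Rightarrow> 'l) \<Rightarrow> bool" where
  "partite_extension L U K k A W P lab Q lab' \<longleftrightarrow>
     U_closed L U Q \<and> finite (verts Q) \<and> locally_in L U Q lab' P lab \<and> uniform_copies L k A W P lab Q lab' \<and>
     (\<forall>(G :: ('r, 'f, nat) lstruct) gm n. is_structure L G \<and> hom_emb_on L U P (verts P) G (gm \<circ> lab) \<and>
        (\<forall>w\<in>W. embedding L A G (gm \<circ> w)) \<and> completable L U K G n \<and> completable L U K P (Suc n) \<longrightarrow>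
        completable L U K Q (Suc n))"

lemma partite_extensionI:
  fixes P Q :: "('r, 'f, nat) lstruct" and lab lab' :: "nat \<Rightarrow> 'l"
  assumes "U_closed L U Q" "finite (verts Q)" "locally_in L U Q lab' P lab" "uniform_copies L k A W P lab Q lab'"
    and "\<And>(G :: ('r, 'f, nat) lstruct) gm n. is_structure L G \<Longrightarrow> hom_emb_on L U P (verts P) G (gm \<circ> lab) \<Longrightarrow>
        \<forall>w\<in>W. embedding L A G (gm \<circ> w) \<Longrightarrow> completable L U K G n \<Longrightarrow> completable L U K P (Suc n) \<Longrightarrow>
        completable L U K Q (Suc n)"
  shows "partite_extension L U K k A W P lab Q lab'"
  unfolding partite_extension_def
proof (intro conjI allI impI)
  fix G :: "('r, 'f, nat) lstruct" and gm n
  assume "is_structure L G \<and> hom_emb_on L U P (verts P) G (gm \<circ> lab) \<and> (\<forall>w\<in>W. embedding L A G (gm \<circ> w)) \<and>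
    completable L U K G n \<and> completable L U K P (Suc n)"
  then show "completable L U K Q (Suc n)" by (elim conjE) (rule assms(5))
qed (rule assms(1-4))+

context class_setting
begin

text \<open>The alphabet \<open>\<Sigma>\<close> consists of the copies of \<open>A\<close> in \<open>P\<close> over \<open>w\<close>. A word \<open>u\<close> over \<open>\<Sigma>\<close> is
  a copy of \<open>A\<close> in the fibre power, whose colour is taken as the colour of \<open>u\<close>. A
  monochromatic line is the trace of a copy of \<open>P\<close> in which all copies of \<open>A\<close> over \<open>w\<close> have
  this colour.\<close>
lemma partite_step:
  fixes P A :: "('r, 'f, nat) lstruct" and lab w :: "nat \<Rightarrow> 'l"
  assumes AK: "A \<in> K" and Pu: "U_closed L U P" and Pf: "finite (verts P)" and winj: "inj_on w (verts A)"
    and ue: "hom_emb_on L U P {x \<in> verts P. lab x \<in> w ` verts A} A (inv_into (verts A) w \<circ> lab)"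
  shows "\<exists>Q lab'. partite_extension L U K k A {w} P lab Q lab'"
proof -
  note As = K_structure[OF AK] and Ps = U_closed_structure[OF Pu]
  define \<Sigma> where "\<Sigma> = {e \<in> verts A \<rightarrow>\<^sub>E verts P. embedding L A P e \<and> (\<forall>x\<in>verts A. lab (e x) = w x)}"
  have \<Sigma>fin: "finite \<Sigma>" unfolding \<Sigma>_def
    using finite_PiE[of "verts A" "\<lambda>_. verts P"] K_finite[OF AK] Pf by simp
  have sec: "restrict e (verts A) \<in> \<Sigma>" if "embedding L A P e" "\<forall>x\<in>verts A. lab (e x) = w x" for e
  proof -
    have "embedding L A P (restrict e (verts A))" by (rule embedding_cong[OF that(1) _ As Ps]) simp
    then show ?thesis unfolding \<Sigma>_def using that(2) hom_verts[OF embedding_hom[OF that(1)]] by auto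
  qed
  show ?thesis
  proof (cases "\<Sigma> = {} \<or> k = 0")
    case True
    note id = id_embedding[OF Ps]
    have "uniform_copies L k A {w} P lab P lab"
    proof (rule uniform_copiesI)
      fix \<chi> :: "nat set \<Rightarrow> nat" assume "\<And>X. \<chi> X < k"
      then have "k \<noteq> 0" by (metis less_zeroE)
      then have "\<Sigma> = {}" using True by simp
      then have "\<not> (embedding L A P e \<and> (\<forall>x\<in>verts A. lab (e x) = w x))" for e using sec by blast
      then have "\<exists>c. \<forall>e. embedding L A P e \<and> (\<forall>x\<in>verts A. lab (e x) = w x) \<longrightarrow> \<chi> (id ` e ` verts A) = c"
        by blast
      then show "\<exists>j. embedding L P P j \<and> (\<forall>x\<in>verts P. lab (j x) = lab x) \<and>
         (\<forall>w\<in>{w}. \<exists>c. \<forall>e. embedding L A P e \<and> (\<forall>x\<in>verts A. lab (e x) = w x) \<longrightarrow> \<chi> (j ` e ` verts A) = c)"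
        using id by (intro exI[of _ id] conjI ballI) simp_all
    qed
    then have "partite_extension L U K k A {w} P lab P lab"
      unfolding partite_extension_def using Pu Pf locally_in_refl[OF Ps, of lab] by simp
    then show ?thesis by blast
  next
    case False
    obtain N where N: "hales_jewett \<Sigma> k N" using hales_jewett_theorem[OF \<Sigma>fin] by blast
    \<comment> \<open>A line has a moving coordinate, so that \<open>N\<close> is positive. The existence of some line
      follows from the constant colouring.\<close>
    have "\<exists>l c. comb_line \<Sigma> N l \<and> (\<forall>s\<in>\<Sigma>. (0::nat) = c)"
      using N False unfolding hales_jewett_def by (elim allE[of _ "\<lambda>_. 0"]) simp
    then have N0: "N > 0" unfolding comb_line_def by auto
    define D where "D = {x \<in> verts P. lab x \<in> w ` verts A}"
    define \<rho> where "\<rho> = inv_into (verts A) w \<circ> lab"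
    have ue': "hom_emb_on L U P D A \<rho>" unfolding D_def \<rho>_def by (rule ue)
    interpret pw: fibre_power_setting L U P D A \<rho> N
      by unfold_locales (use Pu Pf K_closed[OF AK] ue' N0 in simp_all)
    define I where "I = {l. comb_line \<Sigma> N l}"
    have "I \<subseteq> {l. set l \<subseteq> insert None (Some ` \<Sigma>) \<and> length l = N}" unfolding I_def comb_line_def by blast
    then have Ifin: "finite I" by (rule finite_subset) (intro finite_lists_length_eq, simp add: \<Sigma>fin)
    have rho_sec: "e a \<in> D \<and> \<rho> (e a) = a" if "e \<in> \<Sigma>" "a \<in> verts A" for e a
    proof -
      have "lab (e a) = w a" "e a \<in> verts P" using that unfolding \<Sigma>_def by auto
      then show ?thesis unfolding D_def \<rho>_def using winj that(2) by simp
    qed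
    have lam: "embedding L (restr P D) pw.Y (pw.line l)" if "l \<in> I" for l
    proof (rule pw.line_embedding)
      show "length l = N" "None \<in> set l" using that unfolding I_def comb_line_def by auto
      fix e assume "Some e \<in> set l"
      then have e: "e \<in> \<Sigma>" using that unfolding I_def comb_line_def by auto
      show "embedding L A P e" using e unfolding \<Sigma>_def by simp
      fix a assume "a \<in> verts A"
      then show "e a \<in> D \<and> \<rho> (e a) = a" by (rule rho_sec[OF e])
    qed
    have "\<exists>(a :: nat list \<Rightarrow> nat) J. glue_setting L U pw.Y P D I pw.line a J"
      by (rule glue_exists[OF pw.Y_U_closed Pu pw.Dc pw.Y_finite Pf Ifin lam])
    then obtain a :: "nat list \<Rightarrow> nat" and J where gs: "glue_setting L U pw.Y P D I pw.line a J" by blast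
    interpret gl: glue_setting L U pw.Y P D I pw.line a J by (rule gs)
    have lab_D: "lab x = w (\<rho> x)" if "x \<in> D" for x
      using that unfolding D_def \<rho>_def by (auto simp: f_inv_into_f)
    have line_nth: "\<rho> (pw.line l x ! j) = \<rho> x" if "l \<in> I" "x \<in> D" "j < N" for l x j
    proof -
      have l: "length l = N" "None \<in> set l" using that(1) unfolding I_def comb_line_def by auto
      then obtain k where k: "k < N" "l ! k = None" by (auto simp: in_set_conv_nth)
      have "pw.line l x ! k = x" unfolding pw.line_def using k l(1) by simp
      then show ?thesis using pw.rho_nth[OF gl.lam_verts[OF that(1,2)] that(3) k(1)] by simp
    qed
    interpret fibre_power_gluing L U K P D A \<rho> N I pw.line a J lab w
      by unfold_locales (use AK lab_D line_nth N0 in simp_all)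
    have "uniform_copies L k A {w} P lab gl.Q lab'"
    proof (rule uniform_copiesI)
      fix \<chi> :: "nat set \<Rightarrow> nat" assume \<chi>: "\<And>X. \<chi> X < k"
      define \<psi> where "\<psi> u = \<chi> (a ` (\<lambda>x. map (\<lambda>e. e x) u) ` verts A)" for u
      have "\<forall>u. \<psi> u < k" unfolding \<psi>_def using \<chi> by blast
      then obtain l c where l: "comb_line \<Sigma> N l" "\<forall>s\<in>\<Sigma>. \<psi> (line_word l s) = c"
        using N unfolding hales_jewett_def by blast
      have lI: "l \<in> I" unfolding I_def using l(1) by simp
      have "\<chi> (J l ` e ` verts A) = c" if e: "embedding L A P e" "\<forall>x\<in>verts A. lab (e x) = w x" for e
      proof -
        let ?e = "restrict e (verts A)"
        have s: "?e \<in> \<Sigma>" by (rule sec[OF e])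
        have "J l (e x) = a (map (\<lambda>e. e x) (line_word l ?e))" if x: "x \<in> verts A" for x
        proof -
          have ex: "e x \<in> D" "\<rho> (e x) = x" using rho_sec[OF s x] x by auto
          have "pw.line l (e x) = map (\<lambda>e. e x) (line_word l ?e)"
            unfolding pw.line_def line_word_def using ex(2) x by (auto split: option.splits)
          then show ?thesis using gl.J_D[OF lI ex(1)] by simp
        qed
        then have "J l ` e ` verts A = a ` (\<lambda>x. map (\<lambda>e. e x) (line_word l ?e)) ` verts A"
          unfolding image_image by (intro image_cong) auto
        then show ?thesis using l(2) s unfolding \<psi>_def by simp
      qed
      then show "\<exists>j. embedding L P gl.Q j \<and> (\<forall>x\<in>verts P. lab' (j x) = lab x) \<and>
           (\<forall>w\<in>{w}. \<exists>c. \<forall>e. embedding L A P e \<and> (\<forall>x\<in>verts A. lab (e x) = w x) \<longrightarrow> \<chi> (j ` e ` verts A) = c)"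
        using gl.J_embedding[OF lI] lab'_J[OF lI] by (intro exI[of _ "J l"]) auto
    qed
    then have "partite_extension L U K k A {w} P lab gl.Q lab'"
    proof (rule partite_extensionI[OF gl.Q_U_closed gl.Q_finite locally_in_step])
      fix G :: "('r, 'f, nat) lstruct" and gm n
      assume G: "is_structure L G" "hom_emb_on L U P (verts P) G (gm \<circ> lab)" and w: "\<forall>w\<in>{w}. embedding L A G (gm \<circ> w)"
        and c: "completable L U K G n" "completable L U K P (Suc n)"
      have "embedding L A G (gm \<circ> w)" using w by simp
      then show "completable L U K gl.Q (Suc n)" by (rule completable_step[OF G _ c])
    qed
    then show ?thesis by blast
  qed
qed

text \<open>The projections are treated one after the other. The charts of those still to come are
  preserved by \<open>locally_in_hom_emb_on\<close>, and later steps do not spoil earlier ones because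
  they only pass to copies of the structure built so far.\<close>
lemma partite_construction:
  fixes P A :: "('r, 'f, nat) lstruct" and lab :: "nat \<Rightarrow> 'l"
  assumes AK: "A \<in> K" and "finite W" "U_closed L U P" "finite (verts P)"
    and "\<And>w. w \<in> W \<Longrightarrow> inj_on w (verts A)"
    and "\<And>w. w \<in> W \<Longrightarrow> hom_emb_on L U P {x \<in> verts P. lab x \<in> w ` verts A} A (inv_into (verts A) w \<circ> lab)"
  shows "\<exists>Q lab'. partite_extension L U K k A W P lab Q lab'"
  using assms(2-6)
proof (induction W arbitrary: P lab rule: finite_induct)
  case empty
  note Ps = U_closed_structure[OF empty(1)]
  have "partite_extension L U K k A {} P lab P lab"
    unfolding partite_extension_def using empty locally_in_refl[OF Ps, of lab] uniform_copies_refl[OF Ps, of k A lab] by simp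
  then show ?case by blast
next
  case (insert w W)
  note As = K_structure[OF AK] and Ps = U_closed_structure[OF insert.prems(1)]
  obtain Q1 l1 where Q1: "partite_extension L U K k A {w} P lab Q1 l1"
    using partite_step[OF AK insert.prems(1,2) insert.prems(3,4)[of w]] by blast
  have 1: "U_closed L U Q1" "finite (verts Q1)" "locally_in L U Q1 l1 P lab" "uniform_copies L k A {w} P lab Q1 l1"
    using Q1 unfolding partite_extension_def by auto
  note Q1s = U_closed_structure[OF 1(1)]
  have "\<exists>Q lab'. partite_extension L U K k A W Q1 l1 Q lab'"
  proof (rule insert.IH[OF 1(1,2)])
    fix w' assume w': "w' \<in> W"
    then show "inj_on w' (verts A)" using insert.prems(3) by simp
    show "hom_emb_on L U Q1 {x \<in> verts Q1. l1 x \<in> w' ` verts A} A (inv_into (verts A) w' \<circ> l1)"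
      by (rule locally_in_hom_emb_on[OF 1(1) insert.prems(1) As 1(3) insert.prems(4)]) (simp add: w')
  qed
  then obtain Q lab' where Q: "partite_extension L U K k A W Q1 l1 Q lab'" by blast
  have 2: "U_closed L U Q" "finite (verts Q)" "locally_in L U Q lab' Q1 l1" "uniform_copies L k A W Q1 l1 Q lab'"
    using Q unfolding partite_extension_def by auto
  note Qs = U_closed_structure[OF 2(1)]
  have le: "locally_in L U Q lab' P lab" by (rule locally_in_trans[OF 2(1) 1(1) Ps 2(3) 1(3)])
  have un: "uniform_copies L k A (insert w W) P lab Q lab'"
    using uniform_copies_trans[OF 1(4) 2(4) As Ps Q1s Qs] by simp
  have "partite_extension L U K k A (insert w W) P lab Q lab'"
  proof (rule partite_extensionI[OF 2(1,2) le un])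
    fix G :: "('r, 'f, nat) lstruct" and gm n
    assume G: "is_structure L G" "hom_emb_on L U P (verts P) G (gm \<circ> lab)" "\<forall>w\<in>insert w W. embedding L A G (gm \<circ> w)"
      "completable L U K G n" "completable L U K P (Suc n)"
    have c1: "completable L U K Q1 (Suc n)" using Q1 G unfolding partite_extension_def by blast
    have "hom_emb_on L U P {x \<in> verts P. lab x \<in> UNIV} G (gm \<circ> lab)" using G(2) by simp
    from locally_in_hom_emb_on[OF 1(1) insert.prems(1) G(1) 1(3) this]
    have "hom_emb_on L U Q1 (verts Q1) G (gm \<circ> l1)" by simp
    then show "completable L U K Q (Suc n)" using Q G c1 unfolding partite_extension_def by blast
  qed
  then show ?case by blast
qed

end

section \<open>Disjoint unions of copies\<close>

definition empty_structure :: "('r, 'f, 'v) lstruct" where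
  "empty_structure = \<lparr>verts = {}, rel = \<lambda>_. {}, fn = \<lambda>_. Map.empty\<rparr>"

lemma hom_emb_on_of_embedding:
  assumes P: "is_structure L P" and H: "is_structure L H" and D: "is_closed L U P D" and h: "embedding L (restr P D) H h"
  shows "hom_emb_on L U P D H h"
  unfolding hom_emb_on_def
proof (intro conjI allI impI)
  show "is_closed L U P D" by (rule D)
  show "homomorphism L (restr P D) H h" by (rule embedding_hom[OF h])
  fix Z assume Z: "irreducible_in L U P Z \<and> Z \<subseteq> D"
  then have "is_closed L U (restr P D) Z" unfolding restr_closed[OF P D] irreducible_in_def by simp
  from embedding_restr[OF h restr_structure[OF P D] H this]
  show "embedding L (restr P Z) H h" using Z by (simp add: restr_restr)
qed

lemma locally_in_map:
  assumes "locally_in L U Q lQ P lP" "\<And>x. l' x = g (lQ x)" "\<And>x. l x = g (lP x)"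
  shows "locally_in L U Q l' P l"
  unfolding locally_in_def
proof (intro allI impI)
  fix Z assume "irreducible_in L U Q Z"
  then obtain p where "embedding L (restr Q Z) P p" "\<forall>z\<in>Z. lP (p z) = lQ z"
    using assms(1) unfolding locally_in_def by blast
  then show "\<exists>p. embedding L (restr Q Z) P p \<and> (\<forall>z\<in>Z. l (p z) = l' z)"
    using assms(2,3) by (intro exI[of _ p]) simp
qed

context closure_setting
begin

text \<open>Symbols have positive arity, so that a structure without vertices has no relations and
  no values.\<close>
lemma vacuous_embedding:
  assumes M: "is_structure L M" "verts M = {}" and H: "is_structure L H"
  shows "embedding L M H f"
proof -
  have r: "[] \<notin> rel X R" if "is_structure L X" for X :: "('r, 'f, 'z) lstruct" and R
  proof
    assume "[] \<in> rel X R"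
    then show False using structure_rel[OF that, of "[]" R] lang unfolding is_language_def by auto
  qed
  have f: "fn X F [] = None" if "is_structure L X" for X :: "('r, 'f, 'z) lstruct" and F
  proof (cases "fn X F []")
    case (Some y)
    then show ?thesis using structure_fn[OF that Some] lang unfolding is_language_def by auto
  qed simp
  show ?thesis unfolding embedding_iff[OF M(1) H] using M(2) r[OF M(1)] r[OF H] f[OF M(1)] f[OF H] by simp
qed

text \<open>Functions have positive arity, and roots are non-empty.\<close>
lemma closed_empty:
  assumes P: "is_structure L P"
  shows "is_closed L U P {}"
  unfolding is_closed_def
proof (intro conjI allI impI)
  fix t y assume t: "rule L U P t y \<and> set t \<subseteq> {}"
  from conjunct1[OF t] show "y \<in> {}"
  proof (cases rule: rule_cases)
    case (fn F)
    then show ?thesis using structure_fn[OF P fn(2)] t lang unfolding is_language_def by auto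
  next
    case (rel R S ys)
    then show ?thesis using root(4)[OF rel(1)] t by simp
  qed
qed simp

lemma empty_U_closed: "U_closed L U empty_structure"
proof (rule U_closedI)
  show "is_structure L empty_structure" unfolding empty_structure_def is_structure_def by simp
  fix R S t assume "(R, S) \<in> U" "length t = card (verts S)" "set t \<subseteq> verts (empty_structure :: ('r, 'f, 'v) lstruct)"
  then show "\<exists>ys. t @ ys \<in> rel (empty_structure :: ('r, 'f, 'v) lstruct) R"
    using root(4) unfolding empty_structure_def by fastforce
qed (simp_all add: empty_structure_def)

end

text \<open>A disjoint union of copies of \<open>P\<close> is the gluing along the empty set to the empty
  structure.\<close>
locale disjoint_union =
  glue_setting L U "empty_structure :: ('r, 'f, nat) lstruct" P "{}" I "\<lambda>_ _. 0" a J
  for L :: "('r, 'f) lang" and U and P :: "('r, 'f, nat) lstruct" and I :: "'i set" and a :: "nat \<Rightarrow> nat" and J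
begin

lemma union_verts: "verts Q = (\<Union>i\<in>I. J i ` verts P)"
  unfolding Q_verts by (simp add: empty_structure_def)

lemma union_piece:
  assumes "unsplit L U' M" "U' \<subseteq> U" "homomorphism L M Q p" "verts M \<noteq> {}"
  shows "\<exists>i\<in>I. p ` verts M \<subseteq> J i ` verts P"
  using unsplit_image_cases[OF assms(1-3)] assms(4) by (simp add: empty_structure_def)

lemma ex_label: "\<exists>lb. \<forall>i\<in>I. \<forall>x\<in>verts P. lb (J i x) = Lb i x"
  using glue_map_J[of _ _ Lb undefined] by (intro exI[of _ "glue_map undefined Lb"]) simp

lemma union_irreducible_in:
  assumes Z: "irreducible_in L U Q Z" "Z \<noteq> {}"
  obtains i p where "i \<in> I" "embedding L (restr Q Z) P p" "irreducible_in L U P (p ` Z)" "\<And>z. z \<in> Z \<Longrightarrow> p z \<in> verts P \<and> J i (p z) = z"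
proof -
  have Zc: "is_closed L U Q Z" "unsplit L U (restr Q Z)" using Z(1) unfolding irreducible_in_def by auto
  note Zs = restr_structure[OF Q_structure Zc(1)] and Ze = restr_embedding[OF Q_structure Zc(1)]
  obtain i where i: "i \<in> I" "id ` verts (restr Q Z) \<subseteq> J i ` verts P"
    using union_piece[OF Zc(2) subset_refl embedding_hom[OF Ze]] Z(2) by auto
  note f = embedding_factor[OF Ze J_embedding[OF i(1)] i(2) Zs Ps Q_structure]
  show ?thesis
  proof (rule that[OF i(1) f(1) irreducible_in_push(1)[OF Q_U_closed Pu Z(1) f(1)]])
    fix z assume "z \<in> Z"
    then show "(inv_into (verts P) (J i) \<circ> id) z \<in> verts P \<and> J i ((inv_into (verts P) (J i) \<circ> id) z) = z"
      using f(2)[of z] hom_verts[OF embedding_hom[OF f(1)]] by (simp add: image_subset_iff)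
  qed
qed

lemma union_locally_in:
  assumes H: "is_structure L H" and lb: "\<forall>i\<in>I. \<forall>x\<in>verts P. lb (J i x) = Lb i x"
    and loc: "\<And>i. i \<in> I \<Longrightarrow> locally_in L U P (Lb i) H lH"
  shows "locally_in L U Q lb H lH"
  unfolding locally_in_def
proof (intro allI impI)
  fix Z assume Z: "irreducible_in L U Q Z"
  then have Zs: "is_structure L (restr Q Z)" using restr_structure[OF Q_structure] unfolding irreducible_in_def by auto
  show "\<exists>p. embedding L (restr Q Z) H p \<and> (\<forall>z\<in>Z. lH (p z) = lb z)"
  proof (cases "Z = {}")
    case True
    then show ?thesis using vacuous_embedding[OF Zs _ H] by auto
  next
    case False
    obtain i p where p: "i \<in> I" "embedding L (restr Q Z) P p" "irreducible_in L U P (p ` Z)"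
      "\<And>z. z \<in> Z \<Longrightarrow> p z \<in> verts P \<and> J i (p z) = z"
      using union_irreducible_in[OF Z False] by blast
    obtain q where q: "embedding L (restr P (p ` Z)) H q" "\<forall>z\<in>p ` Z. lH (q z) = Lb i z"
      using loc[OF p(1)] p(3) unfolding locally_in_def by blast
    have s: "is_structure L (restr P (p ` Z))" using p(3) restr_structure[OF Ps] unfolding irreducible_in_def by auto
    have "embedding L (restr Q Z) H (q \<circ> p)"
      by (rule embedding_comp[OF irreducible_in_push(2)[OF Q_U_closed Pu Z p(2)] q(1) Zs s H])
    moreover have "lH ((q \<circ> p) z) = lb z" if "z \<in> Z" for z
    proof -
      have "lb (J i (p z)) = Lb i (p z)" using lb p(1) p(4)[OF that] by blast
      then show ?thesis using q(2) p(4)[OF that] that by simp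
    qed
    ultimately show ?thesis by blast
  qed
qed

lemma union_hom_emb_on:
  assumes H: "is_structure L H" and lb: "\<forall>i\<in>I. \<forall>x\<in>verts P. lb (J i x) = Lb i x"
    and ue: "\<And>i. i \<in> I \<Longrightarrow> hom_emb_on L U P {x \<in> verts P. Lb i x \<in> V} H (h \<circ> Lb i)"
  shows "hom_emb_on L U Q {z \<in> verts Q. lb z \<in> V} H (h \<circ> lb)"
proof -
  let ?D = "{z \<in> verts Q. lb z \<in> V}" and ?E = "\<lambda>i. {x \<in> verts P. Lb i x \<in> V}"
  have E: "is_closed L U P (?E i)" "homomorphism L (restr P (?E i)) H (h \<circ> Lb i)"
    "\<And>Z. irreducible_in L U P Z \<Longrightarrow> Z \<subseteq> ?E i \<Longrightarrow> embedding L (restr P Z) H (h \<circ> Lb i)" if "i \<in> I" for i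
    using ue[OF that] unfolding hom_emb_on_def by auto
  have JD: "J i x \<in> ?D \<longleftrightarrow> x \<in> ?E i" if "i \<in> I" "x \<in> verts P" for i x
    using lb that union_verts by auto
  have JDs: "set xs \<subseteq> ?E i" if "i \<in> I" "set xs \<subseteq> verts P" "set (map (J i) xs) \<subseteq> ?D" for i xs
  proof
    fix x assume "x \<in> set xs"
    then show "x \<in> ?E i" using JD[OF that(1), of x] that(2,3) by auto
  qed
  have maps: "map (h \<circ> lb) (map (J i) xs) = map (h \<circ> Lb i) xs" if "i \<in> I" "set xs \<subseteq> verts P" for i xs
    using lb that by auto
  have Dc: "is_closed L U Q ?D"
  proof (rule Q_closedI)
    fix t y assume "rule L U (empty_structure :: ('r, 'f, nat) lstruct) t y"
    from rule_verts[OF Ys this] show "a y \<in> ?D" by (simp add: empty_structure_def)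
  next
    fix i t y assume *: "i \<in> I" "rule L U P t y" "set t \<subseteq> verts P" "set (map (J i) t) \<subseteq> ?D"
    have "y \<in> ?E i" by (rule closedD[OF E(1)[OF *(1)] *(2) JDs[OF *(1,3,4)]])
    then show "J i y \<in> ?D" using JD[OF *(1), of y] by simp
  qed blast
  have "homomorphism L (restr Q ?D) H (h \<circ> lb)"
    unfolding homomorphism_iff
  proof (intro conjI ballI allI impI)
    show "(h \<circ> lb) ` verts (restr Q ?D) \<subseteq> verts H"
    proof
      fix v assume "v \<in> (h \<circ> lb) ` verts (restr Q ?D)"
      then obtain z where z: "z \<in> ?D" "v = h (lb z)" by auto
      then obtain i x where x: "i \<in> I" "x \<in> verts P" "z = J i x" using union_verts by auto
      have "x \<in> ?E i" using JD[OF x(1,2)] z(1) x(3) by simp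
      then have "(h \<circ> Lb i) x \<in> verts H" using hom_verts[OF E(2)[OF x(1)]] by auto
      then show "v \<in> verts H" using z(2) lb x by simp
    qed
  next
    fix R zs assume R: "R \<in> rels L" and "zs \<in> rel (restr Q ?D) R"
    then have zs: "zs \<in> rel Q R" "set zs \<subseteq> ?D" by auto
    from zs(1) show "map (h \<circ> lb) zs \<in> rel H R"
    proof (cases rule: Q_rel_cases)
      case (Y xs) then show ?thesis by (simp add: empty_structure_def)
    next
      case (P i xs)
      have v: "set xs \<subseteq> verts P" using structure_rel[OF Ps P(2)] by simp
      have "set xs \<subseteq> ?E i" using JDs[OF P(1) v] zs(2) P(3) by simp
      then have "map (h \<circ> Lb i) xs \<in> rel H R" using P(2) by (intro hom_rel[OF E(2)[OF P(1)] R]) simp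
      then show ?thesis unfolding P(3) maps[OF P(1) v] .
    qed
  next
    fix F zs v assume F: "F \<in> funs L" and "fn (restr Q ?D) F zs = Some v"
    then have zs: "fn Q F zs = Some v" "set zs \<subseteq> ?D" unfolding restr_simps by (metis option.distinct(1))+
    from zs(1)[unfolded Q_fn] show "fn H F (map (h \<circ> lb) zs) = Some ((h \<circ> lb) v)"
    proof (cases rule: glue_fn_cases)
      case (Y xs u) then show ?thesis by (simp add: empty_structure_def)
    next
      case (P i xs u)
      have v: "set xs \<subseteq> verts P" "u \<in> verts P" using structure_fn[OF Ps P(2)] by auto
      have "set xs \<subseteq> ?E i" using JDs[OF P(1) v(1)] zs(2) P(3) by simp
      then have "fn H F (map (h \<circ> Lb i) xs) = Some ((h \<circ> Lb i) u)" using P(2) by (intro hom_fn[OF E(2)[OF P(1)] F]) simp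
      moreover have "(h \<circ> lb) v = (h \<circ> Lb i) u" using lb P(1,4) v(2) by simp
      ultimately show ?thesis unfolding P(3) maps[OF P(1) v(1)] by simp
    qed
  qed
  moreover have "embedding L (restr Q Z) H (h \<circ> lb)" if Z: "irreducible_in L U Q Z" "Z \<subseteq> ?D" for Z
  proof -
    have Zs: "is_structure L (restr Q Z)" using Z restr_structure[OF Q_structure] unfolding irreducible_in_def by auto
    show ?thesis
    proof (cases "Z = {}")
      case True
      then show ?thesis using vacuous_embedding[OF Zs _ H] by simp
    next
      case False
      obtain i p where p: "i \<in> I" "embedding L (restr Q Z) P p" "irreducible_in L U P (p ` Z)"
        "\<And>z. z \<in> Z \<Longrightarrow> p z \<in> verts P \<and> J i (p z) = z"
        using union_irreducible_in[OF Z(1) False] by blast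
      have "p ` Z \<subseteq> ?E i"
      proof
        fix x assume "x \<in> p ` Z"
        then obtain z where z: "z \<in> Z" "x = p z" by blast
        then show "x \<in> ?E i" using JD[OF p(1), of x] p(4)[OF z(1)] Z(2) by auto
      qed
      then have e: "embedding L (restr P (p ` Z)) H (h \<circ> Lb i)" by (rule E(3)[OF p(1,3)])
      have s: "is_structure L (restr P (p ` Z))" using p(3) restr_structure[OF Ps] unfolding irreducible_in_def by auto
      have "embedding L (restr Q Z) H ((h \<circ> Lb i) \<circ> p)"
        by (rule embedding_comp[OF irreducible_in_push(2)[OF Q_U_closed Pu Z(1) p(2)] e Zs s H])
      then show ?thesis
      proof (rule embedding_cong[OF _ _ Zs H])
        fix z assume "z \<in> verts (restr Q Z)"
        then have z: "p z \<in> verts P" "J i (p z) = z" using p(4) by auto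
        then have "lb z = Lb i (p z)" using lb p(1) by metis
        then show "((h \<circ> Lb i) \<circ> p) z = (h \<circ> lb) z" by simp
      qed
    qed
  qed
  ultimately show ?thesis unfolding hom_emb_on_def using Dc by simp
qed

end

lemma (in closure_setting) ex_disjoint_union:
  fixes P :: "('r, 'f, nat) lstruct" and I :: "'i set"
  assumes "U_closed L U P" "finite (verts P)" "finite I"
  obtains a J where "disjoint_union L U P I a J"
proof -
  note Ps = U_closed_structure[OF assms(1)]
  note es = U_closed_structure[OF empty_U_closed]
  have "\<exists>(a :: nat \<Rightarrow> nat) J. glue_setting L U (empty_structure :: ('r, 'f, nat) lstruct) P {} I (\<lambda>_ _. 0) a J"
    by (rule glue_exists[OF empty_U_closed assms(1) closed_empty[OF Ps] _ assms(2,3)])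
      (simp_all add: empty_structure_def[where ?'v = nat] vacuous_embedding[OF restr_structure[OF Ps closed_empty[OF Ps]] _ es, unfolded empty_structure_def])
  then show ?thesis using that unfolding disjoint_union_def by blast
qed

text \<open>The folding map of the union to \<open>P\<close> completes all sets at once.\<close>
lemma (in class_setting) union_completable:
  assumes "disjoint_union L U P I a J" and PK: "P \<in> K"
  shows "completable L U K (glue (empty_structure :: ('r, 'f, nat) lstruct) P I a J) n"
proof -
  interpret disjoint_union L U P I a J by (rule assms(1))
  obtain f where f: "\<forall>i\<in>I. \<forall>x\<in>verts P. f (J i x) = x" using ex_label[of "\<lambda>_ x. x"] by blast
  have "completes L U K Q S P f" for S
  proof (rule completesI)
    fix M h assume M: "M \<in> K" and h: "embedding L M Q h"
    show "\<exists>\<alpha>. embedding L M P \<alpha> \<and> (\<forall>x\<in>verts M. h x \<in> S \<longrightarrow> \<alpha> x = f (h x))"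
    proof (cases "verts M = {}")
      case True
      then show ?thesis using vacuous_embedding[OF K_structure[OF M] True Ps] by blast
    next
      case False
      obtain i where i: "i \<in> I" "h ` verts M \<subseteq> J i ` verts P"
        using union_piece[OF K_unsplit[OF M] empty_subsetI embedding_hom[OF h] False] by blast
      note fac = embedding_factor[OF h J_embedding[OF i(1)] i(2) K_structure[OF M] Ps Q_structure]
      have "(inv_into (verts P) (J i) \<circ> h) x = f (h x)" if "x \<in> verts M" for x
      proof -
        have "(inv_into (verts P) (J i) \<circ> h) x \<in> verts P"
          using hom_verts[OF embedding_hom[OF fac(1)]] that by (simp add: image_subset_iff)
        then show ?thesis using f i(1) fac(2)[OF that] by metis
      qed
      then show ?thesis using fac(1) by blast
    qed
  qed
  then show ?thesis unfolding completable_def using PK by blast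
qed

section \<open>Uniform colours without charts\<close>

text \<open>The arrow \<open>C \<longrightarrow> (B)\<^sup>A\<close> with copies represented by their vertex sets and \<open>\<chi>\<close> defined on
  all sets of vertices, which can be pulled back along arbitrary maps.\<close>
definition set_arrow :: "('r, 'f) lang \<Rightarrow> ('r, 'f, nat) lstruct \<Rightarrow> ('r, 'f, nat) lstruct \<Rightarrow> ('r, 'f, nat) lstruct
    \<Rightarrow> nat \<Rightarrow> bool" where
  "set_arrow L C B A k \<longleftrightarrow> (\<forall>\<chi> :: nat set \<Rightarrow> nat. (\<forall>X. \<chi> X < k) \<longrightarrow>
     (\<exists>b c. c < k \<and> embedding L B C b \<and> (\<forall>e. embedding L A B e \<longrightarrow> \<chi> (b ` e ` verts A) = c)))"

lemma set_arrowE: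
  fixes \<chi> :: "nat set \<Rightarrow> nat"
  assumes "set_arrow L C B A k" "\<And>X. \<chi> X < k"
  obtains b c where "c < k" "embedding L B C b" "\<forall>e. embedding L A B e \<longrightarrow> \<chi> (b ` e ` verts A) = c"
proof -
  have "\<exists>b c. c < k \<and> embedding L B C b \<and> (\<forall>e. embedding L A B e \<longrightarrow> \<chi> (b ` e ` verts A) = c)"
    using assms unfolding set_arrow_def by simp
  then show ?thesis using that by (elim exE conjE)
qed

context closure_setting
begin

text \<open>The value of a function is determined by its arguments, and in a \<open>\<U>\<close>-closed structure
  also the extension of a tuple is.\<close>
lemma closed_agree:
  assumes f: "homomorphism L A P f" and g: "homomorphism L A P g" and P: "U_closed L U P" and A: "is_structure L A"
  shows "is_closed L U A {x \<in> verts A. f x = g x}"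
  unfolding is_closed_def
proof (intro conjI allI impI)
  fix t y assume "rule L U A t y \<and> set t \<subseteq> {x \<in> verts A. f x = g x}"
  then have r: "rule L U A t y" and t: "set t \<subseteq> {x \<in> verts A. f x = g x}" by auto
  have eq: "map f t = map g t" using t by auto
  from r have "f y = g y"
  proof (cases rule: rule_cases)
    case (fn F)
    have "fn P F (map f t) = Some (f y)" "fn P F (map g t) = Some (g y)"
      using hom_fn[OF f fn] hom_fn[OF g fn] by auto
    then show ?thesis using eq by simp
  next
    case (rel R S ys)
    have ff: "map f t @ map f ys \<in> rel P R" using hom_rel[OF f rel(2,3)] by simp
    have fg: "map f t @ map g ys \<in> rel P R" using hom_rel[OF g rel(2,3)] eq by (metis map_append)
    have "map f ys = map g ys" by (rule U_closed_unique[OF P rel(1) _ ff fg]) (simp add: rel(4))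
    then show ?thesis using rel(5) by simp
  qed
  then show "y \<in> {x \<in> verts A. f x = g x}" using rule_verts[OF A r] by simp
qed blast

end

context class_setting
begin

text \<open>The conclusion of \<open>partite_step\<close> (without completability) for a projection \<open>g\<close> whose
  labels need not form a chart. The words \<open>u\<close> over the alphabet \<open>\<Sigma>\<close> of copies of \<open>A\<close> over
  \<open>g\<close> serve as new projections \<open>w u\<close>. The \<open>partite_construction\<close> is applied to a disjoint
  union of copies of \<open>P\<close>, one for each combinatorial line \<open>l\<close>, in which a vertex carries
  besides its old label the point that the line \<open>l\<close> passes through over it. Then colours
  depend on words only, and a monochromatic line selects the copy of \<open>P\<close>.\<close>
lemma uniform_step:
  fixes P A :: "('r, 'f, nat) lstruct" and lab g :: "nat \<Rightarrow> 'l"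
  assumes AK: "A \<in> K" and Pu: "U_closed L U P" and Pf: "finite (verts P)" and ginj: "inj_on g (verts A)" and k: "k > 0"
  shows "\<exists>Q lab'. U_closed L U Q \<and> finite (verts Q) \<and> locally_in L U Q lab' P lab \<and> uniform_copies L k A {g} P lab Q lab'"
proof -
  note As = K_structure[OF AK] and Ps = U_closed_structure[OF Pu]
  define \<Sigma> where "\<Sigma> = {e \<in> verts A \<rightarrow>\<^sub>E verts P. embedding L A P e \<and> (\<forall>x\<in>verts A. lab (e x) = g x)}"
  have \<Sigma>fin: "finite \<Sigma>" unfolding \<Sigma>_def
    using finite_PiE[of "verts A" "\<lambda>_. verts P"] K_finite[OF AK] Pf by simp
  have sec: "restrict e (verts A) \<in> \<Sigma>" if "embedding L A P e" "\<forall>x\<in>verts A. lab (e x) = g x" for e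
  proof -
    have "embedding L A P (restrict e (verts A))" by (rule embedding_cong[OF that(1) _ As Ps]) simp
    then show ?thesis unfolding \<Sigma>_def using that(2) hom_verts[OF embedding_hom[OF that(1)]] by auto
  qed
  have \<Sigma>D: "embedding L A P e" "\<And>x. x \<in> verts A \<Longrightarrow> lab (e x) = g x" "\<And>x. x \<in> verts A \<Longrightarrow> e x \<in> verts P" if "e \<in> \<Sigma>" for e
    using that unfolding \<Sigma>_def by auto
  obtain N where N: "hales_jewett \<Sigma> k N" using hales_jewett_theorem[OF \<Sigma>fin] by blast
  define I where "I = {l. comb_line \<Sigma> N l}"
  have "I \<subseteq> {l. set l \<subseteq> insert None (Some ` \<Sigma>) \<and> length l = N}" unfolding I_def comb_line_def by blast
  then have Ifin: "finite I" by (rule finite_subset) (intro finite_lists_length_eq, simp add: \<Sigma>fin)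
  obtain a J where du: "disjoint_union L U P I a J" using ex_disjoint_union[OF Pu Pf Ifin] by blast
  interpret disjoint_union L U P I a J by (rule du)
  define X where "X = (\<Union>e\<in>\<Sigma>. e ` verts A)"
  define ln where "ln l x = map (\<lambda>s. case s of None \<Rightarrow> x | Some e \<Rightarrow> e (inv_into (verts A) g (lab x))) l"
    for l :: "(nat \<Rightarrow> nat) option list" and x
  \<comment> \<open>Only vertices on some copy in \<open>\<Sigma>\<close> get a second label; the others must not belong to any
    chart.\<close>
  define Lb where "Lb l x = (lab x, if x \<in> X then Some (ln l x) else None)" for l x
  define w where "w u = (\<lambda>x. (g x, Some (map (\<lambda>e. e x) u)))" for u :: "(nat \<Rightarrow> nat) list"
  define Wd where "Wd = {u. set u \<subseteq> \<Sigma> \<and> length u = N}"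
  have Wfin: "finite Wd" unfolding Wd_def using \<Sigma>fin by (rule finite_lists_length_eq)
  obtain lb where lb: "\<forall>i\<in>I. \<forall>x\<in>verts P. lb (J i x) = Lb i x" using ex_label by blast
  have winj: "inj_on (w u) (verts A)" for u using ginj unfolding w_def inj_on_def by auto
  have eX: "e x \<in> X" if "e \<in> \<Sigma>" "x \<in> verts A" for e x unfolding X_def using that by blast
  have invg: "inv_into (verts A) g (lab (e x)) = x" if "e \<in> \<Sigma>" "x \<in> verts A" for e x
    using \<Sigma>D(2)[OF that] ginj that(2) by simp
  have chart: "hom_emb_on L U P {x \<in> verts P. Lb l x \<in> w u ` verts A} A (inv_into (verts A) (w u) \<circ> Lb l)"
    if l: "l \<in> I" and u: "u \<in> Wd" for l u
  proof -
    have ll: "length l = N" "None \<in> set l" "\<And>e. Some e \<in> set l \<Longrightarrow> e \<in> \<Sigma>"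
      using l unfolding I_def comb_line_def by auto
    have lu: "length u = N" "\<And>e. e \<in> set u \<Longrightarrow> e \<in> \<Sigma>" using u unfolding Wd_def by auto
    obtain m where m: "m < N" "l ! m = None" using ll(1,2) by (auto simp: in_set_conv_nth)
    \<comment> \<open>A moving coordinate of \<open>l\<close> shows that the vertices of this copy over the word \<open>u\<close> lie on
      \<open>e0\<close>.\<close>
    define e0 where "e0 = u ! m"
    have e0: "e0 \<in> \<Sigma>" unfolding e0_def using lu m(1) by simp
    \<comment> \<open>The part of \<open>A\<close> over which the word \<open>u\<close> lies on the line \<open>l\<close>; the chart is its image
      under \<open>e0\<close>.\<close>
    define A' where "A' = {x \<in> verts A. ln l (e0 x) = map (\<lambda>e. e x) u}"
    have ln_nth: "ln l (e0 x) ! j = (case l ! j of None \<Rightarrow> e0 x | Some e \<Rightarrow> e x)" if "x \<in> verts A" "j < N" for x j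
      unfolding ln_def using ll(1) that(2) invg[OF e0 that(1)] by simp
    have A'_eq: "A' = {x \<in> verts A. \<forall>j<N. (case l ! j of None \<Rightarrow> e0 | Some e \<Rightarrow> e) x = (u ! j) x}"
    proof -
      have "ln l (e0 x) = map (\<lambda>e. e x) u \<longleftrightarrow> (\<forall>j<N. (case l ! j of None \<Rightarrow> e0 | Some e \<Rightarrow> e) x = (u ! j) x)"
        if x: "x \<in> verts A" for x
      proof -
        have "length (ln l (e0 x)) = N" unfolding ln_def using ll(1) by simp
        then have "ln l (e0 x) = map (\<lambda>e. e x) u \<longleftrightarrow> (\<forall>j<N. ln l (e0 x) ! j = (u ! j) x)"
          using lu(1) by (simp add: list_eq_iff_nth_eq)
        also have "\<dots> \<longleftrightarrow> (\<forall>j<N. (case l ! j of None \<Rightarrow> e0 | Some e \<Rightarrow> e) x = (u ! j) x)"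
          using ln_nth[OF x] by (auto split: option.splits)
        finally show ?thesis .
      qed
      then show ?thesis unfolding A'_def by blast
    qed
    have A'c: "is_closed L U A A'"
      unfolding is_closed_def
    proof (intro conjI allI impI)
      show "A' \<subseteq> verts A" unfolding A'_def by blast
      fix t y assume ty: "rule L U A t y \<and> set t \<subseteq> A'"
      have "(case l ! j of None \<Rightarrow> e0 | Some e \<Rightarrow> e) y = (u ! j) y" if j: "j < N" for j
      proof -
        let ?f = "case l ! j of None \<Rightarrow> e0 | Some e \<Rightarrow> e"
        have f: "?f \<in> \<Sigma>"
        proof (cases "l ! j")
          case None then show ?thesis using e0 by simp
        next
          case (Some e)
          then have "Some e \<in> set l" using j ll(1) by (metis nth_mem)
          then show ?thesis using Some ll(3) by simp
        qed
        have uj: "u ! j \<in> \<Sigma>" using lu j by simp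
        have "is_closed L U A {x \<in> verts A. ?f x = (u ! j) x}"
          by (rule closed_agree[OF embedding_hom[OF \<Sigma>D(1)[OF f]] embedding_hom[OF \<Sigma>D(1)[OF uj]] Pu As])
        moreover have "set t \<subseteq> {x \<in> verts A. ?f x = (u ! j) x}" using conjunct2[OF ty] j unfolding A'_eq by auto
        ultimately have "y \<in> {x \<in> verts A. ?f x = (u ! j) x}" using closedD conjunct1[OF ty] by metis
        then show ?thesis by simp
      qed
      then show "y \<in> A'" unfolding A'_eq using rule_verts[OF As conjunct1[OF ty]] by simp
    qed
    note e0A = embedding_restr[OF \<Sigma>D(1)[OF e0] As Ps A'c]
    have Lw: "Lb l (e0 x) = w u x" if "x \<in> A'" for x
    proof -
      have x: "x \<in> verts A" "ln l (e0 x) = map (\<lambda>e. e x) u" using that unfolding A'_def by auto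
      then show ?thesis unfolding Lb_def w_def using eX[OF e0 x(1)] \<Sigma>D(2)[OF e0 x(1)] by simp
    qed
    have D_eq: "{x \<in> verts P. Lb l x \<in> w u ` verts A} = e0 ` A'"
    proof (intro equalityI subsetI)
      fix x assume "x \<in> {x \<in> verts P. Lb l x \<in> w u ` verts A}"
      then obtain y where y: "y \<in> verts A" "Lb l x = w u y" by blast
      then have x: "x \<in> X" "ln l x = map (\<lambda>e. e y) u" "lab x = g y" unfolding Lb_def w_def by (auto split: if_splits)
      have "ln l x ! m = x" unfolding ln_def using m ll(1) by simp
      then have "x = e0 y" unfolding x(2) e0_def using m(1) lu(1) by simp
      then show "x \<in> e0 ` A'" using x(2) y(1) unfolding A'_def by blast
    next
      fix x assume "x \<in> e0 ` A'"
      then obtain y where y: "y \<in> A'" "x = e0 y" by blast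
      then have "y \<in> verts A" unfolding A'_def by simp
      then show "x \<in> {x \<in> verts P. Lb l x \<in> w u ` verts A}" using Lw[OF y(1)] y(2) \<Sigma>D(3)[OF e0] by auto
    qed
    have As': "is_structure L (restr A A')" by (rule restr_structure[OF As A'c])
    have Dc: "is_closed L U P (e0 ` A')"
      using embedding_image_closed[OF e0A restr_U_closed[OF K_closed[OF AK] A'c] Pu] by simp
    note Ds = restr_structure[OF Ps Dc]
    have "embedding L (restr P (e0 ` A')) (restr A A') (inv_into A' e0)"
      using embedding_inv[OF e0A As' Ps] by simp
    from embedding_comp[OF this restr_embedding[OF As A'c] Ds As' As]
    have "embedding L (restr P (e0 ` A')) A (id \<circ> inv_into A' e0)" .
    then have "embedding L (restr P (e0 ` A')) A (inv_into (verts A) (w u) \<circ> Lb l)"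
    proof (rule embedding_cong[OF _ _ Ds As])
      fix x assume "x \<in> verts (restr P (e0 ` A'))"
      then obtain y where y: "y \<in> A'" "x = e0 y" by auto
      have "inj_on e0 A'" using e0A unfolding embedding_def by simp
      moreover have "y \<in> verts A" using y(1) unfolding A'_def by simp
      ultimately show "(id \<circ> inv_into A' e0) x = (inv_into (verts A) (w u) \<circ> Lb l) x"
        using y Lw[OF y(1)] winj[of u] by simp
    qed
    then show ?thesis unfolding D_eq by (rule hom_emb_on_of_embedding[OF Ps As Dc])
  qed
  have "\<exists>H l'. partite_extension L U K k A (w ` Wd) Q lb H l'"
  proof (rule partite_construction[OF AK _ Q_U_closed Q_finite])
    show "finite (w ` Wd)" using Wfin by simp
    fix v assume "v \<in> w ` Wd"
    then obtain u where u: "u \<in> Wd" "v = w u" by blast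
    show "inj_on v (verts A)" unfolding u(2) by (rule winj)
    show "hom_emb_on L U Q {x \<in> verts Q. lb x \<in> v ` verts A} A (inv_into (verts A) v \<circ> lb)"
      unfolding u(2) by (rule union_hom_emb_on[OF As lb chart[OF _ u(1)]])
  qed
  then obtain H l' where H: "U_closed L U H" "finite (verts H)" "locally_in L U H l' Q lb" "uniform_copies L k A (w ` Wd) Q lb H l'"
    unfolding partite_extension_def by blast
  note Hs = U_closed_structure[OF H(1)]
  have lfst: "locally_in L U Q (fst \<circ> lb) P lab"
  proof (rule union_locally_in[OF Ps])
    show "\<forall>i\<in>I. \<forall>x\<in>verts P. (fst \<circ> lb) (J i x) = (\<lambda>_. lab) i x" using lb by (simp add: Lb_def)
    show "locally_in L U P lab P lab" by (rule locally_in_refl[OF Ps])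
  qed
  have "locally_in L U H (fst \<circ> l') Q (fst \<circ> lb)"
    by (rule locally_in_map[OF H(3), where g = fst]) simp_all
  then have "locally_in L U H (fst \<circ> l') P lab"
    by (rule locally_in_trans[OF H(1) Q_U_closed Ps _ lfst])
  moreover have "uniform_copies L k A {g} P lab H (fst \<circ> l')"
  proof (rule uniform_copiesI)
    fix \<chi> :: "nat set \<Rightarrow> nat" assume \<chi>: "\<And>X. \<chi> X < k"
    obtain j where j: "embedding L Q H j" "\<forall>x\<in>verts Q. l' (j x) = lb x"
      "\<forall>v\<in>w ` Wd. \<exists>c. \<forall>e. embedding L A Q e \<and> (\<forall>x\<in>verts A. lb (e x) = v x) \<longrightarrow> \<chi> (j ` e ` verts A) = c"
      by (rule uniform_copiesE[OF H(4) \<chi>])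
    define sc where "sc u e \<longleftrightarrow> embedding L A Q e \<and> (\<forall>x\<in>verts A. lb (e x) = w u x)" for u e
    define \<psi> where "\<psi> u = \<chi> (j ` (SOME e. sc u e) ` verts A)" for u
    have col: "\<chi> (j ` e ` verts A) = \<psi> u" if "u \<in> Wd" "sc u e" for u e
    proof -
      have "w u \<in> w ` Wd" using that(1) by blast
      from bspec[OF j(3) this] obtain c where c: "\<forall>e. sc u e \<longrightarrow> \<chi> (j ` e ` verts A) = c"
        unfolding sc_def by (elim exE)
      have "sc u (SOME e. sc u e)" using that(2) by (rule someI[where P = "sc u"])
      then show ?thesis unfolding \<psi>_def using c that(2) by simp
    qed
    have "\<forall>u. \<psi> u < k" unfolding \<psi>_def using \<chi> by blast
    then obtain l c where l: "comb_line \<Sigma> N l" "\<forall>s\<in>\<Sigma>. \<psi> (line_word l s) = c"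
      using N unfolding hales_jewett_def by blast
    have lI: "l \<in> I" unfolding I_def using l(1) by simp
    have "\<chi> ((j \<circ> J l) ` e ` verts A) = c" if e: "embedding L A P e" "\<forall>x\<in>verts A. lab (e x) = g x" for e
    proof -
      let ?e = "restrict e (verts A)"
      have s: "?e \<in> \<Sigma>" by (rule sec[OF e])
      have u: "line_word l ?e \<in> Wd" unfolding Wd_def using line_word_in_alphabet[OF l(1) s] by simp
      have "lb ((J l \<circ> e) x) = w (line_word l ?e) x" if x: "x \<in> verts A" for x
      proof -
        have "e x \<in> verts P" using hom_verts[OF embedding_hom[OF e(1)]] x by blast
        then have "lb (J l (e x)) = Lb l (e x)" using lb lI by blast
        moreover have "e x \<in> X" using eX[OF s x] x by simp
        moreover have "ln l (e x) = map (\<lambda>e. e x) (line_word l ?e)"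
          unfolding ln_def line_word_def using invg[OF s x] x by (auto split: option.splits)
        ultimately show ?thesis unfolding Lb_def w_def using e(2) x by simp
      qed
      moreover have "embedding L A Q (J l \<circ> e)" by (rule embedding_comp[OF e(1) J_embedding[OF lI] As Ps Q_structure])
      ultimately have "sc (line_word l ?e) (J l \<circ> e)" unfolding sc_def by simp
      then have "\<chi> (j ` (J l \<circ> e) ` verts A) = \<psi> (line_word l ?e)" by (rule col[OF u])
      then show ?thesis using l(2) s by (simp add: image_comp comp_assoc)
    qed
    moreover have "embedding L P H (j \<circ> J l)" by (rule embedding_comp[OF J_embedding[OF lI] j(1) Ps Q_structure Hs])
    moreover have "(fst \<circ> l') ((j \<circ> J l) x) = lab x" if "x \<in> verts P" for x
    proof -
      have "J l x \<in> verts Q" using union_verts lI that by blast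
      then show ?thesis using j(2) lb lI that by (simp add: Lb_def)
    qed
    ultimately show "\<exists>j. embedding L P H j \<and> (\<forall>x\<in>verts P. (fst \<circ> l') (j x) = lab x) \<and>
        (\<forall>w\<in>{g}. \<exists>c. \<forall>e. embedding L A P e \<and> (\<forall>x\<in>verts A. lab (e x) = w x) \<longrightarrow> \<chi> (j ` e ` verts A) = c)"
      by (intro exI[of _ "j \<circ> J l"] conjI ballI) (assumption | blast)+
  qed
  ultimately show ?thesis using H(1,2) by blast
qed

lemma uniform_iterate:
  fixes P A :: "('r, 'f, nat) lstruct" and lab :: "nat \<Rightarrow> 'l"
  assumes AK: "A \<in> K" and "finite W" "U_closed L U P" "finite (verts P)" "\<And>w. w \<in> W \<Longrightarrow> inj_on w (verts A)" and k: "k > 0"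
  shows "\<exists>Q lab'. U_closed L U Q \<and> finite (verts Q) \<and> locally_in L U Q lab' P lab \<and> uniform_copies L k A W P lab Q lab'"
  using assms(2-5)
proof (induction W arbitrary: P lab rule: finite_induct)
  case empty
  note Ps = U_closed_structure[OF empty(1)]
  show ?case using empty locally_in_refl[OF Ps, of lab] uniform_copies_refl[OF Ps, of k A lab] by blast
next
  case (insert w W)
  note As = K_structure[OF AK] and Ps = U_closed_structure[OF insert.prems(1)]
  have "inj_on w (verts A)" using insert.prems(3) by simp
  from uniform_step[OF AK insert.prems(1,2) this k]
  obtain Q1 l1 where 1: "U_closed L U Q1" "finite (verts Q1)" "locally_in L U Q1 l1 P lab" "uniform_copies L k A {w} P lab Q1 l1"
    by blast
  obtain Q lab' where 2: "U_closed L U Q" "finite (verts Q)" "locally_in L U Q lab' Q1 l1" "uniform_copies L k A W Q1 l1 Q lab'"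
    using insert.IH[OF 1(1,2)] insert.prems(3) by blast
  have "locally_in L U Q lab' P lab" by (rule locally_in_trans[OF 2(1) 1(1) Ps 2(3) 1(3)])
  moreover have "uniform_copies L k A (insert w W) P lab Q lab'"
    using uniform_copies_trans[OF 1(4) 2(4) As Ps U_closed_structure[OF 1(1)] U_closed_structure[OF 2(1)]] by simp
  ultimately show ?case using 2(1,2) by blast
qed

end

context closure_setting
begin

section \<open>Systems of copies over a base\<close>

text \<open>A colouring of \<open>Q\<close> that is uniform on a copy of \<open>P\<close> induces a colouring of the copies
  of \<open>A\<close> in the base \<open>C\<close>. A copy of \<open>B\<close> in \<open>C\<close> on which it is constant lifts to the
  corresponding copy of \<open>B\<close> in \<open>P\<close>.\<close>
lemma arrow_lift:
  fixes A B C P Q :: "('r, 'f, nat) lstruct" and lb :: "nat \<Rightarrow> nat"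
  assumes arrow: "set_arrow L C B A k" and k: "k > 0"
    and st: "is_structure L A" "is_structure L B" "is_structure L C" "is_structure L P" "is_structure L Q"
    and sections: "\<forall>b. embedding L B C b \<longrightarrow> (\<exists>j. embedding L B P j \<and> (\<forall>x\<in>verts B. lb (j x) = b x))"
    and unif: "uniform_copies L k A {w \<in> verts A \<rightarrow>\<^sub>E verts C. embedding L A C w} P lb Q lab'"
  shows "set_arrow L Q B A k"
  unfolding set_arrow_def
proof (intro allI impI)
  fix \<chi> :: "nat set \<Rightarrow> nat" assume \<chi>: "\<forall>X. \<chi> X < k"
  define W where "W = {w \<in> verts A \<rightarrow>\<^sub>E verts C. embedding L A C w}"
  define sc where "sc w e \<longleftrightarrow> embedding L A P e \<and> (\<forall>x\<in>verts A. lb (e x) = w x)" for w e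
  have \<chi>': "\<And>X. \<chi> X < k" using \<chi> by simp
  obtain j where j: "embedding L P Q j"
    "\<forall>w\<in>W. \<exists>c. \<forall>e. embedding L A P e \<and> (\<forall>x\<in>verts A. lb (e x) = w x) \<longrightarrow> \<chi> (j ` e ` verts A) = c"
    unfolding W_def by (rule uniform_copiesE[OF unif \<chi>'])
  define cc where "cc w = \<chi> (j ` (SOME e. sc w e) ` verts A)" for w
  have col: "\<chi> (j ` e ` verts A) = cc w" if "w \<in> W" "sc w e" for w e
  proof -
    from bspec[OF j(2) that(1)] obtain c where c: "\<forall>e. sc w e \<longrightarrow> \<chi> (j ` e ` verts A) = c"
      unfolding sc_def by (elim exE)
    have "sc w (SOME e. sc w e)" using that(2) by (rule someI[where P = "sc w"])
    then show ?thesis unfolding cc_def using c that(2) by simp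
  qed
  \<comment> \<open>A copy of \<open>A\<close> may be the image of several embeddings. Any choice works, because the copy
    that it gives in \<open>B\<close> is determined by the image.\<close>
  define pick where "pick X = (SOME w. w \<in> W \<and> w ` verts A = X)" for X
  have pk: "\<And>X. cc (pick X) < k" unfolding cc_def using \<chi> by simp
  obtain b c where bc: "c < k" "embedding L B C b"
    "\<forall>e. embedding L A B e \<longrightarrow> cc (pick (b ` e ` verts A)) = c"
    by (rule set_arrowE[OF arrow, of "\<lambda>X. cc (pick X)", OF pk])
  obtain jb where jb: "embedding L B P jb" "\<forall>x\<in>verts B. lb (jb x) = b x" using sections bc(2) by blast
  have "\<chi> ((j \<circ> jb) ` e ` verts A) = c" if e: "embedding L A B e" for e
  proof -
    have be: "embedding L A C (b \<circ> e)" by (rule embedding_comp[OF e bc(2) st(1-3)])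
    have "restrict (b \<circ> e) (verts A) \<in> W \<and> restrict (b \<circ> e) (verts A) ` verts A = b ` e ` verts A"
    proof
      have "embedding L A C (restrict (b \<circ> e) (verts A))" by (rule embedding_cong[OF be _ st(1,3)]) simp
      then show "restrict (b \<circ> e) (verts A) \<in> W"
        unfolding W_def using hom_verts[OF embedding_hom[OF be]] by auto
    qed (simp add: image_comp)
    then have w: "pick (b ` e ` verts A) \<in> W" "pick (b ` e ` verts A) ` verts A = b ` e ` verts A"
      unfolding pick_def by (metis (mono_tags, lifting) someI_ex)+
    define w where "w = pick (b ` e ` verts A)"
    have wC: "embedding L A C w" using w(1) unfolding w_def W_def by simp
    have eB: "e ` verts A \<subseteq> verts B" by (rule hom_verts[OF embedding_hom[OF e]])
    then have sub: "w ` verts A \<subseteq> b ` verts B" unfolding w_def w(2) by (rule image_mono)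
    note f = embedding_factor[OF wC bc(2) sub st(1-3)]
    define e1 where "e1 = inv_into (verts B) b \<circ> w"
    have e1: "embedding L A B e1" "\<And>x. x \<in> verts A \<Longrightarrow> b (e1 x) = w x" using f unfolding e1_def by simp_all
    have e1B: "e1 ` verts A \<subseteq> verts B" by (rule hom_verts[OF embedding_hom[OF e1(1)]])
    have "b ` e1 ` verts A = w ` verts A" using e1(2) by (simp add: image_image)
    then have "b ` e1 ` verts A = b ` e ` verts A" unfolding w_def w(2) .
    moreover have "inj_on b (verts B)" using bc(2) unfolding embedding_def by simp
    ultimately have same: "e1 ` verts A = e ` verts A" using e1B eB by (simp add: inj_on_image_eq_iff)
    have "sc w (jb \<circ> e1)"
      unfolding sc_def
    proof (intro conjI ballI)
      show "embedding L A P (jb \<circ> e1)" by (rule embedding_comp[OF e1(1) jb(1) st(1,2,4)])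
      fix x assume x: "x \<in> verts A"
      then have "e1 x \<in> verts B" using e1B by blast
      then show "lb ((jb \<circ> e1) x) = w x" using jb(2) e1(2)[OF x] by simp
    qed
    then have "\<chi> (j ` (jb \<circ> e1) ` verts A) = cc w" using w(1) unfolding w_def by (intro col)
    moreover have "cc w = c" using bc(3) e unfolding w_def by simp
    moreover have "(j \<circ> jb) ` e ` verts A = j ` (jb \<circ> e1) ` verts A" using same by (metis image_comp)
    ultimately show ?thesis by metis
  qed
  moreover have "embedding L B Q (j \<circ> jb)" by (rule embedding_comp[OF jb(1) j(1) st(2,4,5)])
  ultimately show "\<exists>b c. c < k \<and> embedding L B Q b \<and> (\<forall>e. embedding L A B e \<longrightarrow> \<chi> (b ` e ` verts A) = c)"
    using bc(1) by blast
qed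

end

context class_setting
begin

lemma locally_in_K:
  assumes Q: "U_closed L U Q" and C: "U_closed L U C" and loc: "locally_in L U Q lQ C lC"
    and KC: "\<And>Z. irreducible_in L U C Z \<Longrightarrow> restr C Z \<in> K" and Z: "irreducible_in L U Q Z"
  shows "restr Q Z \<in> K"
proof -
  obtain p where p: "embedding L (restr Q Z) C p" using loc Z unfolding locally_in_def by blast
  note pZ = irreducible_in_push[OF Q C Z p]
  have cZ: "is_closed L U Q Z" using Z unfolding irreducible_in_def by simp
  note Zs = restr_structure[OF U_closed_structure[OF Q] cZ]
  note iv = embedding_inv[OF p Zs U_closed_structure[OF C]]
  have pC: "restr C (p ` Z) \<in> K" by (rule KC[OF pZ(1)])
  have "inj_on p Z" using p unfolding embedding_def by simp
  then have "inv_into Z p ` p ` Z = Z" by simp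
  then have "isomorphic L (restr C (p ` Z)) (restr Q Z)"
    unfolding isomorphic_def using iv by (intro exI[of _ "inv_into Z p"]) simp
  then show ?thesis by (rule K_iso[OF pC Zs])
qed

text \<open>The disjoint union of copies of \<open>B\<close> over a base \<open>C\<close>, one for each embedding of \<open>B\<close>
  into \<open>C\<close>, every vertex being labelled by its image.\<close>
lemma copy_system:
  fixes B C :: "('r, 'f, nat) lstruct"
  assumes BK: "B \<in> K" and Cs: "is_structure L C" and Cf: "finite (verts C)"
  shows "\<exists>(P :: ('r, 'f, nat) lstruct) lb. U_closed L U P \<and> finite (verts P) \<and>
    (\<forall>b. embedding L B C b \<longrightarrow> (\<exists>j. embedding L B P j \<and> (\<forall>x\<in>verts B. lb (j x) = b x))) \<and>
    locally_in L U P (\<lambda>_. ()) B (\<lambda>_. ()) \<and> locally_in L U P lb C id \<and> hom_emb_on L U P (verts P) C lb \<and>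
    (\<forall>n. completable L U K P n)"
proof -
  note Bs = K_structure[OF BK] and Bu = K_closed[OF BK]
  define I where "I = {b \<in> verts B \<rightarrow>\<^sub>E verts C. embedding L B C b}"
  have If: "finite I" unfolding I_def
    using finite_PiE[of "verts B" "\<lambda>_. verts C"] K_finite[OF BK] Cf by simp
  have Ie: "embedding L B C b" if "b \<in> I" for b using that unfolding I_def by simp
  obtain a J where du: "disjoint_union L U B I a J"
    using ex_disjoint_union[OF Bu K_finite[OF BK] If] by blast
  interpret disjoint_union L U B I a J by (rule du)
  obtain lb where lb: "\<forall>b\<in>I. \<forall>x\<in>verts B. lb (J b x) = b x" using ex_label[of "\<lambda>b x. b x"] by blast
  have lB: "locally_in L U Q (\<lambda>_. ()) B (\<lambda>_. ())"
    by (rule union_locally_in[OF Bs _ locally_in_refl[OF Bs]]) simp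
  have lC: "locally_in L U Q lb C id"
  proof (rule union_locally_in[OF Cs lb])
    fix b assume b: "b \<in> I"
    show "locally_in L U B b C id"
      unfolding locally_in_def
    proof (intro allI impI exI[of _ b] conjI)
      fix Z assume "irreducible_in L U B Z"
      then have "is_closed L U B Z" unfolding irreducible_in_def by simp
      then show "embedding L (restr B Z) C b" by (rule embedding_restr[OF Ie[OF b] Bs Cs])
    qed simp
  qed
  have uC: "hom_emb_on L U Q {z \<in> verts Q. lb z \<in> UNIV} C (id \<circ> lb)"
  proof (rule union_hom_emb_on[OF Cs lb])
    fix b assume b: "b \<in> I"
    show "hom_emb_on L U B {x \<in> verts B. b x \<in> UNIV} C (id \<circ> b)"
      using hom_emb_on_of_embedding[OF Bs Cs closed_verts[OF Bs]] Ie[OF b] restr_verts[OF Bs] by simp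
  qed
  have sec: "\<exists>j. embedding L B Q j \<and> (\<forall>x\<in>verts B. lb (j x) = b x)" if b: "embedding L B C b" for b
  proof -
    have "embedding L B C (restrict b (verts B))" by (rule embedding_cong[OF b _ Bs Cs]) simp
    then have r: "restrict b (verts B) \<in> I" unfolding I_def using hom_verts[OF embedding_hom[OF b]] by auto
    have "\<forall>x\<in>verts B. lb (J (restrict b (verts B)) x) = b x" using bspec[OF lb r] by simp
    then show ?thesis using J_embedding[OF r] by blast
  qed
  show ?thesis
    by (intro exI[of _ Q] exI[of _ lb] conjI allI impI Q_U_closed Q_finite lB lC sec union_completable[OF du BK])
      (use uC in simp_all)
qed

text \<open>The requirements on \<open>C\<close> under which the multiamalgamation property with parameter \<open>n\<close>
  yields a member of the class with the arrow.\<close>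
definition ramsey_witness :: "('r, 'f, nat) lstruct \<Rightarrow> ('r, 'f, nat) lstruct \<Rightarrow> nat \<Rightarrow> ('r, 'f, nat) lstruct
    \<Rightarrow> nat \<Rightarrow> ('r, 'f, nat) lstruct \<Rightarrow> bool" where
  "ramsey_witness A B k C0 n C \<longleftrightarrow> U_closed L U C \<and> finite (verts C) \<and> set_arrow L C B A k \<and>
     (\<exists>h. hom_emb_on L U C (verts C) C0 h) \<and> (\<forall>Z. irreducible_in L U C Z \<longrightarrow> restr C Z \<in> K) \<and> completable L U K C n"

lemma finite_embeddings: "A \<in> K \<Longrightarrow> finite (verts C) \<Longrightarrow> finite {w \<in> verts A \<rightarrow>\<^sub>E verts C. embedding L A C w}"
  using finite_PiE[of "verts A" "\<lambda>_. verts C"] K_finite by simp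

text \<open>The empty set generates the empty structure only.\<close>
lemma completable_0:
  fixes C :: "('r, 'f, nat) lstruct"
  assumes E: "E \<in> K"
  shows "completable L U K C 0"
proof -
  have c: "completes L U K C {} E (\<lambda>_. 0)" (is "completes L U K C {} E ?f")
  proof (rule completesI)
    fix M and h :: "nat \<Rightarrow> nat" assume M: "M \<in> K" and g: "generates L U M {x \<in> verts M. h x \<in> {}}"
    have "verts M \<subseteq> {}"
      using g[unfolded generates_def, rule_format, of "{}"] closed_empty[OF K_structure[OF M]] by simp
    then have "embedding L M E (?f \<circ> h)" using vacuous_embedding[OF K_structure[OF M] _ K_structure[OF E]] by simp
    then show "\<exists>\<alpha>. embedding L M E \<alpha> \<and> (\<forall>x\<in>verts M. h x \<in> {} \<longrightarrow> \<alpha> x = ?f (h x))" by auto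
  qed
  show ?thesis
    unfolding completable_def
  proof (intro allI impI)
    fix S :: "nat set" assume "S \<subseteq> verts C \<and> finite S \<and> card S \<le> 0"
    then have "S = {}" by auto
    then show "\<exists>E\<in>K. \<exists>f. completes L U K C S E f" using c E by blast
  qed
qed

lemma system_irreducible_in_K:
  assumes Q: "U_closed L U Q" and P: "U_closed L U P" and BK: "B \<in> K"
    and QP: "locally_in L U Q lQ P lP" and PB: "locally_in L U P (\<lambda>_. ()) B (\<lambda>_. ())"
    and Z: "irreducible_in L U Q Z"
  shows "restr Q Z \<in> K"
proof (rule locally_in_K[OF Q K_closed[OF BK] _ _ Z])
  have "locally_in L U Q (\<lambda>_. ()) P (\<lambda>_. ())" by (rule locally_in_map[OF QP, of _ "\<lambda>_. ()"]) simp_all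
  then show "locally_in L U Q (\<lambda>_. ()) B (\<lambda>_. ())"
    by (rule locally_in_trans[OF Q P K_structure[OF BK] _ PB])
  show "restr B Z \<in> K" if "irreducible_in L U B Z" for Z using K_restr[OF BK] that unfolding irreducible_in_def by simp
qed

text \<open>The first round. As \<open>C0\<close> may fail to be \<open>\<U>\<close>-closed, uniform colours come from
  \<open>uniform_iterate\<close>.\<close>
lemma ramsey_witness_0:
  fixes A B C0 :: "('r, 'f, nat) lstruct"
  assumes AK: "A \<in> K" and BK: "B \<in> K" and C0: "is_structure L C0" "finite (verts C0)"
    and arrow: "set_arrow L C0 B A k" and k: "k > 0"
  shows "\<exists>C. ramsey_witness A B k C0 0 C"
proof -
  define W where "W = {w \<in> verts A \<rightarrow>\<^sub>E verts C0. embedding L A C0 w}"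
  have Wf: "finite W" unfolding W_def by (rule finite_embeddings[OF AK C0(2)])
  have Wi: "inj_on w (verts A)" if "w \<in> W" for w using that unfolding W_def embedding_def by simp
  obtain P and lb :: "nat \<Rightarrow> nat" where P: "U_closed L U P" "finite (verts P)"
    "\<forall>b. embedding L B C0 b \<longrightarrow> (\<exists>j. embedding L B P j \<and> (\<forall>x\<in>verts B. lb (j x) = b x))"
    "locally_in L U P (\<lambda>_. ()) B (\<lambda>_. ())" "hom_emb_on L U P (verts P) C0 lb"
    using copy_system[OF BK C0] by (elim exE conjE)
  have "\<exists>Q lab'. U_closed L U Q \<and> finite (verts Q) \<and> locally_in L U Q lab' P lb \<and> uniform_copies L k A W P lb Q lab'"
    by (rule uniform_iterate[OF AK Wf P(1,2) Wi k])
  then obtain Q lab' where Q: "U_closed L U Q" "finite (verts Q)" "locally_in L U Q lab' P lb"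
    "uniform_copies L k A W P lb Q lab'" by (elim exE conjE)
  have "set_arrow L Q B A k"
    by (rule arrow_lift[OF arrow k K_structure[OF AK] K_structure[OF BK] C0(1) U_closed_structure[OF P(1)]
        U_closed_structure[OF Q(1)] P(3) Q(4)[unfolded W_def]])
  moreover have "hom_emb_on L U Q {x \<in> verts Q. lab' x \<in> UNIV} C0 (id \<circ> lab')"
    by (rule locally_in_hom_emb_on[OF Q(1) P(1) C0(1) Q(3)]) (use P(5) in simp)
  moreover have "\<forall>Z. irreducible_in L U Q Z \<longrightarrow> restr Q Z \<in> K" using system_irreducible_in_K[OF Q(1) P(1) BK Q(3) P(4)] by simp
  ultimately have "ramsey_witness A B k C0 0 Q"
    unfolding ramsey_witness_def using Q(1,2) completable_0[OF BK] by auto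
  then show ?thesis ..
qed

text \<open>The base is \<open>\<U>\<close>-closed now, hence embedded copies of \<open>A\<close> are closed in it and their
  inverses provide charts. The system of copies is locally in the base, which gives charts
  in the system too and a homomorphism-embedding to \<open>C0\<close> by composition.\<close>
lemma ramsey_witness_Suc:
  fixes A B C0 C :: "('r, 'f, nat) lstruct"
  assumes AK: "A \<in> K" and BK: "B \<in> K" and C0: "is_structure L C0" and k: "k > 0"
    and wit: "ramsey_witness A B k C0 n C"
  shows "\<exists>C'. ramsey_witness A B k C0 (Suc n) C'"
proof -
  have Cu: "U_closed L U C" and Cf: "finite (verts C)" and arrow: "set_arrow L C B A k" and Cn: "completable L U K C n"
    using wit unfolding ramsey_witness_def by auto
  obtain h where h: "hom_emb_on L U C (verts C) C0 h" using wit unfolding ramsey_witness_def by (elim conjE exE)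
  note Cs = U_closed_structure[OF Cu] and As = K_structure[OF AK]
  define W where "W = {w \<in> verts A \<rightarrow>\<^sub>E verts C. embedding L A C w}"
  have Wf: "finite W" unfolding W_def by (rule finite_embeddings[OF AK Cf])
  have We: "embedding L A C w" if "w \<in> W" for w using that unfolding W_def by simp
  have Wi: "inj_on w (verts A)" if "w \<in> W" for w using We[OF that] unfolding embedding_def by simp
  obtain P and lb :: "nat \<Rightarrow> nat" where P: "U_closed L U P" "finite (verts P)"
    "\<forall>b. embedding L B C b \<longrightarrow> (\<exists>j. embedding L B P j \<and> (\<forall>x\<in>verts B. lb (j x) = b x))"
    "locally_in L U P (\<lambda>_. ()) B (\<lambda>_. ())" "locally_in L U P lb C id" "hom_emb_on L U P (verts P) C lb"
    "\<forall>n. completable L U K P n"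
    using copy_system[OF BK Cs Cf] by (elim exE conjE)
  have chart: "hom_emb_on L U P {x \<in> verts P. lb x \<in> w ` verts A} A (inv_into (verts A) w \<circ> lb)" if w: "w \<in> W" for w
  proof (rule locally_in_hom_emb_on[OF P(1) Cu As P(5)])
    have c: "is_closed L U C (w ` verts A)" by (rule embedding_image_closed[OF We[OF w] K_closed[OF AK] Cu])
    have "hom_emb_on L U C (w ` verts A) A (inv_into (verts A) w)"
      by (rule hom_emb_on_of_embedding[OF Cs As c embedding_inv[OF We[OF w] As Cs]])
    moreover have "{x \<in> verts C. id x \<in> w ` verts A} = w ` verts A" using closed_subset[OF c] by auto
    ultimately show "hom_emb_on L U C {x \<in> verts C. id x \<in> w ` verts A} A (inv_into (verts A) w \<circ> id)" by simp
  qed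
  have "\<exists>Q lab'. partite_extension L U K k A W P lb Q lab'"
    by (rule partite_construction[OF AK Wf P(1,2) Wi chart])
  then obtain Q lab' where pe: "partite_extension L U K k A W P lb Q lab'" by (elim exE)
  then have Q: "U_closed L U Q" "finite (verts Q)" "locally_in L U Q lab' P lb" "uniform_copies L k A W P lb Q lab'"
    and tr: "\<And>(G :: ('r, 'f, nat) lstruct) gm n. is_structure L G \<Longrightarrow> hom_emb_on L U P (verts P) G (gm \<circ> lb) \<Longrightarrow>
        \<forall>w\<in>W. embedding L A G (gm \<circ> w) \<Longrightarrow> completable L U K G n \<Longrightarrow> completable L U K P (Suc n) \<Longrightarrow>
        completable L U K Q (Suc n)"
    unfolding partite_extension_def by simp_all
  have "set_arrow L Q B A k"
    by (rule arrow_lift[OF arrow k As K_structure[OF BK] Cs U_closed_structure[OF P(1)]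
        U_closed_structure[OF Q(1)] P(3) Q(4)[unfolded W_def]])
  moreover have "hom_emb_on L U Q {x \<in> verts Q. lab' x \<in> UNIV} C0 (h \<circ> lab')"
    by (rule locally_in_hom_emb_on[OF Q(1) Cu C0 locally_in_trans[OF Q(1) P(1) Cs Q(3) P(5)]]) (use h in simp)
  moreover have "\<forall>Z. irreducible_in L U Q Z \<longrightarrow> restr Q Z \<in> K" using system_irreducible_in_K[OF Q(1) P(1) BK Q(3) P(4)] by simp
  moreover have "completable L U K Q (Suc n)"
    by (rule tr[of C id]) (use Cs P(6,7) We Cn in simp_all)
  ultimately have "ramsey_witness A B k C0 (Suc n) Q"
    unfolding ramsey_witness_def using Q(1,2) by auto
  then show ?thesis ..
qed

lemma ramsey_witness_exists:
  fixes A B C0 :: "('r, 'f, nat) lstruct"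
  assumes "A \<in> K" "B \<in> K" "is_structure L C0" "finite (verts C0)" "set_arrow L C0 B A k" "k > 0"
  shows "\<exists>C. ramsey_witness A B k C0 n C"
proof (induction n)
  case 0
  show ?case by (rule ramsey_witness_0[OF assms])
next
  case (Suc n)
  then obtain C where "ramsey_witness A B k C0 n C" ..
  then show ?case by (rule ramsey_witness_Suc[OF assms(1-3,6)])
qed

end

section \<open>From vertex sets to partitions of copies\<close>

lemma embedding_copy:
  assumes e: "embedding L A C e" and A: "is_structure L A" and C: "is_structure L C"
  shows "restr C (e ` verts A) \<in> copies L C A"
proof -
  note c = embedding_image_closed_empty[OF e A C]
  have "embedding L A (restr C (e ` verts A)) e" by (rule embedding_into_restr[OF e A C c subset_refl])
  then have "isomorphic L A (restr C (e ` verts A))" unfolding isomorphic_def by auto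
  then show ?thesis unfolding copies_def using restr_substructure[OF C c] by simp
qed

lemma copy_embedding:
  assumes "A' \<in> copies L C A" and A: "is_structure L A"
  obtains e where "embedding L A A' e" "embedding L A C e" "e ` verts A = verts A'" "A' = restr C (verts A')"
    "substructure L A' C"
proof -
  have sub: "substructure L A' C" and "isomorphic L A A'" using assms(1) unfolding copies_def by auto
  then obtain e where e: "embedding L A A' e" "e ` verts A = verts A'" unfolding isomorphic_def by (elim exE conjE)
  have s: "is_structure L A'" "is_structure L C" "embedding L A' C id" using sub unfolding substructure_def by auto
  have "embedding L A C (id \<circ> e)" by (rule embedding_comp[OF e(1) s(3) A s(1,2)])
  then show ?thesis using that[OF e(1) _ e(2) _ sub] substructure_restr[OF sub] by simp
qed

lemma set_arrow_of_ramsey_arrow: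
  assumes arrow: "ramsey_arrow L C B A k"
    and A: "is_structure L A" and B: "is_structure L B" and C: "is_structure L C"
  shows "set_arrow L C B A k"
  unfolding set_arrow_def
proof (intro allI impI)
  fix \<chi> :: "nat set \<Rightarrow> nat" assume \<chi>: "\<forall>X. \<chi> X < k"
  define P where "P i = {A' \<in> copies L C A. \<chi> (verts A') = i}" for i
  have "disjoint_family_on P {..<k}" unfolding disjoint_family_on_def P_def by auto
  moreover have "(\<Union>i<k. P i) = copies L C A" unfolding P_def using \<chi> by auto
  ultimately obtain B' i where B': "B' \<in> copies L C B" and i: "i < k" "copies L B' A \<subseteq> P i"
    using arrow unfolding ramsey_arrow_def by meson
  obtain b where b: "embedding L B B' b" "embedding L B C b" "substructure L B' C" by (rule copy_embedding[OF B' B])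
  have B's: "is_structure L B'" using b(3) unfolding substructure_def by simp
  have "\<chi> (b ` e ` verts A) = i" if e: "embedding L A B e" for e
  proof -
    have "embedding L A B' (b \<circ> e)" by (rule embedding_comp[OF e b(1) A B B's])
    from embedding_copy[OF this A B's] i(2) have "restr B' ((b \<circ> e) ` verts A) \<in> P i" by blast
    then show ?thesis unfolding P_def by (simp add: image_comp)
  qed
  then show "\<exists>b c. c < k \<and> embedding L B C b \<and> (\<forall>e. embedding L A B e \<longrightarrow> \<chi> (b ` e ` verts A) = c)"
    using b(2) i(1) by blast
qed

text \<open>A set \<open>X\<close> of vertices of \<open>C\<close> gets the number of the class containing the substructure
  of \<open>C'\<close> on the image of \<open>X\<close>, and \<open>0\<close> if there is none. On a copy of \<open>B\<close> the map \<open>f\<close> is an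
  embedding, so that copies of \<open>A\<close> inside it go to copies of \<open>A\<close>.\<close>
lemma ramsey_arrow_of_completion:
  fixes A B C C' :: "('r, 'f, nat) lstruct"
  assumes arrow: "set_arrow L C B A k" and k: "k \<ge> 1" and compl: "completion_wrt_copies L C' C B"
    and A: "is_structure L A" and B: "is_structure L B" and C: "is_structure L C"
  shows "ramsey_arrow L C' B A k"
  unfolding ramsey_arrow_def
proof (intro allI impI)
  fix P :: "nat \<Rightarrow> ('r, 'f, nat) lstruct set"
  assume "disjoint_family_on P {..<k} \<and> (\<Union>i<k. P i) = copies L C' A"
  then have disj: "disjoint_family_on P {..<k}" and cover: "(\<Union>i<k. P i) = copies L C' A" by auto
  have C': "is_structure L C'"
    using compl unfolding completion_wrt_copies_def irreducible_structure_def by (elim conjE)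
  obtain f where f: "\<forall>B'\<in>copies L C B. embedding L B' C' f"
    using compl unfolding completion_wrt_copies_def by (elim exE conjE)
  define good where "good X i \<longleftrightarrow> i < k \<and> restr C' (f ` X) \<in> P i" for X i
  define \<chi> where "\<chi> X = (if \<exists>i. good X i then SOME i. good X i else 0)" for X
  have good_\<chi>: "good X (\<chi> X)" if "good X i" for X i
    unfolding \<chi>_def using someI[of "good X", OF that] that by auto
  have \<chi>k: "\<And>X. \<chi> X < k"
  proof -
    fix X show "\<chi> X < k"
    proof (cases "\<exists>i. good X i")
      case True
      then show ?thesis using good_\<chi> unfolding good_def by blast
    next
      case False
      then have "\<chi> X = 0" unfolding \<chi>_def by (rule if_not_P)
      then show ?thesis using k by simp
    qed
  qed
  obtain b c where bc: "c < k" "embedding L B C b" "\<forall>e. embedding L A B e \<longrightarrow> \<chi> (b ` e ` verts A) = c"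
    by (rule set_arrowE[OF arrow, of \<chi>, OF \<chi>k])
  let ?B = "restr C (b ` verts B)"
  have cB: "?B \<in> copies L C B" by (rule embedding_copy[OF bc(2) B C])
  then have fB: "embedding L ?B C' f" and Bs: "is_structure L ?B"
    using f unfolding copies_def substructure_def by auto
  have bB: "embedding L B ?B b"
    by (rule embedding_into_restr[OF bc(2) B C embedding_image_closed_empty[OF bc(2) B C] subset_refl])
  have fb: "embedding L B C' (f \<circ> b)" by (rule embedding_comp[OF bB fB B Bs C'])
  let ?B' = "restr C' ((f \<circ> b) ` verts B)"
  have B': "?B' \<in> copies L C' B" by (rule embedding_copy[OF fb B C'])
  then have B's: "is_structure L ?B'" "embedding L ?B' C' id" unfolding copies_def substructure_def by auto
  have "A' \<in> P c" if A': "A' \<in> copies L ?B' A" for A'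
  proof -
    obtain e where e: "embedding L A ?B' e" "e ` verts A = verts A'" "A' = restr ?B' (verts A')"
      by (rule copy_embedding[OF A' A])
    have eC: "embedding L A C' e" using embedding_comp[OF e(1) B's(2) A B's(1) C'] by simp
    have sub: "e ` verts A \<subseteq> (f \<circ> b) ` verts B" using hom_verts[OF embedding_hom[OF e(1)]] by simp
    then have A'C: "A' = restr C' (verts A')" using e(2,3) restr_restr[of "verts A'" "(f \<circ> b) ` verts B" C'] by simp
    have "A' \<in> copies L C' A" using embedding_copy[OF eC A C'] unfolding e(2) A'C[symmetric] .
    then obtain i where i: "i < k" "A' \<in> P i" using cover by blast
    note e2 = embedding_factor[OF eC fb sub A B C']
    define e2 where "e2 = inv_into (verts B) (f \<circ> b) \<circ> e"
    have "f ` b ` e2 ` verts A = verts A'"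
      using e2(2) unfolding e(2)[symmetric] e2_def by (simp add: image_image)
    then have g: "good (b ` e2 ` verts A) i" unfolding good_def using i A'C by simp
    have "\<chi> (b ` e2 ` verts A) = c" using bc(3) e2(1) unfolding e2_def by blast
    then have "good (b ` e2 ` verts A) c" using good_\<chi>[OF g] by simp
    then show ?thesis unfolding good_def using \<open>f ` b ` e2 ` verts A = verts A'\<close> A'C by simp
  qed
  then show "\<exists>B'\<in>copies L C' B. \<exists>i<k. copies L B' A \<subseteq> P i" using B' bc(1) by blast
qed

context closure_setting
begin

lemma U_irreducible_in:
  fixes C S :: "('r, 'f, 'v) lstruct"
  assumes C: "U_closed L U C" and S: "substructure L S C" "U_irreducible L U S"
  shows "irreducible_in L U C (verts S)" "S = restr C (verts S)"
proof -
  have Su: "U_closed L U S" using S(2) unfolding U_irreducible_def by simp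
  have "embedding L S C id" using S(1) unfolding substructure_def by simp
  from irreducible_in_image[OF this Su C U_irreducible_unsplit[OF S(2)]] show "irreducible_in L U C (verts S)" by simp
  show "S = restr C (verts S)" using substructure_restr[OF S(1)] by simp
qed

lemma hom_emb_on_U_hom_embedding:
  fixes C :: "('r, 'f, 'v) lstruct"
  assumes C: "U_closed L U C" and h: "hom_emb_on L U C (verts C) H h"
  shows "U_hom_embedding L U C H h"
  unfolding U_hom_embedding_def
proof (intro conjI allI impI)
  show "homomorphism L C H h" using h restr_verts[OF U_closed_structure[OF C]] unfolding hom_emb_on_def by simp
  fix S assume S: "substructure L S C \<and> U_irreducible L U S"
  note i = U_irreducible_in[OF C conjunct1[OF S] conjunct2[OF S]]
  have "embedding L (restr C (verts S)) H h"
    using h i(1) closed_subset[of L U C "verts S"] unfolding hom_emb_on_def irreducible_in_def by simp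
  then show "embedding L S H h" unfolding i(2)[symmetric] .
qed

end

context class_setting
begin

text \<open>Whether \<open>f\<close> is a homomorphism on \<open>S\<close> concerns one edge at a time. Its closure in \<open>C\<close>
  is an irreducible set, hence a member of the class generated by vertices in \<open>S\<close>, and \<open>f\<close>
  extends to an embedding of it. Likewise a \<open>\<U>\<close>-irreducible substructure of \<open>S\<close> is itself
  such a member.\<close>
lemma completable_completion:
  fixes C S :: "('r, 'f, nat) lstruct"
  assumes C: "U_closed L U C" and KC: "\<forall>Z. irreducible_in L U C Z \<longrightarrow> restr C Z \<in> K" and n: "completable L U K C n"
    and S: "substructure L S C" "finite (verts S)" "card (verts S) \<le> n"
  shows "\<exists>E\<in>K. U_completion L U E S"
proof -
  note Cs = U_closed_structure[OF C]
  define X where "X = verts S"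
  have SX: "S = restr C X" and Xc: "is_closed L {} C X" using substructure_restr[OF S(1)] unfolding X_def by auto
  have XC: "X \<subseteq> verts C" by (rule closed_subset[OF Xc])
  obtain E f where E: "E \<in> K" "completes L U K C X E f"
    by (rule completableE[OF n XC S(2)[folded X_def] S(3)[folded X_def]])
  have ext: "\<exists>\<alpha>. embedding L (restr C Z) E \<alpha> \<and> (\<forall>x\<in>Z. x \<in> X \<longrightarrow> \<alpha> x = f x)"
    if Z: "irreducible_in L U C Z" and gen: "\<And>Y. is_closed L U C Y \<Longrightarrow> Z \<inter> X \<subseteq> Y \<Longrightarrow> Z \<subseteq> Y" for Z
  proof -
    have Zc: "is_closed L U C Z" using Z unfolding irreducible_in_def by simp
    have "generates L U (restr C Z) {x \<in> verts (restr C Z). id x \<in> X}"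
      unfolding generates_def
    proof (intro allI impI)
      fix Y assume Y: "is_closed L U (restr C Z) Y \<and> {x \<in> verts (restr C Z). id x \<in> X} \<subseteq> Y"
      then have "is_closed L U C Y" using restr_closed[OF Cs Zc] by simp
      moreover have "Z \<inter> X \<subseteq> Y" using Y by auto
      ultimately show "verts (restr C Z) \<subseteq> Y" using gen by simp
    qed
    from completesE[OF E(2) KC[rule_format, OF Z] restr_embedding[OF Cs Zc] this]
    show ?thesis by (metis id_apply restr_simps(1))
  qed
  have ext_cl: "\<exists>\<alpha>. embedding L (restr C (closure_in L U C T)) E \<alpha> \<and> (\<forall>x\<in>closure_in L U C T. x \<in> X \<longrightarrow> \<alpha> x = f x)"
    if T: "T \<subseteq> X" "irreducible_in L U C (closure_in L U C T)" for T
  proof (rule ext[OF T(2)])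
    fix Y assume Y: "is_closed L U C Y" "closure_in L U C T \<inter> X \<subseteq> Y"
    have "T \<subseteq> closure_in L U C T" using T(1) XC by (intro closure_in_superset) blast
    then show "closure_in L U C T \<subseteq> Y" using T(1) Y by (intro closure_in_least) blast+
  qed
  have "U_hom_embedding L U S E f"
    unfolding U_hom_embedding_def
  proof (intro conjI allI impI)
    show "homomorphism L S E f"
      unfolding homomorphism_iff
    proof (intro conjI ballI allI impI)
      show "f ` verts S \<subseteq> verts E"
      proof
        fix v assume "v \<in> f ` verts S"
        then obtain x where x: "x \<in> X" "v = f x" unfolding X_def by auto
        have xC: "x \<in> verts C" using x XC by blast
        have xZ: "x \<in> closure_in L U C {x}" using closure_in_superset[of "{x}" C L U] xC by simp
        obtain \<alpha> where \<alpha>: "embedding L (restr C (closure_in L U C {x})) E \<alpha>" "\<forall>y\<in>closure_in L U C {x}. y \<in> X \<longrightarrow> \<alpha> y = f y"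
          using ext_cl[of "{x}"] irreducible_in_closure_vertex[OF Cs xC] x by auto
        have "\<alpha> x \<in> verts E" using hom_verts[OF embedding_hom[OF \<alpha>(1)]] xZ by auto
        then show "v \<in> verts E" using \<alpha>(2) xZ x by simp
      qed
    next
      fix R xs assume R: "R \<in> rels L" and "xs \<in> rel S R"
      then have xs: "xs \<in> rel C R" "set xs \<subseteq> X" unfolding SX by auto
      then have e: "edge L C xs" using R unfolding edge_def by blast
      have Z: "set xs \<subseteq> closure_in L U C (set xs)" by (rule closure_in_superset[OF edge_verts[OF Cs e]])
      obtain \<alpha> where \<alpha>: "embedding L (restr C (closure_in L U C (set xs))) E \<alpha>"
        "\<forall>y\<in>closure_in L U C (set xs). y \<in> X \<longrightarrow> \<alpha> y = f y"
        using ext_cl[OF xs(2) irreducible_in_closure_edge[OF Cs e]] by (elim exE conjE)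
      have "map \<alpha> xs \<in> rel E R" by (rule hom_rel[OF embedding_hom[OF \<alpha>(1)] R]) (use xs Z in simp)
      moreover have "map \<alpha> xs = map f xs" using \<alpha>(2) Z xs(2) by auto
      ultimately show "map f xs \<in> rel E R" by simp
    next
      fix F xs y assume F: "F \<in> funs L" and xsy: "fn S F xs = Some y"
      then have xs: "fn C F xs = Some y" "set xs \<subseteq> X" unfolding SX restr_simps by (metis option.distinct(1))+
      have y: "y \<in> X" using closedD[OF Xc rule_fnI[OF F xs(1)] xs(2)] .
      have e: "edge L C xs" using F xs(1) unfolding edge_def by blast
      have Z: "set xs \<subseteq> closure_in L U C (set xs)" by (rule closure_in_superset[OF edge_verts[OF Cs e]])
      have yZ: "y \<in> closure_in L U C (set xs)" by (rule closedD[OF closed_closure_in[OF Cs] rule_fnI[OF F xs(1)] Z])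
      obtain \<alpha> where \<alpha>: "embedding L (restr C (closure_in L U C (set xs))) E \<alpha>"
        "\<forall>y\<in>closure_in L U C (set xs). y \<in> X \<longrightarrow> \<alpha> y = f y"
        using ext_cl[OF xs(2) irreducible_in_closure_edge[OF Cs e]] by (elim exE conjE)
      have "fn E F (map \<alpha> xs) = Some (\<alpha> y)" by (rule hom_fn[OF embedding_hom[OF \<alpha>(1)] F]) (use xs Z in simp)
      moreover have "map \<alpha> xs = map f xs" using \<alpha>(2) Z xs(2) by auto
      ultimately show "fn E F (map f xs) = Some (f y)" using \<alpha>(2) y yZ by simp
    qed
  next
    fix T assume T: "substructure L T S \<and> U_irreducible L U T"
    then have Ts: "is_structure L T" "is_structure L S" "embedding L T S id" and TX: "verts T \<subseteq> X"
      unfolding substructure_def X_def by auto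
    have "embedding L S C id" using S(1) unfolding substructure_def by simp
    then have "embedding L T C id" using embedding_comp[OF Ts(3) _ Ts(1,2) Cs] by simp
    then have TC: "substructure L T C" unfolding substructure_def using Ts(1) Cs TX XC by auto
    note i = U_irreducible_in[OF C TC conjunct2[OF T]]
    have "\<exists>\<alpha>. embedding L (restr C (verts T)) E \<alpha> \<and> (\<forall>x\<in>verts T. x \<in> X \<longrightarrow> \<alpha> x = f x)"
      by (rule ext[OF i(1)]) (use TX in blast)
    then obtain \<alpha> where \<alpha>: "embedding L T E \<alpha>" "\<forall>x\<in>verts T. x \<in> X \<longrightarrow> \<alpha> x = f x"
      unfolding i(2)[symmetric] by (elim exE conjE)
    show "embedding L T E f"
      by (rule embedding_cong[OF \<alpha>(1) _ Ts(1) K_structure[OF E(1)]]) (use \<alpha>(2) TX in blast)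
  qed
  then show ?thesis using E(1) K_irr[OF E(1)] unfolding U_completion_def by blast
qed

end

theorem theorem2p18:
  fixes L :: "('r, 'f) lang"
    and \<R> \<K> :: "('r, 'f, nat) lstruct set"
    and U :: "('r, 'f) closure_descr"
  assumes "is_language L"
    and "ramsey_class L \<R>"
    and "\<And>A. A \<in> \<R> \<Longrightarrow> finite (verts A) \<and> irreducible_structure L A"
    and "closure_description L U"
    and "multiamalgamation_class L \<R> U \<K>"
  shows "ramsey_class L \<K>"
proof -
  note multi = assms(5)[unfolded multiamalgamation_class_def]
  note Kc = multi[THEN conjunct1] and rest1 = multi[THEN conjunct2]
  note KR = rest1[THEN conjunct1] and rest2 = rest1[THEN conjunct2]
  note Kf = rest2[THEN conjunct1] and rest3 = rest2[THEN conjunct2]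
  note Ksub = rest3[THEN conjunct1] and rest4 = rest3[THEN conjunct2]
  note Kam = rest4[THEN conjunct1] and Kcompl = rest4[THEN conjunct2]
  interpret base: closure_setting L U by unfold_locales (rule assms(1) assms(4))+
  interpret class_setting L U \<K>
  proof unfold_locales
    show "B \<in> \<K>" if "A \<in> \<K>" "is_structure L B" "isomorphic L A B" for A B
      using Kc that unfolding structure_class_def by blast
    show "finite (verts A)" "U_closed L U A" if "A \<in> \<K>" for A using Kf that by simp_all
    show "irreducible_structure L A" if "A \<in> \<K>" for A using assms(3) KR that by blast
    show "restr A X \<in> \<K>" if "A \<in> \<K>" "is_closed L U A X" for A X
    proof -
      have "U_closed L U A" using Kf that(1) by simp
      then have "substructure L (restr A X) A" "U_closed L U (restr A X)"
        using restr_substructure[OF U_closed_structure that(2)] base.restr_U_closed that(2) by blast+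
      then show ?thesis using Ksub that(1) by blast
    qed
    show "\<exists>C\<in>\<K>. \<exists>\<beta>1 \<beta>2. embedding L B1 C \<beta>1 \<and> embedding L B2 C \<beta>2 \<and> (\<forall>x\<in>verts A. \<beta>1 (\<alpha>1 x) = \<beta>2 (\<alpha>2 x))"
      if "A \<in> \<K>" "B1 \<in> \<K>" "B2 \<in> \<K>" "embedding L A B1 \<alpha>1" "embedding L A B2 \<alpha>2" for A B1 B2 \<alpha>1 \<alpha>2
      using Kam[rule_format, OF that(1-3) conjI[OF that(4,5)]] unfolding strong_amalgamation_def by (elim bexE exE conjE) (intro bexI exI conjI)
  qed
  have "\<exists>C'\<in>\<K>. ramsey_arrow L C' B A k" if A: "A \<in> \<K>" and B: "B \<in> \<K>" and k: "k \<ge> 1" for A B and k :: nat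
  proof -
    note As = K_structure[OF A] and Bs = K_structure[OF B]
    have "A \<in> \<R>" "B \<in> \<R>" using A B KR by auto
    then obtain C0 where C0: "C0 \<in> \<R>" "ramsey_arrow L C0 B A k"
      using assms(2) k unfolding ramsey_class_def by meson
    have C0i: "finite (verts C0)" "irreducible_structure L C0" using assms(3)[OF C0(1)] by auto
    then have C0s: "is_structure L C0" unfolding irreducible_structure_def by (elim conjE)
    from Kcompl[rule_format, OF B C0(1)] obtain n where n: "\<forall>C :: ('r, 'f, nat) lstruct.
        U_closed L U C \<and> U_completion L U C0 C \<and>
        (\<forall>S. substructure L S C \<and> U_irreducible L U S \<longrightarrow> S \<in> \<K>) \<and>
        (\<forall>S. substructure L S C \<and> finite (verts S) \<and> card (verts S) \<le> n \<longrightarrow> (\<exists>C'\<in>\<K>. U_completion L U C' S)) \<longrightarrow>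
        (\<exists>C'\<in>\<K>. completion_wrt_copies L C' C B)" by (elim exE)
    have "\<exists>C. ramsey_witness A B k C0 n C"
      by (rule ramsey_witness_exists[OF A B C0s C0i(1) set_arrow_of_ramsey_arrow[OF C0(2) As Bs C0s]]) (use k in simp)
    then obtain C where "ramsey_witness A B k C0 n C" ..
    then have Cu: "U_closed L U C" and arrow: "set_arrow L C B A k" and hC: "\<exists>h. hom_emb_on L U C (verts C) C0 h"
      and KC: "\<forall>Z. irreducible_in L U C Z \<longrightarrow> restr C Z \<in> \<K>" and Cn: "completable L U \<K> C n"
      unfolding ramsey_witness_def by auto
    obtain h where "hom_emb_on L U C (verts C) C0 h" using hC ..
    then have "U_completion L U C0 C"
      unfolding U_completion_def using C0i(2) base.hom_emb_on_U_hom_embedding[OF Cu] by blast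
    moreover have "S \<in> \<K>" if "substructure L S C" "U_irreducible L U S" for S
      using base.U_irreducible_in[OF Cu that] KC by metis
    moreover have "\<exists>C'\<in>\<K>. U_completion L U C' S"
      if "substructure L S C" "finite (verts S)" "card (verts S) \<le> n" for S
      by (rule completable_completion[OF Cu KC Cn that])
    ultimately have "\<exists>C'\<in>\<K>. completion_wrt_copies L C' C B" using n Cu by simp
    then obtain C' where "C' \<in> \<K>" "completion_wrt_copies L C' C B" by (elim bexE)
    then show ?thesis using ramsey_arrow_of_completion[OF arrow k _ As Bs U_closed_structure[OF Cu]] by blast
  qed
  then show ?thesis unfolding ramsey_class_def using Kc by blast
qed

end
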